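(* Let $(M,\Sigma,g_c)$ be a sub-Riemannian manifold with $\Sigma$ regular and $M$ connected, and let $\Omega\subset M$ be an n-convex open subset. If an n-convex function $f:\Omega\to\mathbb{R}$ is locally bounded above, then $f$ is locally Lipschitz continuous with respect to $d_c$ and with respect to $d_{\mathcal H}$; that is, for each of $d\in\{d_c,d_{\mathcal H}\}$, every point of $\Omega$ has a neighborhood $U\subset\Omega$ and a constant $L$ such that $|f(p)-f(q)|\le L\,d(p,q)$ for all $p,q\in U$.
   Context: A sub-Riemannian manifold $(M,\Sigma,g_c)$ is a smooth manifold $M$ of dimension $m$ with a smooth (non-integrable) distribution $\Sigma\subset TM$ of rank $k<m$ and a smooth inner product $g_c$ on $\Sigma$. Throughout, $g_c=g|_\Sigma$ for a fixed Riemannian metric $g$ on $M$, $TM=\Sigma\oplus\Sigma^\perp$ is the $g$-orthogonal decomposition, $\mathcal P$ is the projection onto $\Sigma$, and $\nabla$ is the Levi-Civita connection of $g$. The horizontal connection is $D_XY:=\mathcal P(\nabla_XY)$ for $X,Y\in\Gamma(\Sigma)$ (smooth sections of $\Sigma$); it induces differentiation of horizontal vector fields along horizontal curves. A piecewise smooth curve $\gamma$ is horizontal if $\dot\gamma(t)\in\Sigma_{\gamma(t)}$ for a.e. $t$; its length is $\ell(\gamma)=\int\sqrt{g_c(\dot\gamma,\dot\gamma)}\,dt$. A nonholonomic geodesic is a smooth horizontal curve with $D_{\dot\gamma}\dot\gamma=\mathcal P(\nabla_{\dot\gamma}\dot\gamma)=0$. A broken geodesic is a continuous horizontal curve consisting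 of finitely many segments each of which is a nonholonomic geodesic. Let $\Sigma_i$ be the set of vector fields spanned by all iterated commutators of order $\le i$ of vector fields in $\Sigma$, and $\Sigma_i(p)\subset T_pM$ the subspace of their values at $p$. $\Sigma$ is bracket generating if for every $p$ there is an integer $l(p)$ with $\Sigma_{l(p)}(p)=T_pM$; the least such integer is the degree at $p$. $\Sigma$ is regular at $p$ if it is bracket generating and, with $l$ the degree, $\dim\Sigma_i(\cdot)$ is constant in a neighborhood of $p$ for all $i\le l$; $\Sigma$ is regular if it is regular at every point. For $p,q\in M$, $d_c(p,q)$ (the Carnot-Carathéodory distance) is the infimum of lengths of horizontal curves joining $p$ to $q$, and $d_{\mathcal H}(p,q)$ is the infimum of lengths of broken geodesics joining $p$ to $q$. A subset $\Omega\subset M$ is n-convex if, whenever $p,q\in\Omega$ and there exists a nonholonomic geodesic connecting them, its segment between $p$ and $q$ lies in $\Omega$. A function $f$ on an n-convex set $\Omega$ is n-convex if $f\circ\gamma$ is convex for every nonholonomic geodesic $\gamma$ contained in $\Omega$. *)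

theory Defs
  imports "HOL-Analysis.Analysis"
begin

section \<open>Smooth maps\<close>

(* The derivatives are taken within S.  This is used only for open S and for relatively open
   subsets of nondegenerate real intervals, where the derivative within S is unique: on open sets it
   is the ordinary derivative, at an endpoint of an interval it is the one-sided derivative. *)
primrec Ck_on :: "nat \<Rightarrow> 'a::real_normed_vector set \<Rightarrow> ('a \<Rightarrow> 'b::real_normed_vector) \<Rightarrow> bool" where
  "Ck_on 0 S f \<longleftrightarrow> continuous_on S f"
| "Ck_on (Suc k) S f \<longleftrightarrow>
     f differentiable_on S \<and> (\<forall>v. Ck_on k S (\<lambda>x. frechet_derivative f (at x within S) v))"

definition smooth_on :: "'a::real_normed_vector set \<Rightarrow> ('a \<Rightarrow> 'b::real_normed_vector) \<Rightarrow> bool" where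
  "smooth_on S f \<longleftrightarrow> (\<forall>k. Ck_on k S f)"

section \<open>Smooth manifolds and tangent vectors\<close>

(* The manifold is the whole type 'm, a second countable Hausdorff space; its dimension is DIM('e).
   A chart is a pair of its domain and its coordinate map. *)
type_synonym ('m, 'e) chart = "'m set \<times> ('m \<Rightarrow> 'e)"

definition chart_inv :: "('m, 'e) chart \<Rightarrow> 'e \<Rightarrow> 'm" where
  "chart_inv c = inv_into (fst c) (snd c)"

definition smooth_atlas ::
  "('m::{t2_space,second_countable_topology}, 'e::euclidean_space) chart set \<Rightarrow> bool" where
  "smooth_atlas A \<longleftrightarrow>
     (\<Union>c\<in>A. fst c) = UNIV \<and>
     (\<forall>c\<in>A. open (fst c) \<and> open (snd c ` fst c) \<and>
        homeomorphism (fst c) (snd c ` fst c) (snd c) (chart_inv c)) \<and>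
     (\<forall>c\<in>A. \<forall>d\<in>A. smooth_on (snd c ` (fst c \<inter> fst d)) (snd d \<circ> chart_inv c))"

definition chart_at :: "('m, 'e) chart set \<Rightarrow> 'm \<Rightarrow> ('m, 'e) chart" where
  "chart_at A p = (SOME c. c \<in> A \<and> p \<in> fst c)"

(* The tangent space at p is the model space 'e, identified with T_pM by the chart  chart_at A p :
   a tangent vector at p is stored as its coordinate vector in that chart.  Its coordinates in an
   arbitrary chart c around p are given by  to_coord , and  of_coord  is the inverse map; both are
   the derivative of the change of coordinates. *)
definition to_coord ::
  "('m, 'e::euclidean_space) chart set \<Rightarrow> ('m, 'e) chart \<Rightarrow> 'm \<Rightarrow> 'e \<Rightarrow> 'e" where
  "to_coord A c p v =
     frechet_derivative (snd c \<circ> chart_inv (chart_at A p)) (at (snd (chart_at A p) p)) v"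

definition of_coord ::
  "('m, 'e::euclidean_space) chart set \<Rightarrow> ('m, 'e) chart \<Rightarrow> 'm \<Rightarrow> 'e \<Rightarrow> 'e" where
  "of_coord A c p v =
     frechet_derivative (snd (chart_at A p) \<circ> chart_inv c) (at (snd c p)) v"

definition field_coord ::
  "('m, 'e::euclidean_space) chart set \<Rightarrow> ('m, 'e) chart \<Rightarrow> ('m \<Rightarrow> 'e) \<Rightarrow> 'e \<Rightarrow> 'e" where
  "field_coord A c X x = to_coord A c (chart_inv c x) (X (chart_inv c x))"

definition smooth_field_on ::
  "('m, 'e::euclidean_space) chart set \<Rightarrow> 'm set \<Rightarrow> ('m \<Rightarrow> 'e) \<Rightarrow> bool" where
  "smooth_field_on A U X \<longleftrightarrow> (\<forall>c\<in>A. smooth_on (snd c ` (fst c \<inter> U)) (field_coord A c X))"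

(* [X,Y] = DY(X) - DX(Y) in coordinates; the chart  chart_at A p  is the one in which tangent vectors
   at p are stored, so no conversion is needed. *)
definition lie_bracket ::
  "('m, 'e::euclidean_space) chart set \<Rightarrow> ('m \<Rightarrow> 'e) \<Rightarrow> ('m \<Rightarrow> 'e) \<Rightarrow> 'm \<Rightarrow> 'e" where
  "lie_bracket A X Y p =
     (let c = chart_at A p; x = snd c p in
        frechet_derivative (field_coord A c Y) (at x) (X p)
        - frechet_derivative (field_coord A c X) (at x) (Y p))"

section \<open>Riemannian metrics and the Levi-Civita connection\<close>

definition metric_coord ::
  "('m, 'e::euclidean_space) chart set \<Rightarrow> ('m \<Rightarrow> 'e \<Rightarrow> 'e \<Rightarrow> real) \<Rightarrow> ('m, 'e) chart
    \<Rightarrow> 'e \<Rightarrow> 'e \<Rightarrow> 'e \<Rightarrow> real" where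
  "metric_coord A g c x u v =
     (let p = chart_inv c x in g p (of_coord A c p u) (of_coord A c p v))"

definition riemannian_metric ::
  "('m, 'e::euclidean_space) chart set \<Rightarrow> ('m \<Rightarrow> 'e \<Rightarrow> 'e \<Rightarrow> real) \<Rightarrow> bool" where
  "riemannian_metric A g \<longleftrightarrow>
     (\<forall>p. bilinear (g p) \<and> (\<forall>u v. g p u v = g p v u) \<and> (\<forall>v. v \<noteq> 0 \<longrightarrow> g p v v > 0)) \<and>
     (\<forall>c\<in>A. \<forall>u v. smooth_on (snd c ` fst c) (\<lambda>x. metric_coord A g c x u v))"

(* The Levi-Civita connection of g in the chart c, as the map (u,v) \<mapsto> \<nabla>_u v on vector fields with
   constant coordinates (the Christoffel symbols): the unique bilinear map that is torsion-free,
   i.e. symmetric, and compatible with g, i.e. u g(v,w) = g(\<nabla>_u v, w) + g(v, \<nabla>_u w). *)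
definition levi_civita ::
  "('m, 'e::euclidean_space) chart set \<Rightarrow> ('m \<Rightarrow> 'e \<Rightarrow> 'e \<Rightarrow> real) \<Rightarrow> ('m, 'e) chart
    \<Rightarrow> 'e \<Rightarrow> 'e \<Rightarrow> 'e \<Rightarrow> 'e" where
  "levi_civita A g c x =
     (THE \<Gamma>. bilinear \<Gamma> \<and> (\<forall>u v. \<Gamma> u v = \<Gamma> v u) \<and>
        (\<forall>u v w. frechet_derivative (\<lambda>y. metric_coord A g c y v w) (at x) u =
           metric_coord A g c x (\<Gamma> u v) w + metric_coord A g c x v (\<Gamma> u w)))"

section \<open>Curves\<close>

definition smooth_curve ::
  "('m::topological_space, 'e::euclidean_space) chart set \<Rightarrow> real set \<Rightarrow> (real \<Rightarrow> 'm) \<Rightarrow> bool" where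
  "smooth_curve A J \<gamma> \<longleftrightarrow>
     is_interval J \<and> interior J \<noteq> {} \<and> continuous_on J \<gamma> \<and>
     (\<forall>c\<in>A. smooth_on (J \<inter> \<gamma> -` fst c) (snd c \<circ> \<gamma>))"

definition velocity ::
  "('m, 'e::euclidean_space) chart set \<Rightarrow> real set \<Rightarrow> (real \<Rightarrow> 'm) \<Rightarrow> real \<Rightarrow> 'e" where
  "velocity A J \<gamma> t = vector_derivative (snd (chart_at A (\<gamma> t)) \<circ> \<gamma>) (at t within J)"

(* \<nabla>_{\<gamma>'} V for a vector field V along \<gamma>, in coordinates V' + \<Gamma>(\<gamma>', V). *)
definition cov_deriv_along ::
  "('m, 'e::euclidean_space) chart set \<Rightarrow> ('m \<Rightarrow> 'e \<Rightarrow> 'e \<Rightarrow> real) \<Rightarrow> real set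
    \<Rightarrow> (real \<Rightarrow> 'm) \<Rightarrow> (real \<Rightarrow> 'e) \<Rightarrow> real \<Rightarrow> 'e" where
  "cov_deriv_along A g J \<gamma> V t =
     (let c = chart_at A (\<gamma> t) in
        vector_derivative (\<lambda>s. to_coord A c (\<gamma> s) (V s)) (at t within J)
        + levi_civita A g c (snd c (\<gamma> t)) (velocity A J \<gamma> t) (V t))"

definition piecewise :: "(real set \<Rightarrow> bool) \<Rightarrow> real \<Rightarrow> real \<Rightarrow> bool" where
  "piecewise Q a b \<longleftrightarrow>
     (\<exists>(n::nat) s. s 0 = a \<and> s n = b \<and> (\<forall>i<n. s i < s (Suc i) \<and> Q {s i..s (Suc i)}))"

definition curve_length ::
  "('m, 'e::euclidean_space) chart set \<Rightarrow> ('m \<Rightarrow> 'e \<Rightarrow> 'e \<Rightarrow> real) \<Rightarrow> real \<Rightarrow> real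
    \<Rightarrow> (real \<Rightarrow> 'm) \<Rightarrow> real" where
  "curve_length A g a b \<gamma> =
     integral {a..b} (\<lambda>t. sqrt (g (\<gamma> t) (velocity A {a..b} \<gamma> t) (velocity A {a..b} \<gamma> t)))"

section \<open>Distributions\<close>

definition distribution ::
  "('m::topological_space, 'e::euclidean_space) chart set \<Rightarrow> nat \<Rightarrow> ('m \<Rightarrow> 'e set) \<Rightarrow> bool" where
  "distribution A k \<Sigma> \<longleftrightarrow>
     (\<forall>p. subspace (\<Sigma> p) \<and> dim (\<Sigma> p) = k) \<and>
     (\<forall>p. \<exists>U X. open U \<and> p \<in> U \<and> (\<forall>i<k. smooth_field_on A U (X i)) \<and>
        (\<forall>q\<in>U. \<Sigma> q = span ((\<lambda>i. X i q) ` {..<k})))"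

(* Complete integrability: around every point there are smooth coordinates in which the distribution
   is a constant subspace W.  The condition on  insert c A  says that c belongs to the smooth
   structure determined by A. *)
definition integrable_distribution ::
  "('m::{t2_space,second_countable_topology}, 'e::euclidean_space) chart set
    \<Rightarrow> ('m \<Rightarrow> 'e set) \<Rightarrow> bool" where
  "integrable_distribution A \<Sigma> \<longleftrightarrow>
     (\<forall>p. \<exists>c W. smooth_atlas (insert c A) \<and> p \<in> fst c \<and> subspace W \<and>
        (\<forall>q\<in>fst c. to_coord A c q ` \<Sigma> q = W))"

definition horizontal_field ::
  "('m, 'e::euclidean_space) chart set \<Rightarrow> ('m \<Rightarrow> 'e set) \<Rightarrow> ('m \<Rightarrow> 'e) \<Rightarrow> bool" where
  "horizontal_field A \<Sigma> X \<longleftrightarrow> smooth_field_on A UNIV X \<and> (\<forall>p. X p \<in> \<Sigma> p)"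

(* iterated commutators [X1,[X2,...[X(i-1),Xi]...]] of order i; order 1 is a horizontal field itself *)
inductive commutator ::
  "('m, 'e::euclidean_space) chart set \<Rightarrow> ('m \<Rightarrow> 'e set) \<Rightarrow> nat \<Rightarrow> ('m \<Rightarrow> 'e) \<Rightarrow> bool"
  for A \<Sigma> where
  field: "horizontal_field A \<Sigma> X \<Longrightarrow> commutator A \<Sigma> 1 X"
| bracket: "horizontal_field A \<Sigma> X \<Longrightarrow> commutator A \<Sigma> i Y
    \<Longrightarrow> commutator A \<Sigma> (Suc i) (lie_bracket A X Y)"

(* \<Sigma>_i(p): the values at p of the fields spanned by the commutators of order at most i, which is
   the span of the values at p *)
definition flag ::
  "('m, 'e::euclidean_space) chart set \<Rightarrow> ('m \<Rightarrow> 'e set) \<Rightarrow> nat \<Rightarrow> 'm \<Rightarrow> 'e set" where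
  "flag A \<Sigma> i p = span {X p |X j. j \<le> i \<and> commutator A \<Sigma> j X}"

definition bracket_generating ::
  "('m, 'e::euclidean_space) chart set \<Rightarrow> ('m \<Rightarrow> 'e set) \<Rightarrow> bool" where
  "bracket_generating A \<Sigma> \<longleftrightarrow> (\<forall>p. \<exists>l. flag A \<Sigma> l p = UNIV)"

definition degree_at ::
  "('m, 'e::euclidean_space) chart set \<Rightarrow> ('m \<Rightarrow> 'e set) \<Rightarrow> 'm \<Rightarrow> nat" where
  "degree_at A \<Sigma> p = (LEAST l. flag A \<Sigma> l p = UNIV)"

definition regular_at ::
  "('m::topological_space, 'e::euclidean_space) chart set \<Rightarrow> ('m \<Rightarrow> 'e set) \<Rightarrow> 'm \<Rightarrow> bool" where
  "regular_at A \<Sigma> p \<longleftrightarrow> bracket_generating A \<Sigma> \<and>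
     (\<exists>U. open U \<and> p \<in> U \<and>
        (\<forall>i\<le>degree_at A \<Sigma> p. \<forall>q\<in>U. dim (flag A \<Sigma> i q) = dim (flag A \<Sigma> i p)))"

definition regular_distribution ::
  "('m::topological_space, 'e::euclidean_space) chart set \<Rightarrow> ('m \<Rightarrow> 'e set) \<Rightarrow> bool" where
  "regular_distribution A \<Sigma> \<longleftrightarrow> (\<forall>p. regular_at A \<Sigma> p)"

section \<open>Sub-Riemannian manifolds\<close>

(* The inner product g_c on \<Sigma> is the restriction of the Riemannian metric g, which is part of the
   data because the horizontal connection depends on it. *)
definition sub_riemannian_manifold ::
  "('m::{t2_space,second_countable_topology}, 'e::euclidean_space) chart set
    \<Rightarrow> ('m \<Rightarrow> 'e \<Rightarrow> 'e \<Rightarrow> real) \<Rightarrow> nat \<Rightarrow> ('m \<Rightarrow> 'e set) \<Rightarrow> bool" where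
  "sub_riemannian_manifold A g k \<Sigma> \<longleftrightarrow>
     smooth_atlas A \<and> riemannian_metric A g \<and> k < DIM('e) \<and> distribution A k \<Sigma> \<and>
     \<not> integrable_distribution A \<Sigma>"

definition horizontal_proj ::
  "('m \<Rightarrow> 'e::euclidean_space \<Rightarrow> 'e \<Rightarrow> real) \<Rightarrow> ('m \<Rightarrow> 'e set) \<Rightarrow> 'm \<Rightarrow> 'e \<Rightarrow> 'e" where
  "horizontal_proj g \<Sigma> p v = (THE w. w \<in> \<Sigma> p \<and> (\<forall>z\<in>\<Sigma> p. g p (v - w) z = 0))"

definition horizontal_deriv_along ::
  "('m, 'e::euclidean_space) chart set \<Rightarrow> ('m \<Rightarrow> 'e \<Rightarrow> 'e \<Rightarrow> real) \<Rightarrow> ('m \<Rightarrow> 'e set)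
    \<Rightarrow> real set \<Rightarrow> (real \<Rightarrow> 'm) \<Rightarrow> (real \<Rightarrow> 'e) \<Rightarrow> real \<Rightarrow> 'e" where
  "horizontal_deriv_along A g \<Sigma> J \<gamma> V t =
     horizontal_proj g \<Sigma> (\<gamma> t) (cov_deriv_along A g J \<gamma> V t)"

definition nonholonomic_geodesic ::
  "('m::topological_space, 'e::euclidean_space) chart set \<Rightarrow> ('m \<Rightarrow> 'e \<Rightarrow> 'e \<Rightarrow> real)
    \<Rightarrow> ('m \<Rightarrow> 'e set) \<Rightarrow> real set \<Rightarrow> (real \<Rightarrow> 'm) \<Rightarrow> bool" where
  "nonholonomic_geodesic A g \<Sigma> J \<gamma> \<longleftrightarrow>
     smooth_curve A J \<gamma> \<and>
     (\<forall>t\<in>J. velocity A J \<gamma> t \<in> \<Sigma> (\<gamma> t)) \<and>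
     (\<forall>t\<in>J. horizontal_deriv_along A g \<Sigma> J \<gamma> (velocity A J \<gamma>) t = 0)"

definition horizontal_curve ::
  "('m::topological_space, 'e::euclidean_space) chart set \<Rightarrow> ('m \<Rightarrow> 'e set)
    \<Rightarrow> real \<Rightarrow> real \<Rightarrow> (real \<Rightarrow> 'm) \<Rightarrow> bool" where
  "horizontal_curve A \<Sigma> a b \<gamma> \<longleftrightarrow>
     a < b \<and> continuous_on {a..b} \<gamma> \<and> piecewise (\<lambda>J. smooth_curve A J \<gamma>) a b \<and>
     (AE t in lborel. t \<in> {a..b} \<longrightarrow> velocity A {a..b} \<gamma> t \<in> \<Sigma> (\<gamma> t))"

definition broken_geodesic ::
  "('m::topological_space, 'e::euclidean_space) chart set \<Rightarrow> ('m \<Rightarrow> 'e \<Rightarrow> 'e \<Rightarrow> real)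
    \<Rightarrow> ('m \<Rightarrow> 'e set) \<Rightarrow> real \<Rightarrow> real \<Rightarrow> (real \<Rightarrow> 'm) \<Rightarrow> bool" where
  "broken_geodesic A g \<Sigma> a b \<gamma> \<longleftrightarrow>
     horizontal_curve A \<Sigma> a b \<gamma> \<and> piecewise (\<lambda>J. nonholonomic_geodesic A g \<Sigma> J \<gamma>) a b"

(* Both distances take values in the extended reals: the infimum over the empty set is \<infinity>. *)
definition dist_cc ::
  "('m::topological_space, 'e::euclidean_space) chart set \<Rightarrow> ('m \<Rightarrow> 'e \<Rightarrow> 'e \<Rightarrow> real)
    \<Rightarrow> ('m \<Rightarrow> 'e set) \<Rightarrow> 'm \<Rightarrow> 'm \<Rightarrow> ereal" where
  "dist_cc A g \<Sigma> p q =
     Inf {ereal (curve_length A g a b \<gamma>) |a b \<gamma>. horizontal_curve A \<Sigma> a b \<gamma> \<and> \<gamma> a = p \<and> \<gamma> b = q}"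

definition dist_H ::
  "('m::topological_space, 'e::euclidean_space) chart set \<Rightarrow> ('m \<Rightarrow> 'e \<Rightarrow> 'e \<Rightarrow> real)
    \<Rightarrow> ('m \<Rightarrow> 'e set) \<Rightarrow> 'm \<Rightarrow> 'm \<Rightarrow> ereal" where
  "dist_H A g \<Sigma> p q =
     Inf {ereal (curve_length A g a b \<gamma>) |a b \<gamma>. broken_geodesic A g \<Sigma> a b \<gamma> \<and> \<gamma> a = p \<and> \<gamma> b = q}"

section \<open>Convexity along nonholonomic geodesics\<close>

definition n_convex_set ::
  "('m::topological_space, 'e::euclidean_space) chart set \<Rightarrow> ('m \<Rightarrow> 'e \<Rightarrow> 'e \<Rightarrow> real)
    \<Rightarrow> ('m \<Rightarrow> 'e set) \<Rightarrow> 'm set \<Rightarrow> bool" where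
  "n_convex_set A g \<Sigma> \<Omega> \<longleftrightarrow>
     (\<forall>J \<gamma> s t. nonholonomic_geodesic A g \<Sigma> J \<gamma> \<and> s \<in> J \<and> t \<in> J \<and> s \<le> t \<and> \<gamma> s \<in> \<Omega> \<and> \<gamma> t \<in> \<Omega>
        \<longrightarrow> \<gamma> ` {s..t} \<subseteq> \<Omega>)"

definition n_convex_fun ::
  "('m::topological_space, 'e::euclidean_space) chart set \<Rightarrow> ('m \<Rightarrow> 'e \<Rightarrow> 'e \<Rightarrow> real)
    \<Rightarrow> ('m \<Rightarrow> 'e set) \<Rightarrow> 'm set \<Rightarrow> ('m \<Rightarrow> real) \<Rightarrow> bool" where
  "n_convex_fun A g \<Sigma> \<Omega> f \<longleftrightarrow>
     (\<forall>J \<gamma>. nonholonomic_geodesic A g \<Sigma> J \<gamma> \<and> \<gamma> ` J \<subseteq> \<Omega> \<longrightarrow> convex_on J (f \<circ> \<gamma>))"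

definition locally_bounded_above_on :: "'m::topological_space set \<Rightarrow> ('m \<Rightarrow> real) \<Rightarrow> bool" where
  "locally_bounded_above_on \<Omega> f \<longleftrightarrow>
     (\<forall>p\<in>\<Omega>. \<exists>U K. open U \<and> p \<in> U \<and> (\<forall>x\<in>U \<inter> \<Omega>. f x \<le> K))"

definition locally_lipschitz_wrt ::
  "('m::topological_space \<Rightarrow> 'm \<Rightarrow> ereal) \<Rightarrow> 'm set \<Rightarrow> ('m \<Rightarrow> real) \<Rightarrow> bool" where
  "locally_lipschitz_wrt d \<Omega> f \<longleftrightarrow>
     (\<forall>x\<in>\<Omega>. \<exists>U (L::real). open U \<and> x \<in> U \<and> U \<subseteq> \<Omega> \<and>
        (\<forall>p\<in>U. \<forall>q\<in>U. ereal \<bar>f p - f q\<bar> \<le> ereal L * d p q))"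

end

theory Submission
  imports Defs
begin

text \<open>
  Why the theorem holds.  Fix a point of \<open>\<Omega>\<close>, a chart around it and a constant \<open>K\<close> with \<open>f < K\<close> nearby.  Along a
  geodesic that lives on a time interval \<open>[-T, T]\<close> the function \<open>K - f\<close> is concave and positive, hence
  \<open>\<phi> = ln (K - f)\<close> changes by at most \<open>2 \<bar>t\<bar> / T\<close> between the times \<open>0\<close> and \<open>t\<close>
  if \<open>\<bar>t\<bar> \<le> T / 2\<close> (\<open>convex_log_bound\<close>).  Close to the
  point all geodesics of bounded initial speed exist for a common time \<open>T\<close>, so \<open>\<phi>\<close> varies at a bounded rate along
  short geodesic steps, whatever their starting point and direction.  Working with the logarithm makes an upper
  bound of \<open>f\<close> sufficient; a lower bound comes out at the end.

  This rate bound alone does not even make \<open>\<phi>\<close> continuous, since geodesics only leave a point in horizontal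
  directions.  Continuity is a version of the Chow-Rashevskii theorem (\<open>tangential_span_imp_continuous\<close>).  Call a
  vector attainable at a point if it is the velocity of a continuous deformation of the identity along which \<open>\<phi>\<close> changes by at
  most \<open>\<epsilon>\<close>.  Horizontal vectors are attainable.  Conjugating a deformation with a short geodesic step shows that the
  span of the attainable vectors is almost invariant under steps, and differentiating at step length zero
  puts the brackets of horizontal fields with attainable fields into the span (\<open>tangential_bracket\<close>).  When the span
  is the whole tangent space, composed deformations cover a neighbourhood of the point, by an open mapping theorem
  based on Brouwer's theorem, and on it \<open>\<phi>\<close> differs from its value at the point by a multiple of \<open>\<epsilon>\<close>.  The only
  property of the steps that enters is that they are flows to first order: their derivative in the starting point
  is the identity plus \<open>t\<close> times the derivative of the field.

  Once \<open>\<phi>\<close> is continuous, an arbitrary horizontal curve can be replaced by a chain of short geodesic steps with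
  the same controls.  The chain ends arbitrarily close to the end of the curve and has almost the same length, so \<open>\<phi>\<close>
  changes along the curve by at most a constant times its length (\<open>slow_along_horizontal_curve\<close>).  A curve
  between two points near the centre either stays in the chart neighbourhood, or leaves it and then has a
  length bounded below (\<open>first_exit\<close>); in both cases \<open>\<bar>f p - f q\<bar>\<close> is at most a constant times the length.  Taking
  the infimum gives the claim for the Carnot-Caratheodory distance, and the distance by broken geodesics is at least as large.

  The geodesics are constructed in coordinates.  With an orthonormal frame \<open>Z\<^sub>0, ..., Z\<^sub>k\<^sub>-\<^sub>1\<close> of \<open>\<Sigma>\<close> from the
  Gram-Schmidt process, a horizontal velocity is a combination of the \<open>Z\<^sub>i\<close>, and the geodesic equation becomes a smooth
  first-order system for the position and the coefficients (\<open>geodesic_solution\<close>).  Picard iteration solves it, and the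
  variational equation gives the derivative in the initial condition (\<open>flow_differentiable\<close>).  Velocities are stored
  in a chart that may change from point to point, which is why brackets and accelerations are shown to be
  independent of the chart (\<open>lie_bracket_coord\<close>, \<open>acceleration_covariant\<close>).
\<close>

section \<open>Calculus of \<open>C\<^sup>k\<close> maps\<close>

text \<open>On such sets derivatives within the set are unique.  Open sets and nondegenerate intervals qualify, and so do
  their relatively open subsets, such as the times at which a curve is in a given chart.\<close>

definition thick :: "'a::euclidean_space set \<Rightarrow> bool" where
  "thick S \<longleftrightarrow> (\<forall>x\<in>S. \<forall>i\<in>Basis. \<forall>e>0. \<exists>d. 0 < \<bar>d\<bar> \<and> \<bar>d\<bar> < e \<and> x + d *\<^sub>R i \<in> S)"

lemma thick_openin:
  assumes "thick S" "openin (top_of_set S) T"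
  shows "thick T"
  unfolding thick_def
proof (intro ballI allI impI)
  fix x i and e :: real
  assume x: "x \<in> T" and i: "i \<in> (Basis :: 'a set)" and e: "e > 0"
  obtain r where r: "r > 0" "\<And>y. y \<in> S \<Longrightarrow> dist y x < r \<Longrightarrow> y \<in> T" and TS: "T \<subseteq> S"
    using assms(2) x unfolding openin_euclidean_subtopology_iff by metis
  obtain d where d: "0 < \<bar>d\<bar>" "\<bar>d\<bar> < min e r" "x + d *\<^sub>R i \<in> S"
    using assms(1) x TS i e r(1) unfolding thick_def by (metis min_less_iff_conj subsetD)
  moreover have "dist (x + d *\<^sub>R i) x < r"
    using d i by (simp add: dist_norm)
  ultimately show "\<exists>d. 0 < \<bar>d\<bar> \<and> \<bar>d\<bar> < e \<and> x + d *\<^sub>R i \<in> T"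
    using r(2) by (metis min_less_iff_conj)
qed

lemma open_thick: "open S \<Longrightarrow> thick S"
proof (rule thick_openin[of UNIV])
  have "\<exists>d::real. 0 < \<bar>d\<bar> \<and> \<bar>d\<bar> < e" if "e > 0" for e
    using that by (intro exI[of _ "e/2"]) auto
  then show "thick (UNIV::'a set)" by (auto simp: thick_def)
qed auto

lemma thick_interval:
  fixes J :: "real set"
  assumes "is_interval J" "interior J \<noteq> {}"
  shows "thick J"
  unfolding thick_def
proof (intro ballI allI impI)
  fix x i e :: real
  assume x: "x \<in> J" and i: "i \<in> Basis" and e: "e > 0"
  obtain z r where z: "r > 0" "ball z r \<subseteq> J"
    using assms(2) by (meson all_not_in_conv mem_interior)
  define y where "y = (if z = x then z + r/2 else z)"
  have y: "y \<in> J" "y \<noteq> x" using z by (auto simp: y_def subset_eq dist_real_def)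
  define s where "s = min (1/2) (e / (2 * \<bar>y - x\<bar>))"
  have s: "0 < s" "s < 1" using y e by (auto simp: s_def)
  have "s * \<bar>y - x\<bar> \<le> e / 2"
    using y mult_right_mono[of s "e / (2 * \<bar>y - x\<bar>)" "\<bar>y - x\<bar>"] by (auto simp: s_def field_simps)
  hence "\<bar>s * (y - x)\<bar> < e" using s e by (simp add: abs_mult)
  moreover have "x + s * (y - x) \<in> J"
    using mem_is_intervalI[OF assms(1), of x y "x + s * (y - x)"] x y s
    by (smt (verit) assms(1) is_interval_1 mult_left_le_one_le mult_less_cancel_right2 zero_less_mult_iff mult_pos_neg)
  ultimately show "\<exists>d. 0 < \<bar>d\<bar> \<and> \<bar>d\<bar> < e \<and> x + d *\<^sub>R i \<in> J"
    using i s y by (intro exI[of _ "s * (y - x)"]) auto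
qed

lemma frechet_derivative_eq_on_thick:
  assumes "thick S" "x \<in> S" "(f has_derivative D) (at x within S)"
  shows "frechet_derivative f (at x within S) = D"
proof -
  have "(f has_derivative frechet_derivative f (at x within S)) (at x within S)"
    using assms(3) frechet_derivative_works differentiableI by blast
  from frechet_derivative_unique_within[OF this assms(3)] show ?thesis
    using assms(1,2) by (auto simp: thick_def)
qed

lemma Ck_on_cong:
  assumes "\<And>x. x \<in> S \<Longrightarrow> f x = g x"
  shows "Ck_on k S f = Ck_on k S g"
  using assms
proof (induction k arbitrary: f g)
  case 0
  then show ?case by (simp cong: continuous_on_cong)
next
  case (Suc k)
  have d: "(f has_derivative D) (at x within S) \<longleftrightarrow> (g has_derivative D) (at x within S)"
    if "x \<in> S" for x D
    using Suc.prems has_derivative_transform that by metis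
  have "frechet_derivative f (at x within S) = frechet_derivative g (at x within S)" if "x \<in> S" for x
    unfolding frechet_derivative_def by (simp add: d that)
  hence "Ck_on k S (\<lambda>x. frechet_derivative f (at x within S) v)
       = Ck_on k S (\<lambda>x. frechet_derivative g (at x within S) v)" for v
    by (intro Suc.IH) auto
  moreover have "f differentiable_on S \<longleftrightarrow> g differentiable_on S"
    by (simp add: differentiable_on_def differentiable_def d)
  ultimately show ?case by simp
qed

lemma Ck_on_SucI:
  assumes "thick S" "\<And>x. x \<in> S \<Longrightarrow> (f has_derivative D x) (at x within S)"
    and "\<And>v. Ck_on k S (\<lambda>x. D x v)"
  shows "Ck_on (Suc k) S f"
proof -
  have "Ck_on k S (\<lambda>x. frechet_derivative f (at x within S) v) = Ck_on k S (\<lambda>x. D x v)" for v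
    by (rule Ck_on_cong) (simp add: frechet_derivative_eq_on_thick[OF assms(1) _ assms(2)])
  then show ?thesis using assms(2,3) by (auto simp: differentiable_on_def differentiable_def)
qed

lemma Ck_on_has_derivative:
  assumes "Ck_on (Suc k) S f" "x \<in> S"
  shows "(f has_derivative frechet_derivative f (at x within S)) (at x within S)"
  using assms by (auto simp: differentiable_on_def frechet_derivative_works)

lemma Ck_on_Suc_mono: "Ck_on (Suc k) S f \<Longrightarrow> Ck_on k S f"
proof (induction k arbitrary: f)
  case 0
  then show ?case by (simp add: differentiable_imp_continuous_on)
next
  case (Suc k)
  then show ?case using Suc.IH by (metis Ck_on.simps(2))
qed

lemma Ck_on_mono: "Ck_on k S f \<Longrightarrow> j \<le> k \<Longrightarrow> Ck_on j S f"
  by (induction k) (use Ck_on_Suc_mono le_Suc_eq in blast)+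

lemma Ck_on_imp_continuous_on: "Ck_on k S f \<Longrightarrow> continuous_on S f"
  using Ck_on_mono[of k S f 0] by simp

lemma Ck_on_subset:
  assumes "Ck_on k S f" "T \<subseteq> S" "thick T"
  shows "Ck_on k T f"
  using assms(1)
proof (induction k arbitrary: f)
  case 0
  then show ?case using assms by (auto intro: continuous_on_subset)
next
  case (Suc k)
  show ?case
  proof (rule Ck_on_SucI[OF assms(3)])
    fix x assume "x \<in> T"
    show "(f has_derivative frechet_derivative f (at x within S)) (at x within T)"
      using Ck_on_has_derivative[OF Suc.prems] \<open>x \<in> T\<close> assms(2) has_derivative_subset by blast
  qed (use Suc in auto)
qed

lemma Ck_on_const:
  fixes c :: "'b::real_normed_vector"
  shows "thick S \<Longrightarrow> Ck_on k S (\<lambda>x. c)"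
proof (induction k arbitrary: c)
  case (Suc k)
  show ?case
  proof (rule Ck_on_SucI[OF Suc.prems])
    show "((\<lambda>x. c) has_derivative (\<lambda>v. 0)) (at x within S)" for x :: 'a by simp
    show "Ck_on k S (\<lambda>x. 0::'b)" using Suc by blast
  qed
qed auto

lemma Ck_on_bounded_linear:
  assumes "bounded_linear h" "thick S" "Ck_on k S f"
  shows "Ck_on k S (\<lambda>x. h (f x))"
  using assms(3)
proof (induction k arbitrary: f)
  case 0
  then show ?case using assms(1) by (simp add: bounded_linear.continuous_on)
next
  case (Suc k)
  show ?case
    by (rule Ck_on_SucI[OF assms(2) bounded_linear.has_derivative[OF assms(1) Ck_on_has_derivative[OF Suc.prems]]])
       (use Suc in auto)
qed

lemma Ck_on_add:
  assumes "thick S" "Ck_on k S f" "Ck_on k S g"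
  shows "Ck_on k S (\<lambda>x. f x + g x)"
  using assms(2,3)
proof (induction k arbitrary: f g)
  case 0
  then show ?case by (simp add: continuous_on_add)
next
  case (Suc k)
  show ?case
    by (rule Ck_on_SucI[OF assms(1) has_derivative_add[OF Ck_on_has_derivative[OF Suc.prems(1)]
          Ck_on_has_derivative[OF Suc.prems(2)]]]) (use Suc in auto)
qed

lemma Ck_on_bilinear:
  assumes h: "bounded_bilinear h" and S: "thick S" and "Ck_on k S f" "Ck_on k S g"
  shows "Ck_on k S (\<lambda>x. h (f x) (g x))"
  using assms(3,4)
proof (induction k arbitrary: f g)
  case 0
  then show ?case using h by (simp add: bounded_bilinear.continuous_on)
next
  case (Suc k)
  show ?case
  proof (rule Ck_on_SucI[OF S bounded_bilinear.FDERIV[OF h Ck_on_has_derivative[OF Suc.prems(1)]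
          Ck_on_has_derivative[OF Suc.prems(2)]]])
    show "Ck_on k S (\<lambda>x. h (f x) (frechet_derivative g (at x within S) v) +
             h (frechet_derivative f (at x within S) v) (g x))" for v
      by (intro Ck_on_add S Suc.IH) (use Suc.prems Ck_on_Suc_mono in auto)
  qed auto
qed

lemmas Ck_on_scaleR = Ck_on_bilinear[OF bounded_bilinear_scaleR]
  and Ck_on_mult = Ck_on_bilinear[OF bounded_bilinear_mult]
  and Ck_on_minus = Ck_on_bounded_linear[OF bounded_linear_minus[OF bounded_linear_ident]]
  and Ck_on_fst = Ck_on_bounded_linear[OF bounded_linear_fst]
  and Ck_on_snd = Ck_on_bounded_linear[OF bounded_linear_snd]
  and Ck_on_inner_left = Ck_on_bounded_linear[OF bounded_linear_inner_left]

lemma Ck_on_diff: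
  assumes "thick S" "Ck_on k S f" "Ck_on k S g"
  shows "Ck_on k S (\<lambda>x. f x - g x)"
  using Ck_on_add[OF assms(1,2) Ck_on_minus[OF assms(1,3)]] by simp

lemma Ck_on_sum:
  assumes "thick S" "\<And>i. i \<in> I \<Longrightarrow> Ck_on k S (f i)"
  shows "Ck_on k S (\<lambda>x. \<Sum>i\<in>I. f i x)"
  using assms(2) by (induction I rule: infinite_finite_induct) (auto intro!: Ck_on_const Ck_on_add assms(1))

lemma Ck_on_Pair:
  assumes "thick S" "Ck_on k S f" "Ck_on k S g"
  shows "Ck_on k S (\<lambda>x. (f x, g x))"
proof -
  have 1: "bounded_linear (\<lambda>x. (x, 0))" and 2: "bounded_linear (\<lambda>x. (0, x))"
    by (auto intro!: bounded_linear_Pair bounded_linear_ident bounded_linear_zero)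
  show ?thesis
    using Ck_on_add[OF assms(1) Ck_on_bounded_linear[OF 1 assms(1,2)] Ck_on_bounded_linear[OF 2 assms(1,3)]]
    by simp
qed

lemma Ck_on_ident: "thick S \<Longrightarrow> Ck_on k S (\<lambda>x. x)"
proof (cases k)
  case (Suc j)
  assume "thick S"
  then show ?thesis unfolding Suc
    by (intro Ck_on_SucI[where D="\<lambda>x v. v"] Ck_on_const) auto
qed auto

lemma linear_basis_sum:
  fixes M :: "'b::euclidean_space \<Rightarrow> 'c::real_vector"
  assumes "linear M"
  shows "M u = (\<Sum>b\<in>Basis. (u \<bullet> b) *\<^sub>R M b)"
proof -
  have "M u = M (\<Sum>b\<in>Basis. (u \<bullet> b) *\<^sub>R b)" by (simp add: euclidean_representation)
  also have "\<dots> = (\<Sum>b\<in>Basis. (u \<bullet> b) *\<^sub>R M b)"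
    using assms by (simp add: linear_sum linear_cmul)
  finally show ?thesis .
qed

text \<open>Expanding the argument in the standard basis reduces the claim to products.  This one rule differentiates the
  chain rule and handles tensors that are evaluated on vector fields.\<close>

lemma Ck_on_linear_apply:
  fixes u :: "'a::euclidean_space \<Rightarrow> 'b::euclidean_space"
  assumes S: "thick S" and lin: "\<And>x. x \<in> S \<Longrightarrow> linear (M x)"
    and M: "\<And>b. b \<in> Basis \<Longrightarrow> Ck_on k S (\<lambda>x. M x b)" and u: "Ck_on k S u"
  shows "Ck_on k S (\<lambda>x. M x (u x))"
proof -
  have "Ck_on k S (\<lambda>x. \<Sum>b\<in>Basis. (u x \<bullet> b) *\<^sub>R M x b)"
    by (intro Ck_on_sum Ck_on_scaleR Ck_on_inner_left S M u)
  then show ?thesis using linear_basis_sum[OF lin] by (subst Ck_on_cong) auto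
qed

text \<open>Induction on the order: the derivative of a composition is the linear family \<open>Df \<circ> g\<close>, of lower
  order, applied to \<open>Dg\<close>.\<close>

lemma Ck_on_compose:
  fixes g :: "'a::euclidean_space \<Rightarrow> 'b::euclidean_space" and f :: "'b \<Rightarrow> 'c::real_normed_vector"
  assumes S: "thick S" and "Ck_on k T f" "Ck_on k S g" and im: "g ` S \<subseteq> T"
  shows "Ck_on k S (\<lambda>x. f (g x))"
  using assms(2,3)
proof (induction k arbitrary: f)
  case 0
  then show ?case using im by (auto intro: continuous_on_compose2)
next
  case (Suc k)
  let ?Df = "\<lambda>y. frechet_derivative f (at y within T)" and ?Dg = "\<lambda>x. frechet_derivative g (at x within S)"
  have gk: "Ck_on k S g" using Suc.prems Ck_on_Suc_mono by blast
  have D: "((\<lambda>x. f (g x)) has_derivative (\<lambda>v. ?Df (g x) (?Dg x v))) (at x within S)" if "x \<in> S" for x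
    using has_derivative_in_compose[of g "?Dg x" x S f "?Df (g x)"] that im
      Ck_on_has_derivative[OF Suc.prems(2) that]
      has_derivative_subset[OF Ck_on_has_derivative[OF Suc.prems(1), of "g x"] im] by blast
  show ?case
  proof (rule Ck_on_SucI[OF S D])
    fix v
    show "Ck_on k S (\<lambda>x. ?Df (g x) (?Dg x v))"
    proof (rule Ck_on_linear_apply[OF S])
      show "linear (?Df (g x))" if "x \<in> S" for x
        using Ck_on_has_derivative[OF Suc.prems(1), of "g x"] im that
        by (auto intro: has_derivative_linear)
      show "Ck_on k S (\<lambda>x. ?Df (g x) b)" for b
        using Suc.IH[of "\<lambda>y. ?Df y b"] Suc.prems gk by simp
      show "Ck_on k S (\<lambda>x. ?Dg x v)" using Suc.prems by simp
    qed
  qed auto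
qed

text \<open>The exponents \<open>-1/2\<close> of this rule normalize vectors in the Gram-Schmidt process.\<close>

lemma Ck_on_powr: "Ck_on k {0<..} (\<lambda>t::real. t powr a)"
proof (induction k arbitrary: a)
  case 0
  then show ?case by (auto intro!: continuous_intros)
next
  case (Suc k)
  have th: "thick {0::real<..}" by (simp add: open_thick)
  show ?case
  proof (rule Ck_on_SucI[OF th])
    show "((\<lambda>t. t powr a) has_derivative (\<lambda>v. v * (a * x powr (a - 1)))) (at x within {0<..})"
      if "x \<in> {0<..}" for x :: real
      using has_real_derivative_powr[of x a] that
      by (auto simp: has_field_derivative_def mult_commute_abs intro!: has_derivative_at_withinI)
    show "Ck_on k {0<..} (\<lambda>x. v * (a * x powr (a - 1)))" for v
      by (intro Ck_on_mult Ck_on_const th Suc)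
  qed
qed

lemma Ck_on_frechet_derivative:
  assumes "Ck_on (Suc k) S f" "open S"
  shows "Ck_on k S (\<lambda>x. frechet_derivative f (at x) v)"
proof -
  have "Ck_on k S (\<lambda>x. frechet_derivative f (at x within S) v)" using assms(1) by simp
  then show ?thesis by (subst Ck_on_cong) (auto simp: at_within_open[OF _ assms(2)])
qed

lemma Ck_on_has_derivative_open:
  assumes "Ck_on (Suc k) S f" "open S" "x \<in> S"
  shows "(f has_derivative frechet_derivative f (at x)) (at x)"
  using Ck_on_has_derivative[OF assms(1,3)] at_within_open[OF assms(3,2)] by simp

lemma smooth_on_has_derivative:
  assumes "smooth_on S f" "open S" "x \<in> S"
  shows "(f has_derivative frechet_derivative f (at x)) (at x)"
  using assms Ck_on_has_derivative_open[of 0] unfolding smooth_on_def by blast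

lemma smooth_on_frechet_derivative:
  assumes "smooth_on S f" "open S"
  shows "smooth_on S (\<lambda>x. frechet_derivative f (at x) v)"
  using assms Ck_on_frechet_derivative unfolding smooth_on_def by blast

lemma smooth_on_cong:
  assumes "\<And>x. x \<in> S \<Longrightarrow> f x = g x"
  shows "smooth_on S f = smooth_on S g"
proof -
  have "Ck_on k S f = Ck_on k S g" for k by (rule Ck_on_cong) (rule assms)
  then show ?thesis by (simp add: smooth_on_def)
qed

lemma smooth_on_subset: "smooth_on S f \<Longrightarrow> T \<subseteq> S \<Longrightarrow> thick T \<Longrightarrow> smooth_on T f"
  unfolding smooth_on_def using Ck_on_subset by blast

lemma smooth_on_imp_continuous_on: "smooth_on S f \<Longrightarrow> continuous_on S f"
  unfolding smooth_on_def using Ck_on_imp_continuous_on by blast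

lemma smooth_on_const: "thick S \<Longrightarrow> smooth_on S (\<lambda>x. c)"
  and smooth_on_ident: "thick S \<Longrightarrow> smooth_on S (\<lambda>x. x)"
  and smooth_on_add: "thick S \<Longrightarrow> smooth_on S f \<Longrightarrow> smooth_on S g \<Longrightarrow> smooth_on S (\<lambda>x. f x + g x)"
  and smooth_on_diff: "thick S \<Longrightarrow> smooth_on S f \<Longrightarrow> smooth_on S g \<Longrightarrow> smooth_on S (\<lambda>x. f x - g x)"
  and smooth_on_minus: "thick S \<Longrightarrow> smooth_on S f \<Longrightarrow> smooth_on S (\<lambda>x. - f x)"
  and smooth_on_inner_left: "thick S \<Longrightarrow> smooth_on S h \<Longrightarrow> smooth_on S (\<lambda>x. h x \<bullet> b)"
  unfolding smooth_on_def
  by (blast intro: Ck_on_const Ck_on_ident Ck_on_add Ck_on_diff Ck_on_minus Ck_on_inner_left)+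

lemma smooth_on_scaleR: "thick S \<Longrightarrow> smooth_on S a \<Longrightarrow> smooth_on S f \<Longrightarrow> smooth_on S (\<lambda>x. a x *\<^sub>R f x)"
  and smooth_on_mult: "thick S \<Longrightarrow> smooth_on S a \<Longrightarrow> smooth_on S a' \<Longrightarrow> smooth_on S (\<lambda>x. a x * a' x :: real)"
  unfolding smooth_on_def by (blast intro: Ck_on_scaleR Ck_on_mult)+

lemma smooth_on_sum:
  "thick S \<Longrightarrow> (\<And>i. i \<in> I \<Longrightarrow> smooth_on S (f i)) \<Longrightarrow> smooth_on S (\<lambda>x. \<Sum>i\<in>I. f i x)"
  unfolding smooth_on_def using Ck_on_sum[of S I _ f] by blast

lemma smooth_on_Pair:
  "thick S \<Longrightarrow> smooth_on S f \<Longrightarrow> smooth_on S g \<Longrightarrow> smooth_on S (\<lambda>x. (f x, g x))"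
  unfolding smooth_on_def using Ck_on_Pair by blast

lemma smooth_on_fst: "thick S \<Longrightarrow> smooth_on S f \<Longrightarrow> smooth_on S (\<lambda>x. fst (f x))"
  and smooth_on_snd: "thick S \<Longrightarrow> smooth_on S f \<Longrightarrow> smooth_on S (\<lambda>x. snd (f x))"
  unfolding smooth_on_def using Ck_on_fst Ck_on_snd by blast+

lemma smooth_on_linear_apply:
  fixes u :: "'a::euclidean_space \<Rightarrow> 'b::euclidean_space"
  assumes "thick S" "\<And>x. x \<in> S \<Longrightarrow> linear (M x)"
    and "\<And>b. b \<in> Basis \<Longrightarrow> smooth_on S (\<lambda>x. M x b)" and "smooth_on S u"
  shows "smooth_on S (\<lambda>x. M x (u x))"
  using assms Ck_on_linear_apply[of S M _ u] unfolding smooth_on_def by blast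

lemma smooth_on_compose:
  fixes g :: "'a::euclidean_space \<Rightarrow> 'b::euclidean_space" and f :: "'b \<Rightarrow> 'c::real_normed_vector"
  assumes "thick S" "smooth_on T f" "smooth_on S g" "g ` S \<subseteq> T"
  shows "smooth_on S (\<lambda>x. f (g x))"
  using assms Ck_on_compose[of S _ T f g] unfolding smooth_on_def by blast

lemma smooth_on_powr:
  fixes h :: "'a::euclidean_space \<Rightarrow> real"
  assumes "thick S" "smooth_on S h" "\<And>x. x \<in> S \<Longrightarrow> h x > 0"
  shows "smooth_on S (\<lambda>x. h x powr a)"
proof -
  have "h ` S \<subseteq> {0<..}" using assms(3) by auto
  then show ?thesis
    using assms Ck_on_compose[of S _ "{0<..}" "\<lambda>t. t powr a" h] Ck_on_powr unfolding smooth_on_def by blast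
qed

section \<open>Symmetry of second derivatives\<close>

text \<open>The mean value theorem, applied first in direction \<open>u\<close> and then in direction \<open>v\<close>.  The left-hand side is
  symmetric in \<open>u\<close> and \<open>v\<close>, so for \<open>h\<close> tending to \<open>0\<close> the two orders of differentiation agree.\<close>

lemma second_difference_mvt:
  fixes f :: "'a::euclidean_space \<Rightarrow> real"
  assumes f: "Ck_on 2 S f" and S: "open S" and r: "ball x r \<subseteq> S" and h: "h > 0"
    and hr: "h * (norm u + norm v) < r"
  shows "\<exists>\<xi> \<eta>. 0 < \<xi> \<and> \<xi> < h \<and> 0 < \<eta> \<and> \<eta> < h \<and>
    f (x + h *\<^sub>R u + h *\<^sub>R v) - f (x + h *\<^sub>R u) - f (x + h *\<^sub>R v) + f x
      = h\<^sup>2 * frechet_derivative (\<lambda>y. frechet_derivative f (at y) u) (at (x + \<xi> *\<^sub>R u + \<eta> *\<^sub>R v)) v"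
proof -
  let ?D = "\<lambda>f v y. frechet_derivative f (at y) v"
  have inS: "x + s *\<^sub>R u + t *\<^sub>R v \<in> S" if "0 \<le> s" "s \<le> h" "0 \<le> t" "t \<le> h" for s t
  proof -
    have "norm (s *\<^sub>R u + t *\<^sub>R v) \<le> s * norm u + t * norm v"
      using norm_triangle_ineq[of "s *\<^sub>R u" "t *\<^sub>R v"] that by simp
    also have "\<dots> \<le> h * (norm u + norm v)"
      using that by (simp add: distrib_left add_mono mult_right_mono)
    finally have "norm (s *\<^sub>R u + t *\<^sub>R v) < r" using hr by simp
    then have "x + (s *\<^sub>R u + t *\<^sub>R v) \<in> ball x r"
      by (metis add_diff_cancel_left' dist_commute dist_norm mem_ball)
    then show ?thesis using r by (auto simp: add.assoc)
  qed
  have f2: "Ck_on (Suc (Suc 0)) S f" using f by (simp only: numeral_2_eq_2)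
  have d1: "(f has_derivative (\<lambda>w. ?D f w y)) (at y)" if "y \<in> S" for y
    using Ck_on_has_derivative_open[OF f2 S that] .
  have f1: "Ck_on (Suc 0) S (?D f u)" using Ck_on_frechet_derivative[OF f2 S] .
  have d2: "(?D f u has_derivative (\<lambda>w. ?D (?D f u) w y)) (at y)" if "y \<in> S" for y
    using Ck_on_has_derivative_open[OF f1 S that] .
  let ?g = "\<lambda>s. f (x + s *\<^sub>R u + h *\<^sub>R v) - f (x + s *\<^sub>R u)"
  have der: "((\<lambda>s. f (x + s *\<^sub>R u + t *\<^sub>R v)) has_real_derivative ?D f u (x + s *\<^sub>R u + t *\<^sub>R v)) (at s)"
    if "0 \<le> s" "s \<le> h" "0 \<le> t" "t \<le> h" for s t
  proof -
    have "((\<lambda>s. f (x + s *\<^sub>R u + t *\<^sub>R v)) has_derivative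
        (\<lambda>a. ?D f (a *\<^sub>R u) (x + s *\<^sub>R u + t *\<^sub>R v))) (at s)"
      by (rule has_derivative_compose[where g=f and f="\<lambda>s. x + s *\<^sub>R u + t *\<^sub>R v", OF _ d1[OF inS[OF that]]])
         (auto intro!: derivative_eq_intros)
    moreover have "?D f (a *\<^sub>R u) (x + s *\<^sub>R u + t *\<^sub>R v) = ?D f u (x + s *\<^sub>R u + t *\<^sub>R v) * a" for a
      using linear_cmul[OF has_derivative_linear[OF d1[OF inS[OF that]]]] by simp
    ultimately show ?thesis by (simp add: has_field_derivative_def)
  qed
  have "\<exists>\<xi>. 0 < \<xi> \<and> \<xi> < h \<and> ?g h - ?g 0 = (h - 0) *
     (?D f u (x + \<xi> *\<^sub>R u + h *\<^sub>R v) - ?D f u (x + \<xi> *\<^sub>R u))"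
  proof (rule MVT2[OF h])
    fix s assume s: "0 \<le> s" "s \<le> h"
    show "(?g has_real_derivative ?D f u (x + s *\<^sub>R u + h *\<^sub>R v) - ?D f u (x + s *\<^sub>R u)) (at s)"
      using DERIV_diff[OF der[OF s, of h] der[OF s, of 0]] h by simp
  qed
  then obtain \<xi> where \<xi>: "0 < \<xi>" "\<xi> < h" and
    e1: "?g h - ?g 0 = h * (?D f u (x + \<xi> *\<^sub>R u + h *\<^sub>R v) - ?D f u (x + \<xi> *\<^sub>R u))" by auto
  have "\<exists>\<eta>. 0 < \<eta> \<and> \<eta> < h \<and> ?D f u (x + \<xi> *\<^sub>R u + h *\<^sub>R v) - ?D f u (x + \<xi> *\<^sub>R u + 0 *\<^sub>R v)
     = (h - 0) * ?D (?D f u) v (x + \<xi> *\<^sub>R u + \<eta> *\<^sub>R v)"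
  proof (rule MVT2[OF h])
    fix t assume t: "0 \<le> t" "t \<le> h"
    have in': "x + \<xi> *\<^sub>R u + t *\<^sub>R v \<in> S" using inS \<xi> t by simp
    have "((\<lambda>t. ?D f u (x + \<xi> *\<^sub>R u + t *\<^sub>R v)) has_derivative
        (\<lambda>a. ?D (?D f u) (a *\<^sub>R v) (x + \<xi> *\<^sub>R u + t *\<^sub>R v))) (at t)"
      by (rule has_derivative_compose[where g="?D f u" and f="\<lambda>t. x + \<xi> *\<^sub>R u + t *\<^sub>R v", OF _ d2[OF in']])
         (auto intro!: derivative_eq_intros)
    moreover have "?D (?D f u) (a *\<^sub>R v) (x + \<xi> *\<^sub>R u + t *\<^sub>R v) = ?D (?D f u) v (x + \<xi> *\<^sub>R u + t *\<^sub>R v) * a" for a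
      using linear_cmul[OF has_derivative_linear[OF d2[OF in']]] by simp
    ultimately show "((\<lambda>t. ?D f u (x + \<xi> *\<^sub>R u + t *\<^sub>R v)) has_real_derivative
        ?D (?D f u) v (x + \<xi> *\<^sub>R u + t *\<^sub>R v)) (at t)" by (simp add: has_field_derivative_def)
  qed
  then obtain \<eta> where \<eta>: "0 < \<eta>" "\<eta> < h" and
    e2: "?D f u (x + \<xi> *\<^sub>R u + h *\<^sub>R v) - ?D f u (x + \<xi> *\<^sub>R u) = h * ?D (?D f u) v (x + \<xi> *\<^sub>R u + \<eta> *\<^sub>R v)"
    by auto
  have "?g h - ?g 0 = h\<^sup>2 * ?D (?D f u) v (x + \<xi> *\<^sub>R u + \<eta> *\<^sub>R v)"
    unfolding e1 e2 by (simp add: power2_eq_square)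
  then show ?thesis using \<xi> \<eta> by (intro exI[of _ \<xi>] exI[of _ \<eta>]) (simp add: algebra_simps)
qed

lemma second_derivative_symmetric_real:
  fixes f :: "'a::euclidean_space \<Rightarrow> real"
  assumes f: "Ck_on 2 S f" and S: "open S" "x \<in> S"
  shows "frechet_derivative (\<lambda>y. frechet_derivative f (at y) u) (at x) v
       = frechet_derivative (\<lambda>y. frechet_derivative f (at y) v) (at x) u"
proof -
  let ?D = "\<lambda>u v y. frechet_derivative (\<lambda>y. frechet_derivative f (at y) u) (at y) v"
  obtain r where r: "r > 0" "ball x r \<subseteq> S" using S open_contains_ball by blast
  have cont: "continuous_on S (?D u v)" for u v
  proof -
    have "Ck_on (Suc (Suc 0)) S f" using f by (simp only: numeral_2_eq_2)
    then have "Ck_on 0 S (?D u v)" using Ck_on_frechet_derivative S(1) by blast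
    then show ?thesis by simp
  qed
  have "\<bar>?D u v x - ?D v u x\<bar> \<le> e" if e: "e > 0" for e
  proof -
    have "isCont (?D u v) x" "isCont (?D v u) x" using cont S continuous_on_eq_continuous_at by blast+
    then obtain d1 d2 where d: "d1 > 0" "\<And>y. dist y x < d1 \<Longrightarrow> dist (?D u v y) (?D u v x) < e/2"
       "d2 > 0" "\<And>y. dist y x < d2 \<Longrightarrow> dist (?D v u y) (?D v u x) < e/2"
      unfolding continuous_at_eps_delta using e by (metis half_gt_zero)
    define n where "n = norm u + norm v + 1"
    define h where "h = min (min d1 d2) r / (2 * n)"
    have n: "n > 0" by (simp add: n_def add_nonneg_pos)
    have h: "h > 0" using d(1,3) r(1) n by (simp add: h_def)
    have "h * (norm u + norm v) \<le> h * n" using h by (simp add: n_def)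
    also have "\<dots> = min (min d1 d2) r / 2" using n by (simp add: h_def)
    also have "\<dots> < min (min d1 d2) r" using d(1,3) r(1) by linarith
    finally have hn: "h * (norm u + norm v) < min (min d1 d2) r" .
    have near: "dist (x + s *\<^sub>R u' + t *\<^sub>R v') x < min d1 d2"
      if "0 < s" "s < h" "0 < t" "t < h" "norm u' + norm v' = norm u + norm v" for s t u' v'
    proof -
      have "dist (x + s *\<^sub>R u' + t *\<^sub>R v') x = norm (s *\<^sub>R u' + t *\<^sub>R v')"
        by (simp add: dist_norm add.assoc)
      also have "\<dots> \<le> s * norm u' + t * norm v'"
        using norm_triangle_ineq[of "s *\<^sub>R u'" "t *\<^sub>R v'"] that by simp
      also have "\<dots> \<le> h * norm u' + h * norm v'"
        using that by (intro add_mono mult_right_mono) auto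
      also have "\<dots> = h * (norm u' + norm v')" by (rule distrib_left[symmetric])
      finally show ?thesis using hn that by simp
    qed
    obtain \<xi> \<eta> where 1: "0 < \<xi>" "\<xi> < h" "0 < \<eta>" "\<eta> < h"
      "f (x + h *\<^sub>R u + h *\<^sub>R v) - f (x + h *\<^sub>R u) - f (x + h *\<^sub>R v) + f x
        = h\<^sup>2 * ?D u v (x + \<xi> *\<^sub>R u + \<eta> *\<^sub>R v)"
      using second_difference_mvt[OF f S(1) r(2) h, of u v] hn by auto
    obtain \<xi>' \<eta>' where 2: "0 < \<xi>'" "\<xi>' < h" "0 < \<eta>'" "\<eta>' < h"
      "f (x + h *\<^sub>R v + h *\<^sub>R u) - f (x + h *\<^sub>R v) - f (x + h *\<^sub>R u) + f x
        = h\<^sup>2 * ?D v u (x + \<xi>' *\<^sub>R v + \<eta>' *\<^sub>R u)"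
      using second_difference_mvt[OF f S(1) r(2) h, of v u] hn by (auto simp: add.commute)
    have swap: "x + h *\<^sub>R v + h *\<^sub>R u = x + h *\<^sub>R u + h *\<^sub>R v" by simp
    have "h\<^sup>2 * ?D u v (x + \<xi> *\<^sub>R u + \<eta> *\<^sub>R v) = h\<^sup>2 * ?D v u (x + \<xi>' *\<^sub>R v + \<eta>' *\<^sub>R u)"
      using 1(5) 2(5) unfolding swap by linarith
    then have "?D u v (x + \<xi> *\<^sub>R u + \<eta> *\<^sub>R v) = ?D v u (x + \<xi>' *\<^sub>R v + \<eta>' *\<^sub>R u)"
      using h by simp
    moreover have "dist (?D u v (x + \<xi> *\<^sub>R u + \<eta> *\<^sub>R v)) (?D u v x) < e/2"
      using d(2) near[OF 1(1-4)] by simp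
    moreover have "dist (?D v u (x + \<xi>' *\<^sub>R v + \<eta>' *\<^sub>R u)) (?D v u x) < e/2"
      using d(4) near[OF 2(1-4)] by simp
    ultimately show ?thesis unfolding dist_real_def by linarith
  qed
  then have "\<bar>?D u v x - ?D v u x\<bar> \<le> 0" by (rule field_le_epsilon) simp
  then show ?thesis by simp
qed

lemma second_derivative_symmetric:
  fixes f :: "'a::euclidean_space \<Rightarrow> 'b::euclidean_space"
  assumes f: "smooth_on S f" and S: "open S" "x \<in> S"
  shows "frechet_derivative (\<lambda>y. frechet_derivative f (at y) u) (at x) v
       = frechet_derivative (\<lambda>y. frechet_derivative f (at y) v) (at x) u"
proof (rule euclidean_eqI)
  fix b :: 'b assume "b \<in> Basis"
  let ?f = "\<lambda>y. f y \<bullet> b"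
  have sm: "Ck_on 2 S ?f" using f smooth_on_inner_left[OF open_thick[OF S(1)] f] by (simp add: smooth_on_def)
  have 1: "frechet_derivative ?f (at y) u = frechet_derivative f (at y) u \<bullet> b" if "y \<in> S" for y u
    using frechet_derivative_at[OF bounded_linear.has_derivative[OF bounded_linear_inner_left
          smooth_on_has_derivative[OF f S(1) that]]] by metis
  have 2: "frechet_derivative (\<lambda>y. frechet_derivative ?f (at y) u) (at x) v
      = frechet_derivative (\<lambda>y. frechet_derivative f (at y) u) (at x) v \<bullet> b" for u v
  proof -
    have "((\<lambda>y. frechet_derivative f (at y) u \<bullet> b) has_derivative
        (\<lambda>v. frechet_derivative (\<lambda>y. frechet_derivative f (at y) u) (at x) v \<bullet> b)) (at x)"
      by (intro bounded_linear.has_derivative[OF bounded_linear_inner_left]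
          smooth_on_has_derivative[OF smooth_on_frechet_derivative[OF f S(1)] S])
    then have "((\<lambda>y. frechet_derivative ?f (at y) u) has_derivative
        (\<lambda>v. frechet_derivative (\<lambda>y. frechet_derivative f (at y) u) (at x) v \<bullet> b)) (at x)"
      by (rule has_derivative_transform_within_open[OF _ S]) (simp add: 1)
    from frechet_derivative_at[OF this] show ?thesis by metis
  qed
  show "frechet_derivative (\<lambda>y. frechet_derivative f (at y) u) (at x) v \<bullet> b
       = frechet_derivative (\<lambda>y. frechet_derivative f (at y) v) (at x) u \<bullet> b"
    using second_derivative_symmetric_real[OF sm S, of u v] by (simp add: 2)
qed

section \<open>Local flows of ordinary differential equations\<close>

lemma norm_vector_derivative_bound:
  fixes y :: "real \<Rightarrow> 'a::real_normed_vector"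
  assumes y: "\<And>s. s \<in> {-T..T} \<Longrightarrow> (y has_vector_derivative y' s) (at s within {-T..T})"
    and t: "\<bar>t\<bar> \<le> T" and K: "\<And>s. \<bar>s\<bar> \<le> \<bar>t\<bar> \<Longrightarrow> norm (y' s) \<le> K"
  shows "norm (y t - y 0) \<le> K * \<bar>t\<bar>"
proof -
  have "K \<ge> 0" using K[of 0] norm_ge_zero[of "y' 0"] by linarith
  have "norm (y t - y 0) \<le> K * norm (t - 0)"
  proof (rule differentiable_bound[where S="{-\<bar>t\<bar>..\<bar>t\<bar>}" and f'="\<lambda>s h. h *\<^sub>R y' s"])
    fix s assume s: "s \<in> {-\<bar>t\<bar>..\<bar>t\<bar>}"
    show "(y has_derivative (\<lambda>h. h *\<^sub>R y' s)) (at s within {-\<bar>t\<bar>..\<bar>t\<bar>})"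
      using y[of s] s t unfolding has_vector_derivative_def
      by (auto intro: has_derivative_subset)
    show "onorm (\<lambda>h. h *\<^sub>R y' s) \<le> K"
      using K[of s] s \<open>K \<ge> 0\<close> by (intro onorm_bound) (auto simp: mult.commute[of K] intro: mult_left_mono)
  qed auto
  then show ?thesis by simp
qed

text \<open>On an interval this short no exponential is needed: at its maximum the norm is bounded by the initial
  data plus half of itself.\<close>

lemma short_time_gronwall:
  fixes y :: "real \<Rightarrow> 'a::real_normed_vector"
  assumes y: "\<And>s. s \<in> {-T..T} \<Longrightarrow> (y has_vector_derivative y' s) (at s within {-T..T})"
    and b: "\<And>s. s \<in> {-T..T} \<Longrightarrow> norm (y' s) \<le> a * norm (y s) + b"
    and aT: "2 * a * T \<le> 1" and ab: "a \<ge> 0" "b \<ge> 0" and t: "\<bar>t\<bar> \<le> T"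
  shows "norm (y t) \<le> 2 * norm (y 0) + 2 * b * \<bar>t\<bar>"
proof -
  have "continuous_on {-T..T} y"
    using y by (meson continuous_on_vector_derivative)
  then have "continuous_on {-\<bar>t\<bar>..\<bar>t\<bar>} (\<lambda>s. norm (y s))"
    by (intro continuous_on_norm) (use t in \<open>auto elim: continuous_on_subset\<close>)
  from continuous_attains_sup[OF compact_Icc _ this]
  obtain m where m: "m \<in> {-\<bar>t\<bar>..\<bar>t\<bar>}" "\<And>s. s \<in> {-\<bar>t\<bar>..\<bar>t\<bar>} \<Longrightarrow> norm (y s) \<le> norm (y m)"
    by auto
  have "norm (y m - y 0) \<le> (a * norm (y m) + b) * \<bar>m\<bar>"
  proof (rule norm_vector_derivative_bound[OF y])
    show "\<bar>m\<bar> \<le> T" using m t by auto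
    fix s assume s: "\<bar>s\<bar> \<le> \<bar>m\<bar>"
    then have "s \<in> {-T..T}" "s \<in> {-\<bar>t\<bar>..\<bar>t\<bar>}" using m t by auto
    then show "norm (y' s) \<le> a * norm (y m) + b"
      using b[of s] m(2)[of s] ab(1) mult_left_mono by fastforce
  qed
  also have "\<dots> \<le> (a * norm (y m) + b) * \<bar>t\<bar>"
    using m ab by (intro mult_left_mono) auto
  also have "\<dots> = (a * \<bar>t\<bar>) * norm (y m) + b * \<bar>t\<bar>" by (simp add: algebra_simps)
  also have "\<dots> \<le> 1/2 * norm (y m) + b * \<bar>t\<bar>"
    using aT ab t mult_left_mono[of "\<bar>t\<bar>" T a] by (intro add_mono mult_right_mono) auto
  finally have "norm (y m) \<le> 2 * norm (y 0) + 2 * b * \<bar>t\<bar>"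
    using norm_triangle_ineq2[of "y m" "y 0"] by simp
  moreover have "t \<in> {-\<bar>t\<bar>..\<bar>t\<bar>}" by auto
  ultimately show ?thesis using m(2) by force
qed

text \<open>Banach's fixed point theorem for the integral operator.  The right-hand side depends on time because the
  variational equation has to be covered, and takes values in a Banach space because the unknown of that equation is
  a linear map.\<close>

lemma picard_global:
  fixes G :: "real \<Rightarrow> 'a::banach \<Rightarrow> 'a"
  assumes T: "T > 0" and L: "L \<ge> 0" "8 * L * T \<le> 1"
    and lip: "\<And>t x y. t \<in> {-T..T} \<Longrightarrow> norm (G t x - G t y) \<le> L * norm (x - y)"
    and cont: "\<And>y. continuous_on {-T..T} y \<Longrightarrow> continuous_on {-T..T} (\<lambda>t. G t (y t))"
  shows "\<exists>y. y 0 = p \<and> (\<forall>t\<in>{-T..T}. (y has_vector_derivative G t (y t)) (at t within {-T..T}))"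
proof -
  \<comment> \<open>Curves are extended constantly beyond \<open>[-T, T]\<close>, so that the bounded continuous functions on the line
    can serve as the complete space.\<close>
  define cl where "cl t = max (-T) (min T t)" for t
  have cl: "cl t \<in> {-T..T}" "t \<in> {-T..T} \<Longrightarrow> cl t = t" for t using T by (auto simp: cl_def)
  define I where "I y t = integral {-T..t} (\<lambda>s. G s (y s))" for y t
  define Op where "Op y = (\<lambda>t. p + (I y (cl t) - I y 0))" for y
  have c: "continuous_on {-T..T} (\<lambda>s. G s (apply_bcontfun y s))" for y by (intro cont) simp
  have cI: "continuous_on {-T..T} (I (apply_bcontfun y))" for y
    unfolding I_def by (intro indefinite_integral_continuous_1 integrable_continuous_real c)
  have cOp: "Op (apply_bcontfun y) \<in> bcontfun" for y
  proof -
    have "continuous_on UNIV (\<lambda>t. I (apply_bcontfun y) (cl t))"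
      by (rule continuous_on_compose2[OF cI]) (use cl in \<open>auto simp: cl_def intro!: continuous_intros\<close>)
    then have 1: "continuous_on UNIV (Op (apply_bcontfun y))"
      unfolding Op_def by (intro continuous_intros)
    have "range (Op (apply_bcontfun y)) \<subseteq> (\<lambda>t. p + (I (apply_bcontfun y) t - I (apply_bcontfun y) 0)) ` {-T..T}"
      using cl by (auto simp: Op_def)
    moreover have "compact ((\<lambda>t. p + (I (apply_bcontfun y) t - I (apply_bcontfun y) 0)) ` {-T..T})"
      by (intro compact_continuous_image continuous_intros cI) auto
    ultimately show ?thesis using 1 compact_imp_bounded bounded_subset by (auto simp: bcontfun_def)
  qed
  have "\<exists>!y. Bcontfun (Op (apply_bcontfun y)) = (y :: real \<Rightarrow>\<^sub>C 'a)"
  proof (rule banach_fix_type[of "1/2"])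
    show "\<forall>y z::real \<Rightarrow>\<^sub>C 'a. dist (Bcontfun (Op (apply_bcontfun y))) (Bcontfun (Op (apply_bcontfun z))) \<le> 1/2 * dist y z"
    proof (intro allI dist_bound)
      fix y z :: "real \<Rightarrow>\<^sub>C 'a" and t :: real
      have b: "norm (I y t - I z t) \<le> L * dist y z * (2 * T)" if t: "t \<in> {-T..T}" for t
      proof -
        have ss: "{-T..t} \<subseteq> {-T..T}" using t by auto
        have "I y t - I z t = integral {-T..t} (\<lambda>s. G s (y s) - G s (z s))"
          unfolding I_def
          by (subst integral_diff) (auto intro!: integrable_continuous_real continuous_on_subset[OF c ss])
        also have "norm \<dots> \<le> L * dist y z * (t - (-T))"
        proof (rule integral_bound)
          fix s assume s: "s \<in> {-T..t}"
          have "norm (G s (y s) - G s (z s)) \<le> L * norm (y s - z s)" using s ss by (intro lip) auto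
          also have "\<dots> \<le> L * dist y z"
            using dist_bounded[of y s z] L by (intro mult_left_mono) (auto simp: dist_norm)
          finally show "norm (G s (y s) - G s (z s)) \<le> L * dist y z" .
        qed (use t in \<open>auto intro!: continuous_intros continuous_on_subset[OF c ss]\<close>)
        also have "\<dots> \<le> L * dist y z * (2 * T)" using t L by (intro mult_left_mono) auto
        finally show ?thesis .
      qed
      have "dist (Op y t) (Op z t) = norm ((I y (cl t) - I z (cl t)) - (I y 0 - I z 0))"
        by (simp add: Op_def dist_norm algebra_simps)
      also have "\<dots> \<le> L * dist y z * (2 * T) + L * dist y z * (2 * T)"
        using norm_triangle_ineq4 b[of "cl t"] b[of 0] cl T
        by (smt (verit) atLeastAtMost_iff)
      also have "\<dots> = (8 * L * T) * (1/2 * dist y z)" by simp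
      also have "\<dots> \<le> 1 * (1/2 * dist y z)" using L by (intro mult_right_mono) auto
      finally show "dist (Bcontfun (Op (apply_bcontfun y)) t) (Bcontfun (Op (apply_bcontfun z)) t) \<le> 1/2 * dist y z"
        by (simp add: Bcontfun_inverse[OF cOp])
    qed
  qed auto
  then obtain y :: "real \<Rightarrow>\<^sub>C 'a" where "Bcontfun (Op (apply_bcontfun y)) = y" by blast
  then have y: "apply_bcontfun y = Op (apply_bcontfun y)" using Bcontfun_inverse[OF cOp, of y] by simp
  show ?thesis
  proof (intro exI[of _ "apply_bcontfun y"] conjI ballI)
    show "y 0 = p" by (subst y) (use T in \<open>simp add: Op_def cl\<close>)
    fix t assume t: "t \<in> {-T..T}"
    have "((\<lambda>t. p + (I y t - I y 0)) has_vector_derivative G t (y t)) (at t within {-T..T})"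
      using integral_has_vector_derivative[OF c t, of y] unfolding I_def
      by (auto intro!: derivative_eq_intros)
    moreover have "y s = p + (I y s - I y 0)" if "s \<in> {-T..T}" for s
      by (subst y) (use that in \<open>simp add: Op_def cl\<close>)
    ultimately show "(apply_bcontfun y has_vector_derivative G t (y t)) (at t within {-T..T})"
      by (rule has_vector_derivative_transform[OF t, rotated]) auto
  qed
qed

lemma has_derivative_quadraticI:
  fixes f :: "'a::real_normed_vector \<Rightarrow> 'b::real_normed_vector"
  assumes D: "bounded_linear D" and r: "r > 0"
    and q: "\<And>y. dist y x < r \<Longrightarrow> norm (f y - f x - D (y - x)) \<le> K * (norm (y - x))\<^sup>2"
  shows "(f has_derivative D) (at x)"
  unfolding has_derivative_at_alt
proof (intro conjI D allI impI)
  fix e :: real assume e: "e > 0"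
  define d where "d = min r (e / (\<bar>K\<bar> + 1))"
  show "\<exists>d>0. \<forall>y. norm (y - x) < d \<longrightarrow> norm (f y - f x - D (y - x)) \<le> e * norm (y - x)"
  proof (intro exI[of _ d] conjI allI impI)
    show "d > 0" using r e by (simp add: d_def add_nonneg_pos)
    fix y assume y: "norm (y - x) < d"
    have "norm (f y - f x - D (y - x)) \<le> K * (norm (y - x))\<^sup>2"
      using q y by (simp add: d_def dist_norm)
    also have "\<dots> \<le> (\<bar>K\<bar> + 1) * (norm (y - x))\<^sup>2" by (intro mult_right_mono) auto
    also have "\<dots> = ((\<bar>K\<bar> + 1) * norm (y - x)) * norm (y - x)" by (simp add: power2_eq_square)
    also have "\<dots> \<le> e * norm (y - x)"
      using y by (intro mult_right_mono) (auto simp: d_def field_simps)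
    finally show "norm (f y - f x - D (y - x)) \<le> e * norm (y - x)" .
  qed
qed

text \<open>A vector field on a ball with the constants that make all solutions starting in the ball of half the radius
  exist up to time \<open>T\<close>: \<open>M T \<le> R / 2\<close> keeps them inside, \<open>8 L T \<le> 1\<close> makes the Picard operator a contraction.\<close>

locale local_flow =
  fixes F :: "'a::euclidean_space \<Rightarrow> 'a" and DF :: "'a \<Rightarrow> 'a \<Rightarrow>\<^sub>L 'a" and z0 :: 'a and R M L C T :: real
  assumes pos: "R > 0" "T > 0" and MT: "M * T \<le> R / 2" and LT: "8 * L * T \<le> 1"
    and bound: "\<And>z. z \<in> cball z0 R \<Longrightarrow> norm (F z) \<le> M"
    and deriv: "\<And>z. z \<in> cball z0 R \<Longrightarrow> (F has_derivative DF z) (at z within cball z0 R)"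
    and DF_bound: "\<And>z. z \<in> cball z0 R \<Longrightarrow> norm (DF z) \<le> L"
    and DF_lip: "\<And>z w. z \<in> cball z0 R \<Longrightarrow> w \<in> cball z0 R \<Longrightarrow> norm (DF z - DF w) \<le> C * norm (z - w)"
begin

abbreviation "B \<equiv> cball z0 R"

lemma const_nonneg: "M \<ge> 0" "L \<ge> 0"
proof -
  have z0: "z0 \<in> cball z0 R" using pos by simp
  show "M \<ge> 0" using bound[OF z0] norm_ge_zero[of "F z0"] by linarith
  show "L \<ge> 0" using DF_bound[OF z0] norm_ge_zero[of "DF z0"] by linarith
qed

lemma C_nonneg: "z \<in> B \<Longrightarrow> w \<in> B \<Longrightarrow> C * norm (z - w) \<ge> 0"
  using DF_lip[of z w] norm_ge_zero[of "DF z - DF w"] by linarith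

lemma lipschitz: "z \<in> B \<Longrightarrow> w \<in> B \<Longrightarrow> norm (F z - F w) \<le> L * norm (z - w)"
  by (rule differentiable_bound[OF convex_cball deriv])
     (use DF_bound in \<open>auto simp: norm_blinfun.rep_eq\<close>)

lemma linearization:
  assumes z: "z \<in> B" and w: "w \<in> B"
  shows "norm (F w - F z - DF z (w - z)) \<le> C * (norm (w - z))\<^sup>2"
proof -
  have "norm (F w - F z - DF z (w - z)) \<le> norm (w - z) * (C * norm (w - z))"
  proof (rule differentiable_bound_linearization[where S="closed_segment z w" and f'="\<lambda>z. blinfun_apply (DF z)"])
    have sub: "closed_segment z w \<subseteq> B" using z w by (simp add: closed_segment_subset)
    show "z + t *\<^sub>R (w - z) \<in> closed_segment z w" if "t \<in> {0..1}" for t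
    proof -
      have "z + t *\<^sub>R (w - z) = (1 - t) *\<^sub>R z + t *\<^sub>R w" by (simp add: algebra_simps)
      then show ?thesis using that unfolding closed_segment_def by auto
    qed
    fix x assume x: "x \<in> closed_segment z w"
    show "(F has_derivative DF x) (at x within closed_segment z w)"
      using deriv[of x] sub x has_derivative_subset by blast
    have "onorm (\<lambda>h. blinfun_apply (DF x) h - blinfun_apply (DF z) h) = norm (DF x - DF z)"
      by (simp add: norm_blinfun.rep_eq minus_blinfun.rep_eq fun_diff_def)
    also have "\<dots> \<le> C * norm (x - z)" using DF_lip sub x z by blast
    also have "\<dots> \<le> C * norm (w - z)"
    proof (cases "w = z")
      case False
      then have "C \<ge> 0" using C_nonneg[OF w z] by (simp add: zero_le_mult_iff)
      then show ?thesis using x segment_bound1[OF x] by (simp add: mult_left_mono)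
    qed (use x in auto)
    finally show "onorm (blinfun_apply (DF x) - blinfun_apply (DF z)) \<le> C * norm (w - z)"
      by (simp add: fun_diff_def)
  qed auto
  then show ?thesis by (simp add: power2_eq_square mult_ac)
qed

text \<open>Composing \<open>F\<close> with the nearest point retraction onto the ball makes it globally Lipschitz; the solution of the
  modified equation never leaves the ball, where both equations agree.\<close>

lemma flow_exists:
  assumes p: "p \<in> cball z0 (R/2)"
  shows "\<exists>y. y 0 = p \<and> (\<forall>t\<in>{-T..T}. y t \<in> B \<and> (y has_vector_derivative F (y t)) (at t within {-T..T}))"
proof -
  let ?c = "closest_point B"
  have ne: "B \<noteq> {}" using pos by auto
  have cin: "?c z \<in> B" for z using closest_point_in_set[OF closed_cball ne] .
  have lipc: "norm (?c x - ?c y) \<le> norm (x - y)" for x y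
    using closest_point_lipschitz[OF convex_cball closed_cball ne] by (simp add: dist_norm)
  have "\<exists>y. y 0 = p \<and> (\<forall>t\<in>{-T..T}. (y has_vector_derivative F (?c (y t))) (at t within {-T..T}))"
  proof (rule picard_global[OF pos(2) const_nonneg(2) LT])
    show lip: "norm (F (?c x) - F (?c y)) \<le> L * norm (x - y)" for x y
      using lipschitz[OF cin cin, of x y] lipc[of x y] const_nonneg mult_left_mono order_trans by blast
    have "L-lipschitz_on UNIV (\<lambda>x. F (?c x))"
      by (rule lipschitz_onI) (use lip const_nonneg in \<open>auto simp: dist_norm\<close>)
    then have "continuous_on UNIV (\<lambda>x. F (?c x))" by (rule lipschitz_on_continuous_on)
    then show "continuous_on {-T..T} (\<lambda>t. F (?c (y t)))" if "continuous_on {-T..T} y" for y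
      using continuous_on_compose2 that by blast
  qed
  then obtain y where y: "y 0 = p" "\<And>t. t \<in> {-T..T} \<Longrightarrow> (y has_vector_derivative F (?c (y t))) (at t within {-T..T})"
    by blast
  have "y t \<in> B" if t: "t \<in> {-T..T}" for t
  proof -
    have "norm (y t - y 0) \<le> M * \<bar>t\<bar>"
      by (rule norm_vector_derivative_bound[OF y(2)]) (use t bound cin in auto)
    also have "\<dots> \<le> M * T" using t const_nonneg by (intro mult_left_mono) auto
    finally have "dist (y 0) (y t) \<le> R/2" using MT by (simp add: dist_norm norm_minus_commute)
    then show ?thesis using p y(1) dist_triangle[of z0 "y t" "y 0"] by simp
  qed
  then show ?thesis using y by (intro exI[of _ y]) (auto simp: closest_point_self)
qed

definition flow where
  "flow p = (SOME y. y 0 = p \<and> (\<forall>t\<in>{-T..T}. y t \<in> B \<and> (y has_vector_derivative F (y t)) (at t within {-T..T})))"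

lemma flow:
  assumes "p \<in> cball z0 (R/2)"
  shows "flow p 0 = p" "t \<in> {-T..T} \<Longrightarrow> flow p t \<in> B"
    "t \<in> {-T..T} \<Longrightarrow> (flow p has_vector_derivative F (flow p t)) (at t within {-T..T})"
  using someI_ex[OF flow_exists[OF assms]] unfolding flow_def by blast+

text \<open>The second bound says that \<open>p \<mapsto> flow p t\<close> is a small Lipschitz perturbation of the identity, which makes
  it injective.\<close>

lemma flow_lipschitz:
  assumes p: "p \<in> cball z0 (R/2)" and q: "q \<in> cball z0 (R/2)" and t: "\<bar>t\<bar> \<le> T"
  shows "norm (flow p t - flow q t) \<le> 2 * norm (p - q)"
    and "norm ((flow p t - p) - (flow q t - q)) \<le> 2 * L * \<bar>t\<bar> * norm (p - q)"
proof -
  have der: "((\<lambda>t. flow p t - flow q t) has_vector_derivative F (flow p s) - F (flow q s)) (at s within {-T..T})"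
    if "s \<in> {-T..T}" for s
    using flow(3)[OF p that] flow(3)[OF q that] by (rule has_vector_derivative_diff)
  have lip: "norm (F (flow p s) - F (flow q s)) \<le> L * norm (flow p s - flow q s)" if "s \<in> {-T..T}" for s
    using lipschitz flow(2)[OF p that] flow(2)[OF q that] by blast
  have 1: "norm (flow p t - flow q t) \<le> 2 * norm (p - q)" if "\<bar>t\<bar> \<le> T" for t
    using short_time_gronwall[OF der, of L 0 t] lip LT const_nonneg pos that flow(1)[OF p] flow(1)[OF q]
    by auto
  then show "norm (flow p t - flow q t) \<le> 2 * norm (p - q)" using t .
  have "norm ((flow p t - flow q t) - (flow p 0 - flow q 0)) \<le> (L * (2 * norm (p - q))) * \<bar>t\<bar>"
  proof (rule norm_vector_derivative_bound[OF der t])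
    fix s assume "\<bar>s\<bar> \<le> \<bar>t\<bar>"
    then have s: "\<bar>s\<bar> \<le> T" using t by simp
    show "norm (F (flow p s) - F (flow q s)) \<le> L * (2 * norm (p - q))"
      using lip[of s] 1[OF s] s const_nonneg(2) by (meson abs_le_iff atLeastAtMost_iff minus_le_iff mult_left_mono order_trans)
  qed auto
  then show "norm ((flow p t - p) - (flow q t - q)) \<le> 2 * L * \<bar>t\<bar> * norm (p - q)"
    by (simp add: flow(1)[OF p] flow(1)[OF q] algebra_simps)
qed

lemma flow_time_lipschitz:
  assumes p: "p \<in> cball z0 (R/2)" and t: "t \<in> {-T..T}" "s \<in> {-T..T}"
  shows "norm (flow p t - flow p s) \<le> M * \<bar>t - s\<bar>"
proof -
  have "norm (flow p t - flow p s) \<le> M * norm (t - s)"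
  proof (rule differentiable_bound[where S="{-T..T}" and f'="\<lambda>r h. h *\<^sub>R F (flow p r)"])
    fix r assume r: "r \<in> {-T..T}"
    show "(flow p has_derivative (\<lambda>h. h *\<^sub>R F (flow p r))) (at r within {-T..T})"
      using flow(3)[OF p r] by (simp add: has_vector_derivative_def)
    have "norm (F (flow p r)) \<le> M" using bound flow(2)[OF p r] by blast
    then show "onorm (\<lambda>h. h *\<^sub>R F (flow p r)) \<le> M"
      using const_nonneg by (intro onorm_bound) (auto simp: mult.commute[of M] intro: mult_left_mono)
  qed (use t in auto)
  then show ?thesis by simp
qed

lemma flow_displacement:
  assumes p: "p \<in> cball z0 (R/2)" and t: "\<bar>t\<bar> \<le> T"
  shows "norm (flow p t - p) \<le> M * \<bar>t\<bar>"
proof -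
  have "t \<in> {-T..T}" using t unfolding atLeastAtMost_iff by linarith
  moreover have "0 \<in> {-T..T}" using pos by simp
  ultimately show ?thesis using flow_time_lipschitz[OF p, of t 0] by (simp add: flow(1)[OF p])
qed

lemma continuous_on_flow: "continuous_on (cball z0 (R/2) \<times> {-T..T}) (\<lambda>z. flow (fst z) (snd z))"
proof -
  have "(2 + M)-lipschitz_on (cball z0 (R/2) \<times> {-T..T}) (\<lambda>z. flow (fst z) (snd z))"
  proof (rule lipschitz_onI)
    fix z w assume z: "z \<in> cball z0 (R/2) \<times> {-T..T}" and w: "w \<in> cball z0 (R/2) \<times> {-T..T}"
    have "norm (flow (fst z) (snd z) - flow (fst w) (snd w))
        \<le> norm (flow (fst z) (snd z) - flow (fst w) (snd z)) + norm (flow (fst w) (snd z) - flow (fst w) (snd w))"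
      using norm_triangle_ineq[of "flow (fst z) (snd z) - flow (fst w) (snd z)"
          "flow (fst w) (snd z) - flow (fst w) (snd w)"] by simp
    also have "\<dots> \<le> 2 * norm (fst z - fst w) + M * \<bar>snd z - snd w\<bar>"
      using z w by (intro add_mono flow_lipschitz(1) flow_time_lipschitz) (auto simp: mem_Times_iff)
    also have "\<dots> \<le> 2 * dist z w + M * dist z w"
      using dist_fst_le[of z w] dist_snd_le[of z w] const_nonneg
      by (intro add_mono mult_left_mono) (auto simp: dist_norm)
    finally show "dist (flow (fst z) (snd z)) (flow (fst w) (snd w)) \<le> (2 + M) * dist z w"
      by (simp add: dist_norm distrib_right)
  qed (use const_nonneg in auto)
  then show ?thesis by (rule lipschitz_on_continuous_on)
qed

lemma flow_first_order:
  assumes p: "p \<in> cball z0 (R/2)" and t: "\<bar>t\<bar> \<le> T"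
  shows "norm (flow p t - p - t *\<^sub>R F p) \<le> L * M * t\<^sup>2"
proof -
  have der: "((\<lambda>t. flow p t - t *\<^sub>R F p) has_vector_derivative F (flow p s) - F p) (at s within {-T..T})"
    if "s \<in> {-T..T}" for s
    using flow(3)[OF p that] by (auto intro!: derivative_eq_intros)
  have "norm ((flow p t - t *\<^sub>R F p) - (flow p 0 - 0 *\<^sub>R F p)) \<le> (L * (M * \<bar>t\<bar>)) * \<bar>t\<bar>"
  proof (rule norm_vector_derivative_bound[OF der t])
    fix s assume s: "\<bar>s\<bar> \<le> \<bar>t\<bar>"
    have "norm (F (flow p s) - F (flow p 0)) \<le> L * norm (flow p s - flow p 0)"
      using s t pos by (intro lipschitz flow(2)[OF p]) auto
    also have "\<dots> \<le> L * (M * \<bar>t\<bar>)"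
      using flow_displacement[OF p, of s] s t const_nonneg flow(1)[OF p]
      by (intro mult_left_mono) (auto intro: order_trans mult_left_mono)
    finally show "norm (F (flow p s) - F p) \<le> L * (M * \<bar>t\<bar>)" using flow(1)[OF p] by simp
  qed auto
  then show ?thesis by (simp add: flow(1)[OF p] power2_eq_square algebra_simps)
qed

text \<open>The derivative \<open>\<Phi> t\<close> in the starting point solves the variational equation \<open>\<Phi>' = DF (flow p t) \<Phi>\<close>, \<open>\<Phi> 0 = id\<close>; the
  linearization error of \<open>F\<close> is quadratic and stays so by the short-time Gronwall bound.\<close>

lemma flow_differentiable:
  assumes p: "p \<in> ball z0 (R/2)" and t: "\<bar>t\<bar> \<le> T"
  shows "\<exists>\<Phi>::'a \<Rightarrow>\<^sub>L 'a. ((\<lambda>q. flow q t) has_derivative blinfun_apply \<Phi>) (at p) \<and>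
    norm (\<Phi> - id_blinfun - t *\<^sub>R DF p) \<le> (2 * L\<^sup>2 + \<bar>C\<bar> * M) * t\<^sup>2"
proof -
  have p': "p \<in> cball z0 (R/2)" using p by simp
  have DF_lip': "norm (DF z - DF w) \<le> \<bar>C\<bar> * norm (z - w)" if "z \<in> B" "w \<in> B" for z w
    using DF_lip[OF that] by (smt (verit) mult_right_mono norm_ge_zero)
  let ?A = "\<lambda>t. DF (flow p t)"
  have cflow: "continuous_on {-T..T} (flow p)"
    using flow(3)[OF p'] by (meson continuous_on_vector_derivative)
  have "\<bar>C\<bar>-lipschitz_on B DF"
    by (rule lipschitz_onI) (use DF_lip' in \<open>auto simp: dist_norm\<close>)
  then have cDF: "continuous_on B DF" by (rule lipschitz_on_continuous_on)
  have cA: "continuous_on {-T..T} ?A"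
    by (rule continuous_on_compose2[OF cDF cflow]) (use flow(2)[OF p'] in auto)
  have "\<exists>\<Phi>::real \<Rightarrow> 'a \<Rightarrow>\<^sub>L 'a. \<Phi> 0 = id_blinfun \<and>
      (\<forall>t\<in>{-T..T}. (\<Phi> has_vector_derivative ?A t o\<^sub>L \<Phi> t) (at t within {-T..T}))"
  proof (rule picard_global[OF pos(2) const_nonneg(2) LT])
    show "norm ((?A t o\<^sub>L x) - (?A t o\<^sub>L y)) \<le> L * norm (x - y)" if "t \<in> {-T..T}" for t and x y :: "'a \<Rightarrow>\<^sub>L 'a"
    proof -
      have "(?A t o\<^sub>L x) - (?A t o\<^sub>L y) = ?A t o\<^sub>L (x - y)"
        by (rule blinfun_eqI) (simp add: blinfun.bilinear_simps)
      also have "norm \<dots> \<le> norm (?A t) * norm (x - y)" by (rule norm_blinfun_compose)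
      also have "\<dots> \<le> L * norm (x - y)"
        using DF_bound[OF flow(2)[OF p' that]] by (intro mult_right_mono) auto
      finally show ?thesis .
    qed
    show "continuous_on {-T..T} (\<lambda>t. ?A t o\<^sub>L y t)" if "continuous_on {-T..T} y" for y :: "real \<Rightarrow> 'a \<Rightarrow>\<^sub>L 'a"
      using cA that by (intro bounded_bilinear.continuous_on[OF bounded_bilinear_blinfun_compose])
  qed
  then obtain \<Phi> :: "real \<Rightarrow> 'a \<Rightarrow>\<^sub>L 'a" where \<Phi>0: "\<Phi> 0 = id_blinfun" and
    \<Phi>: "\<And>t. t \<in> {-T..T} \<Longrightarrow> (\<Phi> has_vector_derivative ?A t o\<^sub>L \<Phi> t) (at t within {-T..T})" by blast
  have A\<Phi>: "norm (?A s o\<^sub>L \<Phi> s) \<le> L * norm (\<Phi> s)" if "s \<in> {-T..T}" for s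
    using norm_blinfun_compose[of "?A s" "\<Phi> s"] DF_bound[OF flow(2)[OF p' that]]
    by (meson mult_right_mono norm_ge_zero order_trans)
  have n1: "norm (id_blinfun :: 'a \<Rightarrow>\<^sub>L 'a) \<le> 1" by (rule norm_blinfun_bound) auto
  have b1: "norm (\<Phi> s) \<le> 2" if "\<bar>s\<bar> \<le> T" for s
    using short_time_gronwall[OF \<Phi>, of L 0 s] A\<Phi> LT const_nonneg pos that n1 \<Phi>0 by auto
  have b2: "norm (\<Phi> s - id_blinfun) \<le> 2 * L * \<bar>s\<bar>" if s: "\<bar>s\<bar> \<le> T" for s
  proof -
    have "norm (\<Phi> s - \<Phi> 0) \<le> (L * 2) * \<bar>s\<bar>"
    proof (rule norm_vector_derivative_bound[OF \<Phi> s])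
      fix r assume "\<bar>r\<bar> \<le> \<bar>s\<bar>"
      then have r: "\<bar>r\<bar> \<le> T" using s by simp
      then have "norm (?A r o\<^sub>L \<Phi> r) \<le> L * norm (\<Phi> r)" by (intro A\<Phi>) auto
      also have "\<dots> \<le> L * 2" using b1[OF r] const_nonneg by (intro mult_left_mono) auto
      finally show "norm (?A r o\<^sub>L \<Phi> r) \<le> L * 2" .
    qed auto
    then show ?thesis by (simp add: \<Phi>0 mult.commute)
  qed
  have est: "norm (\<Phi> t - id_blinfun - t *\<^sub>R DF p) \<le> (2 * L\<^sup>2 + \<bar>C\<bar> * M) * t\<^sup>2"
  proof -
    have "norm ((\<Phi> t - t *\<^sub>R DF p) - (\<Phi> 0 - 0 *\<^sub>R DF p)) \<le> ((2 * L\<^sup>2 + \<bar>C\<bar> * M) * \<bar>t\<bar>) * \<bar>t\<bar>"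
    proof (rule norm_vector_derivative_bound[OF _ t, where y'="\<lambda>s. (?A s o\<^sub>L \<Phi> s) - DF p"])
      show "((\<lambda>t. \<Phi> t - t *\<^sub>R DF p) has_vector_derivative (?A s o\<^sub>L \<Phi> s) - DF p) (at s within {-T..T})"
        if "s \<in> {-T..T}" for s using \<Phi>[OF that] by (auto intro!: derivative_eq_intros)
      fix s assume s: "\<bar>s\<bar> \<le> \<bar>t\<bar>"
      then have sT: "\<bar>s\<bar> \<le> T" "s \<in> {-T..T}" using t by auto
      have "norm ((?A s o\<^sub>L \<Phi> s) - DF p) = norm ((?A s o\<^sub>L (\<Phi> s - id_blinfun)) + (?A s - DF p))"
        by (intro arg_cong[where f=norm] blinfun_eqI) (simp add: blinfun.bilinear_simps)
      also have "\<dots> \<le> norm (?A s) * norm (\<Phi> s - id_blinfun) + norm (?A s - DF p)"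
        using norm_triangle_ineq norm_blinfun_compose add_right_mono order_trans by meson
      also have "\<dots> \<le> L * (2 * L * \<bar>s\<bar>) + \<bar>C\<bar> * (M * \<bar>s\<bar>)"
      proof (intro add_mono mult_mono)
        show "norm (?A s) \<le> L" using DF_bound flow(2)[OF p'] sT by blast
        show "norm (\<Phi> s - id_blinfun) \<le> 2 * L * \<bar>s\<bar>" using b2 sT by blast
        have "norm (?A s - DF p) \<le> \<bar>C\<bar> * norm (flow p s - p)"
          using sT flow(2)[OF p'] p pos by (intro DF_lip') auto
        also have "\<dots> \<le> \<bar>C\<bar> * (M * \<bar>s\<bar>)" using flow_displacement[OF p' sT(1)] by (intro mult_left_mono) auto
        finally show "norm (?A s - DF p) \<le> \<bar>C\<bar> * (M * \<bar>s\<bar>)" .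
      qed (use const_nonneg in auto)
      also have "\<dots> = (2 * L\<^sup>2 + \<bar>C\<bar> * M) * \<bar>s\<bar>" by (simp add: power2_eq_square algebra_simps)
      also have "\<dots> \<le> (2 * L\<^sup>2 + \<bar>C\<bar> * M) * \<bar>t\<bar>"
        using s const_nonneg by (intro mult_left_mono) auto
      finally show "norm ((?A s o\<^sub>L \<Phi> s) - DF p) \<le> (2 * L\<^sup>2 + \<bar>C\<bar> * M) * \<bar>t\<bar>" .
    qed
    then show ?thesis by (simp add: \<Phi>0 power2_eq_square algebra_simps)
  qed
  \<comment> \<open>The derivative at a fixed time: the deviation of \<open>q\<close> from the linear prediction starts at \<open>0\<close> and is driven
    by an error quadratic in \<open>q - p\<close>.\<close>
  have "((\<lambda>q. flow q t) has_derivative blinfun_apply (\<Phi> t)) (at p)"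
  proof (rule has_derivative_quadraticI[where r="R/2 - dist z0 p" and K="8 * \<bar>C\<bar> * T"])
    show "bounded_linear (blinfun_apply (\<Phi> t))" by (rule blinfun.bounded_linear_right)
    show "0 < R/2 - dist z0 p" using p by simp
    fix q assume "dist q p < R/2 - dist z0 p"
    then have q: "q \<in> cball z0 (R/2)" using dist_triangle[of z0 q p] by (simp add: dist_commute)
    let ?e = "\<lambda>t. flow q t - flow p t - blinfun_apply (\<Phi> t) (q - p)"
    have "norm (?e t) \<le> 2 * norm (?e 0) + 2 * (4 * \<bar>C\<bar> * (norm (q - p))\<^sup>2) * \<bar>t\<bar>"
    proof (rule short_time_gronwall[where a=L])
      fix s assume s: "s \<in> {-T..T}"
      show "(?e has_vector_derivative F (flow q s) - F (flow p s) - blinfun_apply (?A s) (blinfun_apply (\<Phi> s) (q - p))) (at s within {-T..T})"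
        using flow(3)[OF p' s] flow(3)[OF q s]
          bounded_linear.has_vector_derivative[OF blinfun.bounded_linear_left \<Phi>[OF s], of "q - p"]
        by (auto intro!: has_vector_derivative_diff)
      have "norm (F (flow q s) - F (flow p s) - blinfun_apply (?A s) (blinfun_apply (\<Phi> s) (q - p)))
          = norm ((F (flow q s) - F (flow p s) - blinfun_apply (?A s) (flow q s - flow p s)) + blinfun_apply (?A s) (?e s))"
        by (simp add: blinfun.bilinear_simps algebra_simps)
      also have "\<dots> \<le> C * (norm (flow q s - flow p s))\<^sup>2 + norm (?A s) * norm (?e s)"
        using linearization[OF flow(2)[OF p' s] flow(2)[OF q s]] norm_blinfun[of "?A s" "?e s"]
        by (intro order_trans[OF norm_triangle_ineq] add_mono)
      also have "\<dots> \<le> \<bar>C\<bar> * (2 * norm (q - p))\<^sup>2 + L * norm (?e s)"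
      proof (intro add_mono mult_mono power_mono)
        show "norm (flow q s - flow p s) \<le> 2 * norm (q - p)" using flow_lipschitz(1)[OF q p'] s by auto
        show "norm (?A s) \<le> L" using DF_bound flow(2)[OF p' s] by blast
      qed (use const_nonneg in auto)
      finally show "norm (F (flow q s) - F (flow p s) - blinfun_apply (?A s) (blinfun_apply (\<Phi> s) (q - p)))
          \<le> L * norm (?e s) + 4 * \<bar>C\<bar> * (norm (q - p))\<^sup>2" by (simp add: power2_eq_square)
    qed (use LT const_nonneg pos t in auto)
    also have "\<dots> = 8 * \<bar>C\<bar> * \<bar>t\<bar> * (norm (q - p))\<^sup>2"
      by (simp add: flow(1)[OF p'] flow(1)[OF q] \<Phi>0)
    also have "\<dots> \<le> 8 * \<bar>C\<bar> * T * (norm (q - p))\<^sup>2"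
      using t by (intro mult_right_mono mult_left_mono) auto
    finally show "norm (?e t) \<le> 8 * \<bar>C\<bar> * T * (norm (q - p))\<^sup>2" .
  qed
  then show ?thesis using est by blast
qed

end

lemma onorm_le_sum_Basis:
  fixes f :: "'a::euclidean_space \<Rightarrow> 'b::real_normed_vector"
  assumes "linear f"
  shows "norm (f h) \<le> (\<Sum>b\<in>Basis. norm (f b)) * norm h"
proof -
  have "norm (f h) \<le> (\<Sum>b\<in>Basis. norm ((h \<bullet> b) *\<^sub>R f b))"
    by (subst linear_basis_sum[OF assms]) (rule norm_sum)
  also have "\<dots> \<le> (\<Sum>b\<in>Basis. norm h * norm (f b))"
    by (intro sum_mono) (simp add: Basis_le_norm mult_right_mono)
  finally show ?thesis by (simp add: sum_distrib_left[symmetric] mult.commute)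
qed

lemma compact_family_bound:
  fixes f :: "'i \<Rightarrow> 'a::metric_space \<Rightarrow> 'b::real_normed_vector"
  assumes "compact K" "finite I" "\<And>i. i \<in> I \<Longrightarrow> continuous_on K (f i)"
  shows "\<exists>M\<ge>0. \<forall>x\<in>K. (\<Sum>i\<in>I. norm (f i x)) \<le> M"
proof -
  have "continuous_on K (\<lambda>x. \<Sum>i\<in>I. norm (f i x))"
    by (intro continuous_on_sum continuous_on_norm assms)
  then have "bounded ((\<lambda>x. \<Sum>i\<in>I. norm (f i x)) ` K)"
    using assms(1) by (intro compact_imp_bounded compact_continuous_image)
  then obtain M where "M > 0" "\<forall>y\<in>(\<lambda>x. \<Sum>i\<in>I. norm (f i x)) ` K. norm y \<le> M"
    unfolding bounded_pos by blast
  then show ?thesis by (intro exI[of _ M]) auto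
qed

lemma C1_lipschitz_on_cball:
  fixes f :: "'a::euclidean_space \<Rightarrow> 'b::real_normed_vector"
  assumes f: "Ck_on 1 S f" and S: "open S" "cball z R \<subseteq> S"
  shows "\<exists>K\<ge>0. (\<forall>x\<in>cball z R. \<forall>h. norm (frechet_derivative f (at x) h) \<le> K * norm h) \<and>
    (\<forall>x\<in>cball z R. \<forall>y\<in>cball z R. norm (f x - f y) \<le> K * norm (x - y))"
proof -
  have f1: "Ck_on (Suc 0) S f" using f by simp
  have d: "(f has_derivative frechet_derivative f (at x)) (at x)" if "x \<in> cball z R" for x
    using Ck_on_has_derivative_open[OF f1 S(1)] that S(2) by blast
  have "continuous_on (cball z R) (\<lambda>x. frechet_derivative f (at x) b)" for b
    using Ck_on_frechet_derivative[OF f1 S(1), of b] S(2) by (auto intro: continuous_on_subset)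
  then have "\<exists>K\<ge>0. \<forall>x\<in>cball z R. (\<Sum>b\<in>Basis. norm (frechet_derivative f (at x) b)) \<le> K"
    by (intro compact_family_bound) auto
  then obtain K where K: "K \<ge> 0" "\<And>x. x \<in> cball z R \<Longrightarrow> (\<Sum>b\<in>Basis. norm (frechet_derivative f (at x) b)) \<le> K"
    by blast
  have b: "norm (frechet_derivative f (at x) h) \<le> K * norm h" if "x \<in> cball z R" for x h
    using onorm_le_sum_Basis[OF has_derivative_linear[OF d[OF that]], of h] K(2)[OF that]
    by (meson mult_right_mono norm_ge_zero order_trans)
  have "norm (f x - f y) \<le> K * norm (x - y)" if "x \<in> cball z R" "y \<in> cball z R" for x y
    by (rule differentiable_bound[OF convex_cball has_derivative_at_withinI[OF d] _ that])
       (auto intro!: onorm_le b)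
  then show ?thesis using K(1) b by blast
qed

text \<open>Compactness of a small ball provides all the bounds; the Lipschitz bound for the derivative comes from the
  second derivatives, one basis direction at a time.\<close>

lemma smooth_imp_local_flow:
  fixes F :: "'a::euclidean_space \<Rightarrow> 'a"
  assumes F: "smooth_on S F" and S: "open S" "z0 \<in> S"
  shows "\<exists>R M L C T. cball z0 R \<subseteq> S \<and> local_flow F (\<lambda>z. Blinfun (frechet_derivative F (at z))) z0 R M L C T"
proof -
  obtain R where R: "R > 0" "cball z0 R \<subseteq> S" using S open_contains_cball by blast
  let ?B = "cball z0 R" and ?D = "\<lambda>z. frechet_derivative F (at z)"
  have F1: "Ck_on 1 S F" using F by (simp add: smooth_on_def)
  obtain L where L: "L \<ge> 0" "\<And>z h. z \<in> ?B \<Longrightarrow> norm (?D z h) \<le> L * norm h"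
    using C1_lipschitz_on_cball[OF F1 S(1) R(2)] by blast
  have "\<exists>C\<ge>0. \<forall>x\<in>?B. \<forall>y\<in>?B. norm (?D x b - ?D y b) \<le> C * norm (x - y)" for b
  proof -
    have "Ck_on 1 S (\<lambda>z. ?D z b)" using smooth_on_frechet_derivative[OF F S(1)] by (simp add: smooth_on_def)
    from C1_lipschitz_on_cball[OF this S(1) R(2)] show ?thesis by blast
  qed
  then obtain c where c: "\<And>b. c b \<ge> 0" "\<And>b x y. x \<in> ?B \<Longrightarrow> y \<in> ?B \<Longrightarrow> norm (?D x b - ?D y b) \<le> c b * norm (x - y)"
    by metis
  have "bounded (F ` ?B)"
    using continuous_on_subset[OF smooth_on_imp_continuous_on[OF F] R(2)]
    by (intro compact_imp_bounded compact_continuous_image) auto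
  then obtain M where M: "M > 0" "\<And>z. z \<in> ?B \<Longrightarrow> norm (F z) \<le> M" unfolding bounded_pos by auto
  define T where "T = min (R / (2 * M)) (1 / (8 * (L + 1)))"
  have T: "T > 0" using R(1) M(1) L(1) by (simp add: T_def)
  have dF: "(F has_derivative ?D z) (at z)" if "z \<in> ?B" for z
    using smooth_on_has_derivative[OF F S(1)] that R(2) by blast
  have Bl: "blinfun_apply (Blinfun (?D z)) = ?D z" if "z \<in> ?B" for z
    using has_derivative_bounded_linear[OF dF[OF that]] by (rule bounded_linear_Blinfun_apply)
  have "local_flow F (\<lambda>z. Blinfun (?D z)) z0 R M L (\<Sum>b\<in>Basis. c b) T"
  proof
    show "0 < R" "0 < T" by fact+
    have "T \<le> R / (2 * M)" by (simp add: T_def)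
    then show "M * T \<le> R / 2" using M(1) by (simp add: field_simps)
    have "T \<le> 1 / (8 * (L + 1))" by (simp add: T_def)
    then have "8 * (L + 1) * T \<le> 1" using L(1) by (simp add: field_simps)
    then show "8 * L * T \<le> 1" using T by (simp add: algebra_simps)
    show "norm (F z) \<le> M" if "z \<in> ?B" for z using M(2) that .
    show "(F has_derivative blinfun_apply (Blinfun (?D z))) (at z within ?B)" if "z \<in> ?B" for z
      unfolding Bl[OF that] using dF[OF that] by (rule has_derivative_at_withinI)
    show "norm (Blinfun (?D z)) \<le> L" if "z \<in> ?B" for z
      by (rule norm_blinfun_bound) (use L that in \<open>simp_all add: Bl\<close>)
    show "norm (Blinfun (?D z) - Blinfun (?D w)) \<le> (\<Sum>b\<in>Basis. c b) * norm (z - w)" if "z \<in> ?B" "w \<in> ?B" for z w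
    proof -
      have "norm (Blinfun (?D z) - Blinfun (?D w)) \<le> (\<Sum>b\<in>Basis. norm ((Blinfun (?D z) - Blinfun (?D w)) b))"
        by (rule norm_blinfun_euclidean_le)
      also have "\<dots> \<le> (\<Sum>b\<in>Basis. c b * norm (z - w))"
        by (intro sum_mono) (use c(2)[OF that] Bl[OF that(1)] Bl[OF that(2)] in \<open>simp add: minus_blinfun.rep_eq\<close>)
      finally show ?thesis by (simp add: sum_distrib_right)
    qed
  qed
  then show ?thesis using R(2) by blast
qed

text \<open>If a solution is \<open>C\<^sup>k\<close>, then so is its derivative \<open>F \<circ> y\<close>, hence the solution is \<open>C\<^sup>k\<^sup>+\<^sup>1\<close>.\<close>

lemma solution_smooth:
  fixes F :: "'a::euclidean_space \<Rightarrow> 'a" and y :: "real \<Rightarrow> 'a"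
  assumes F: "smooth_on S F" and J: "thick J" and yS: "y ` J \<subseteq> S"
    and y: "\<And>t. t \<in> J \<Longrightarrow> (y has_vector_derivative F (y t)) (at t within J)"
  shows "smooth_on J y"
  unfolding smooth_on_def
proof
  fix k show "Ck_on k J y"
  proof (induction k)
    case 0
    then show ?case using continuous_on_vector_derivative[OF y] by simp
  next
    case (Suc k)
    show ?case
    proof (rule Ck_on_SucI[OF J])
      show "(y has_derivative (\<lambda>h. h *\<^sub>R F (y t))) (at t within J)" if "t \<in> J" for t
        using y[OF that] by (simp add: has_vector_derivative_def)
      show "Ck_on k J (\<lambda>t. h *\<^sub>R F (y t))" for h
        by (intro Ck_on_scaleR Ck_on_const J Ck_on_compose[OF J _ Suc yS]) (use F in \<open>simp add: smooth_on_def\<close>)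
    qed
  qed
qed

section \<open>Functions that vary slowly along a bracket generating family of steps\<close>

text \<open>\<open>H (s, \<cdot>)\<close> is a deformation of the identity with parameter \<open>s\<close> and initial velocity \<open>L s\<close> at \<open>q\<close>, and it
  moves points without changing \<open>\<phi>\<close> by more than \<open>\<epsilon>\<close>.  The parameter is a vector of the same dimension as the space, so that
  a deformation with invertible \<open>L\<close> can reach a whole neighbourhood; apart from the derivative at
  the single point \<open>(0, q)\<close> only continuity is demanded, which suffices for the open mapping theorem and is preserved by
  all constructions below.\<close>

definition movable :: "('e::euclidean_space \<Rightarrow> real) \<Rightarrow> real \<Rightarrow> 'e \<Rightarrow> ('e \<Rightarrow> 'e) \<Rightarrow> bool" where
  "movable \<phi> \<epsilon> q L \<longleftrightarrow> (\<exists>H U. open U \<and> (0, q) \<in> U \<and> continuous_on U H \<and> H (0, q) = q \<and>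
     (H has_derivative (\<lambda>z. L (fst z) + snd z)) (at (0, q)) \<and>
     (\<forall>z\<in>U. \<bar>\<phi> (H z) - \<phi> (snd z)\<bar> \<le> \<epsilon>))"

lemma movable_mono: "movable \<phi> \<epsilon> q L \<Longrightarrow> \<epsilon> \<le> \<delta> \<Longrightarrow> movable \<phi> \<delta> q L"
  unfolding movable_def by (erule ex_forward)+ auto

lemma movable_zero: "movable \<phi> 0 q (\<lambda>s. 0)"
  unfolding movable_def
  by (rule exI[of _ snd], rule exI[of _ UNIV])
     (auto intro: bounded_linear_imp_has_derivative bounded_linear_snd continuous_on_snd)

text \<open>Carrying out one deformation after the other adds the velocities and the costs.\<close>

lemma movable_add:
  assumes "movable \<phi> \<epsilon> q L" "movable \<phi> \<delta> q L'"
  shows "movable \<phi> (\<epsilon> + \<delta>) q (\<lambda>s. L s + L' s)"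
proof -
  obtain H U where H: "open U" "(0, q) \<in> U" "continuous_on U H" "H (0, q) = q"
    "(H has_derivative (\<lambda>z. L (fst z) + snd z)) (at (0, q))"
    "\<And>z. z \<in> U \<Longrightarrow> \<bar>\<phi> (H z) - \<phi> (snd z)\<bar> \<le> \<epsilon>"
    using assms(1) unfolding movable_def by blast
  obtain H' U' where H': "open U'" "(0, q) \<in> U'" "continuous_on U' H'" "H' (0, q) = q"
    "(H' has_derivative (\<lambda>z. L' (fst z) + snd z)) (at (0, q))"
    "\<And>z. z \<in> U' \<Longrightarrow> \<bar>\<phi> (H' z) - \<phi> (snd z)\<bar> \<le> \<delta>"
    using assms(2) unfolding movable_def by blast
  define P where "P z = (fst z, H z)" for z
  define V where "V = U \<inter> P -` U'"
  have cP: "continuous_on U P" unfolding P_def by (intro continuous_intros H)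
  have P0: "P (0, q) = (0, q)" by (simp add: P_def H)
  have dP: "(P has_derivative (\<lambda>z. (fst z, L (fst z) + snd z))) (at (0, q))"
    unfolding P_def by (intro has_derivative_Pair has_derivative_fst has_derivative_ident H)
  show ?thesis unfolding movable_def
  proof (intro exI[of _ "\<lambda>z. H' (P z)"] exI[of _ V] conjI ballI)
    show "open V" unfolding V_def by (intro continuous_open_preimage cP H H')
    show "(0, q) \<in> V" using H H' P0 by (auto simp: V_def)
    show "continuous_on V (\<lambda>z. H' (P z))"
      by (rule continuous_on_compose2[OF H'(3) continuous_on_subset[OF cP]]) (auto simp: V_def)
    show "H' (P (0, q)) = q" by (simp add: P0 H')
    have "((\<lambda>z. H' (P z)) has_derivative
        (\<lambda>z. L' (fst (fst z, L (fst z) + snd z)) + snd (fst z, L (fst z) + snd z))) (at (0, q))"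
      using has_derivative_compose[OF dP, of H' "\<lambda>z. L' (fst z) + snd z"] H'(5) P0 by simp
    then show "((\<lambda>z. H' (P z)) has_derivative (\<lambda>z. L (fst z) + L' (fst z) + snd z)) (at (0, q))"
      by (simp add: algebra_simps)
    fix z assume "z \<in> V"
    then have "\<bar>\<phi> (H z) - \<phi> (snd z)\<bar> \<le> \<epsilon>" "\<bar>\<phi> (H' (P z)) - \<phi> (H z)\<bar> \<le> \<delta>"
      using H(6)[of z] H'(6)[of "P z"] by (auto simp: V_def P_def)
    then show "\<bar>\<phi> (H' (P z)) - \<phi> (snd z)\<bar> \<le> \<epsilon> + \<delta>" by linarith
  qed
qed

text \<open>The deformation is transported by \<open>\<Phi>\<close> and back; each of the two transports costs at most \<open>\<delta>\<close>.  Invariance of domain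
  makes \<open>\<Phi>\<close> a homeomorphism onto an open set although it is only known to be differentiable at \<open>q\<close>.\<close>

lemma movable_conjugate:
  fixes \<phi> :: "'e::euclidean_space \<Rightarrow> real" and \<Phi> :: "'e \<Rightarrow> 'e" and \<epsilon> \<delta> :: real
  assumes V: "open V" "q \<in> V" and \<Phi>: "continuous_on V \<Phi>" "inj_on \<Phi> V" "(\<Phi> has_derivative M) (at q)"
    and N: "bounded_linear N" "\<And>h. N (M h) = h"
    and \<delta>: "\<And>y. y \<in> V \<Longrightarrow> \<bar>\<phi> (\<Phi> y) - \<phi> y\<bar> \<le> \<delta>"
    and mov: "movable \<phi> \<epsilon> (\<Phi> q) L"
  shows "movable \<phi> (\<epsilon> + 2 * \<delta>) q (\<lambda>s. N (L s))"
proof -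
  obtain H U where H: "open U" "(0, \<Phi> q) \<in> U" "continuous_on U H" "H (0, \<Phi> q) = \<Phi> q"
    "(H has_derivative (\<lambda>z. L (fst z) + snd z)) (at (0, \<Phi> q))"
    "\<And>z. z \<in> U \<Longrightarrow> \<bar>\<phi> (H z) - \<phi> (snd z)\<bar> \<le> \<epsilon>"
    using mov unfolding movable_def by blast
  have opW: "open (\<Phi> ` V)" using invariance_of_domain[OF \<Phi>(1) V(1) \<Phi>(2)] .
  obtain \<Psi> where "homeomorphism V (\<Phi> ` V) \<Phi> \<Psi>"
    using invariance_of_domain_homeomorphism[OF V(1) \<Phi>(1) _ \<Phi>(2)] by auto
  then have \<Psi>: "continuous_on (\<Phi> ` V) \<Psi>" "\<And>y. y \<in> V \<Longrightarrow> \<Psi> (\<Phi> y) = y" "\<And>z. z \<in> \<Phi> ` V \<Longrightarrow> \<Phi> (\<Psi> z) = z"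
    "\<And>z. z \<in> \<Phi> ` V \<Longrightarrow> \<Psi> z \<in> V"
    by (auto simp: homeomorphism_def)
  have d\<Psi>: "(\<Psi> has_derivative N) (at (\<Phi> q))"
  proof (rule has_derivative_inverse_basic[where T="\<Phi> ` V" and f'=M])
    show "(\<Phi> has_derivative M) (at (\<Psi> (\<Phi> q)))" using \<Phi>(3) \<Psi>(2) V by simp
    show "N \<circ> M = id" using N(2) by auto
    show "continuous (at (\<Phi> q)) \<Psi>" using \<Psi>(1) opW V(2) continuous_on_eq_continuous_at by blast
  qed (use N opW V \<Psi>(3) in auto)
  define P where "P z = (fst z, \<Phi> (snd z))" for z :: "'e \<times> 'e"
  define U1 where "U1 = (UNIV \<times> V) \<inter> P -` U"
  define U2 where "U2 = U1 \<inter> (\<lambda>z. H (P z)) -` (\<Phi> ` V)"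
  have cP: "continuous_on (UNIV \<times> V) P" unfolding P_def
    by (intro continuous_intros continuous_on_compose2[OF \<Phi>(1)]) auto
  have op1: "open U1" unfolding U1_def
    by (intro continuous_open_preimage cP H open_Times open_UNIV V)
  have cHP: "continuous_on U1 (\<lambda>z. H (P z))"
    by (rule continuous_on_compose2[OF H(3) continuous_on_subset[OF cP]]) (auto simp: U1_def)
  have dP: "(P has_derivative (\<lambda>z. (fst z, M (snd z)))) (at (0, q))"
    unfolding P_def
    by (intro has_derivative_Pair has_derivative_fst has_derivative_ident
        has_derivative_compose[where g=\<Phi> and f=snd] has_derivative_snd) (simp add: \<Phi>)
  have P0: "P (0, q) = (0, \<Phi> q)" by (simp add: P_def)
  show ?thesis unfolding movable_def
  proof (intro exI[of _ "\<lambda>z. \<Psi> (H (P z))"] exI[of _ U2] conjI ballI)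
    show "open U2" unfolding U2_def by (intro continuous_open_preimage cHP op1 opW)
    show "(0, q) \<in> U2" using V H by (auto simp: U1_def U2_def P_def)
    show "continuous_on U2 (\<lambda>z. \<Psi> (H (P z)))"
      by (rule continuous_on_compose2[OF \<Psi>(1) continuous_on_subset[OF cHP]]) (auto simp: U2_def)
    show "\<Psi> (H (P (0, q))) = q" using V by (simp add: P0 H \<Psi>)
    have "((\<lambda>z. H (P z)) has_derivative (\<lambda>z. L (fst z) + M (snd z))) (at (0, q))"
      using has_derivative_compose[OF dP, of H "\<lambda>z. L (fst z) + snd z"] H(5) P0 by simp
    then have "((\<lambda>z. \<Psi> (H (P z))) has_derivative (\<lambda>z. N (L (fst z) + M (snd z)))) (at (0, q))"
      by (rule has_derivative_compose) (simp add: P0 H d\<Psi>)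
    then show "((\<lambda>z. \<Psi> (H (P z))) has_derivative (\<lambda>z. N (L (fst z)) + snd z)) (at (0, q))"
      using N by (simp add: linear_simps)
    fix z assume z: "z \<in> U2"
    then have "\<bar>\<phi> (H (P z)) - \<phi> (\<Phi> (snd z))\<bar> \<le> \<epsilon>"
      using H(6)[of "P z"] by (auto simp: U1_def U2_def P_def)
    moreover have "\<bar>\<phi> (\<Phi> (snd z)) - \<phi> (snd z)\<bar> \<le> \<delta>" using \<delta> z by (auto simp: U1_def U2_def)
    moreover have "\<bar>\<phi> (\<Phi> (\<Psi> (H (P z)))) - \<phi> (\<Psi> (H (P z)))\<bar> \<le> \<delta>"
      using z by (intro \<delta> \<Psi>(4)) (auto simp: U2_def)
    moreover have "\<Phi> (\<Psi> (H (P z))) = H (P z)" using z by (intro \<Psi>(3)) (auto simp: U2_def)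
    ultimately show "\<bar>\<phi> (\<Psi> (H (P z))) - \<phi> (snd z)\<bar> \<le> \<epsilon> + 2 * \<delta>" by simp
  qed
qed

text \<open>By the open mapping theorem for maps that are differentiable at one point, the positions \<open>H (s, q)\<close> fill a neighbourhood of \<open>q\<close>.\<close>

lemma movable_surj_imp_nearby:
  fixes \<phi> :: "'e::euclidean_space \<Rightarrow> real" and \<epsilon> :: real
  assumes "movable \<phi> \<epsilon> q L" "linear g" "L \<circ> g = id"
  shows "\<exists>V. open V \<and> q \<in> V \<and> (\<forall>y\<in>V. \<bar>\<phi> y - \<phi> q\<bar> \<le> \<epsilon>)"
proof -
  obtain H U where H: "open U" "(0, q) \<in> U" "continuous_on U H" "H (0, q) = q"
    "(H has_derivative (\<lambda>z. L (fst z) + snd z)) (at (0, q))"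
    "\<And>z. z \<in> U \<Longrightarrow> \<bar>\<phi> (H z) - \<phi> (snd z)\<bar> \<le> \<epsilon>"
    using assms(1) unfolding movable_def by blast
  define S where "S = (\<lambda>s. (s, q)) -` U"
  have cP: "continuous_on UNIV (\<lambda>s. (s, q))" by (intro continuous_intros)
  have S: "open S" using continuous_open_preimage[OF cP open_UNIV H(1)] by (simp add: S_def)
  have "((\<lambda>s. (s, q)) has_derivative (\<lambda>s. (s, 0))) (at 0)"
    by (intro has_derivative_Pair has_derivative_ident has_derivative_const)
  from has_derivative_compose[OF this H(5)]
  have d: "((\<lambda>s. H (s, q)) has_derivative L) (at 0)" by simp
  have "H (0, q) \<in> interior ((\<lambda>s. H (s, q)) ` S)"
  proof (rule sussmann_open_mapping[OF S _ _ d])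
    show "continuous_on S (\<lambda>s. H (s, q))"
      by (rule continuous_on_compose2[OF H(3) continuous_on_subset[OF cP]]) (auto simp: S_def)
    show "0 \<in> S" "0 \<in> interior S" using H(2) interior_open[OF S] by (auto simp: S_def)
    show "bounded_linear g" using assms(2) by (simp add: linear_conv_bounded_linear)
  qed (use assms in auto)
  then have "q \<in> interior ((\<lambda>s. H (s, q)) ` S)" by (simp add: H)
  moreover have "\<bar>\<phi> y - \<phi> q\<bar> \<le> \<epsilon>" if "y \<in> interior ((\<lambda>s. H (s, q)) ` S)" for y
    using that interior_subset H(6) by (force simp: S_def)
  ultimately show ?thesis using open_interior by blast
qed

text \<open>The scalar parameter \<open>s \<bullet> c\<close> in place of a real parameter lets deformations in different directions be
  superposed with \<open>movable_add\<close>.\<close>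

definition directions :: "('e::euclidean_space \<Rightarrow> real) \<Rightarrow> real \<Rightarrow> 'e \<Rightarrow> 'e set" where
  "directions \<phi> \<epsilon> q = {w. \<forall>c. movable \<phi> \<epsilon> q (\<lambda>s. (s \<bullet> c) *\<^sub>R w)}"

lemma directions_mono: "\<epsilon> \<le> \<delta> \<Longrightarrow> directions \<phi> \<epsilon> q \<subseteq> directions \<phi> \<delta> q"
  unfolding directions_def by (auto elim: movable_mono)

text \<open>A basis \<open>(w\<^sub>b)\<close> of attainable vectors, one for each standard basis vector \<open>b\<close>, yields the invertible velocity
  \<open>s \<mapsto> \<Sum>\<^sub>b (s \<bullet> b) w\<^sub>b\<close> by superposition.\<close>

lemma directions_span_imp_nearby:
  fixes \<phi> :: "'e::euclidean_space \<Rightarrow> real" and \<epsilon> :: real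
  assumes "span (directions \<phi> \<epsilon> q) = UNIV"
  shows "\<exists>V. open V \<and> q \<in> V \<and> (\<forall>y\<in>V. \<bar>\<phi> y - \<phi> q\<bar> \<le> DIM('e) * \<epsilon>)"
proof -
  obtain B where B: "B \<subseteq> directions \<phi> \<epsilon> q" "independent B" "directions \<phi> \<epsilon> q \<subseteq> span B"
    using maximal_independent_subset by blast
  have spB: "span B = UNIV" using span_minimal[OF B(3) subspace_span] assms by auto
  then have "card B = DIM('e)" using dim_span_eq_card_independent[OF B(2)] by simp
  then obtain f where f: "bij_betw f (Basis::'e set) B"
    using finite_same_card_bij[of "Basis::'e set" B] B(2) independent_imp_finite by auto
  define L where "L s = (\<Sum>b\<in>Basis. (s \<bullet> b) *\<^sub>R f b)" for s :: 'e
  have "movable \<phi> (card I * \<epsilon>) q (\<lambda>s. \<Sum>b\<in>I. (s \<bullet> b) *\<^sub>R f b)" if "I \<subseteq> Basis" for I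
    using finite_subset[OF that finite_Basis] that
  proof (induction I)
    case empty
    then show ?case using movable_zero by simp
  next
    case (insert b I)
    have "f b \<in> directions \<phi> \<epsilon> q" using f B(1) insert by (auto simp: bij_betw_def)
    then have "movable \<phi> \<epsilon> q (\<lambda>s. (s \<bullet> b) *\<^sub>R f b)" by (simp add: directions_def)
    then have mov: "movable \<phi> (\<epsilon> + card I * \<epsilon>) q (\<lambda>s. (s \<bullet> b) *\<^sub>R f b + (\<Sum>b\<in>I. (s \<bullet> b) *\<^sub>R f b))"
      using insert.IH insert.prems by (intro movable_add) auto
    have "real (card (insert b I)) * \<epsilon> = \<epsilon> + card I * \<epsilon>" using insert.hyps by (simp add: distrib_right)
    moreover have "(\<Sum>b\<in>insert b I. (s \<bullet> b) *\<^sub>R f b) = (s \<bullet> b) *\<^sub>R f b + (\<Sum>b\<in>I. (s \<bullet> b) *\<^sub>R f b)" for s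
      using insert.hyps by simp
    ultimately show ?case using mov by simp
  qed
  from this[of Basis] have mov: "movable \<phi> (DIM('e) * \<epsilon>) q L" unfolding L_def by simp
  have linL: "linear L" unfolding L_def
    by (rule linearI) (simp_all add: inner_add_left scaleR_add_left sum.distrib scaleR_sum_right)
  have "B \<subseteq> range L"
  proof
    fix w assume "w \<in> B"
    then obtain b where b: "b \<in> Basis" "w = f b" using f by (auto simp: bij_betw_def)
    have "L b = (\<Sum>b'\<in>Basis. if b' = b then f b' else 0)"
      unfolding L_def using b by (intro sum.cong) (auto simp: inner_Basis)
    also have "\<dots> = f b" using b by simp
    finally have "w = L b" using b by simp
    then show "w \<in> range L" by simp
  qed
  then have "span B \<subseteq> range L"
    using span_minimal[OF _ linear_subspace_image[OF linL subspace_UNIV]] by blast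
  then have "surj L" using spB by auto
  then obtain g where "linear g" "L \<circ> g = id" using linear_surjective_right_inverse[OF linL] by blast
  then show ?thesis using movable_surj_imp_nearby[OF mov] by blast
qed

text \<open>\<open>E i t\<close> is a step of length \<open>t\<close> that agrees to first order with the flow of the field \<open>X i\<close>, both in position and in its derivative
  in the starting point, and along which \<open>\<phi>\<close> varies at the rate \<open>c\<close>.  Geodesic steps with a fixed initial
  control have these properties, although they are not a flow on the manifold.\<close>

locale slow_steps =
  fixes \<phi> :: "'e::euclidean_space \<Rightarrow> real" and W :: "'e set" and I :: "'i set"
    and E :: "'i \<Rightarrow> real \<Rightarrow> 'e \<Rightarrow> 'e" and X :: "'i \<Rightarrow> 'e \<Rightarrow> 'e" and DX :: "'i \<Rightarrow> 'e \<Rightarrow> 'e \<Rightarrow> 'e"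
    and T C c :: real
  assumes W: "open W" and T: "T > 0"
    and step_cont: "\<And>i. i \<in> I \<Longrightarrow> continuous_on ({-T<..<T} \<times> W) (\<lambda>z. E i (fst z) (snd z))"
    and step_inj: "\<And>i t. i \<in> I \<Longrightarrow> \<bar>t\<bar> < T \<Longrightarrow> inj_on (E i t) W"
    and step_first_order: "\<And>i t y. i \<in> I \<Longrightarrow> \<bar>t\<bar> < T \<Longrightarrow> y \<in> W \<Longrightarrow>
          norm (E i t y - y - t *\<^sub>R X i y) \<le> C * t\<^sup>2"
    and step_deriv: "\<And>i t y. i \<in> I \<Longrightarrow> \<bar>t\<bar> < T \<Longrightarrow> y \<in> W \<Longrightarrow>
          \<exists>M. (E i t has_derivative M) (at y) \<and> (\<forall>h. norm (M h - h - t *\<^sub>R DX i y h) \<le> C * t\<^sup>2 * norm h)"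
    and field_deriv: "\<And>i y. i \<in> I \<Longrightarrow> y \<in> W \<Longrightarrow> (X i has_derivative DX i y) (at y)"
    and slow: "\<And>i t y. i \<in> I \<Longrightarrow> \<bar>t\<bar> < T \<Longrightarrow> y \<in> W \<Longrightarrow> \<bar>\<phi> (E i t y) - \<phi> y\<bar> \<le> c * \<bar>t\<bar>"
begin

definition tangential :: "('e \<Rightarrow> 'e) \<Rightarrow> bool" where
  "tangential Z \<longleftrightarrow> (\<forall>y\<in>W. \<forall>\<epsilon>>0. Z y \<in> span (directions \<phi> \<epsilon> y))"

lemma step_zero: "i \<in> I \<Longrightarrow> y \<in> W \<Longrightarrow> E i 0 y = y"
  using step_first_order[of i 0 y] T by simp

text \<open>The steps themselves are the deformation; its derivative at \<open>(0, q)\<close> combines the first-order property of the steps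
  with the continuity of the field.\<close>

lemma field_in_directions:
  assumes i: "i \<in> I" and q: "q \<in> W" and \<epsilon>: "\<epsilon> > 0"
  shows "X i q \<in> directions \<phi> \<epsilon> q"
  unfolding directions_def movable_def
proof (intro CollectI allI)
  fix c' :: 'e
  define \<tau> where "\<tau> = min T (\<epsilon> / (\<bar>c\<bar> + 1))"
  have \<tau>: "\<tau> > 0" "\<tau> \<le> T" "\<bar>c\<bar> * \<tau> \<le> \<epsilon>"
  proof -
    have "\<tau> \<le> \<epsilon> / (\<bar>c\<bar> + 1)" by (simp add: \<tau>_def)
    moreover have "\<bar>c\<bar> + 1 > 0" by simp
    ultimately have "(\<bar>c\<bar> + 1) * \<tau> \<le> \<epsilon>" by (simp add: pos_le_divide_eq mult.commute)
    moreover have "\<tau> > 0" using T \<epsilon> by (simp add: \<tau>_def add_nonneg_pos)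
    ultimately show "\<bar>c\<bar> * \<tau> \<le> \<epsilon>" by (simp add: distrib_right)
  qed (use T \<epsilon> in \<open>auto simp: \<tau>_def add_nonneg_pos\<close>)
  define P where "P z = (fst z \<bullet> c', snd z)" for z :: "'e \<times> 'e"
  define U where "U = P -` ({-\<tau><..<\<tau>} \<times> W)"
  define H where "H z = E i (fst (P z)) (snd (P z))" for z
  have cP: "continuous_on UNIV P" unfolding P_def by (intro continuous_intros)
  have XC: "isCont (X i) q" using field_deriv[OF i q] has_derivative_continuous by blast
  show "\<exists>H U. open U \<and> (0, q) \<in> U \<and> continuous_on U H \<and> H (0, q) = q \<and>
     (H has_derivative (\<lambda>z. (fst z \<bullet> c') *\<^sub>R X i q + snd z)) (at (0, q)) \<and>
     (\<forall>z\<in>U. \<bar>\<phi> (H z) - \<phi> (snd z)\<bar> \<le> \<epsilon>)"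
  proof (intro exI[of _ H] exI[of _ U] conjI ballI)
    show opU: "open U" unfolding U_def using continuous_open_preimage[OF cP open_UNIV, of "{-\<tau><..<\<tau>} \<times> W"] W
      by (simp add: open_Times)
    show inU: "(0, q) \<in> U" using q \<tau> by (simp add: U_def P_def)
    show "continuous_on U H" unfolding H_def
      by (rule continuous_on_compose2[OF step_cont[OF i] continuous_on_subset[OF cP]])
         (use \<tau> in \<open>auto simp: U_def\<close>)
    show H0: "H (0, q) = q" using step_zero[OF i q] by (simp add: H_def P_def)
    show "\<bar>\<phi> (H z) - \<phi> (snd z)\<bar> \<le> \<epsilon>" if "z \<in> U" for z
    proof -
      have "\<bar>fst z \<bullet> c'\<bar> < \<tau>" "snd z \<in> W" using that by (auto simp: U_def P_def)
      then have "\<bar>\<phi> (H z) - \<phi> (snd z)\<bar> \<le> c * \<bar>fst z \<bullet> c'\<bar>"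
        using slow[OF i, of "fst z \<bullet> c'" "snd z"] \<tau> by (simp add: H_def P_def)
      also have "\<dots> \<le> \<bar>c\<bar> * \<tau>" using \<open>\<bar>fst z \<bullet> c'\<bar> < \<tau>\<close> by (intro mult_mono) auto
      finally show ?thesis using \<tau> by simp
    qed
    show "(H has_derivative (\<lambda>z. (fst z \<bullet> c') *\<^sub>R X i q + snd z)) (at (0, q))"
      unfolding has_derivative_at_alt
    proof (intro conjI allI impI)
      show "bounded_linear (\<lambda>z. (fst z \<bullet> c') *\<^sub>R X i q + snd z)"
        by (intro bounded_linear_add bounded_linear_snd bounded_linear_scaleR_const
            bounded_linear_compose[OF bounded_linear_inner_left bounded_linear_fst])
      fix e :: real assume e: "e > 0"
      define k where "k = norm c' + 1"
      have k: "k > 0" by (simp add: k_def add_nonneg_pos)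
      have "e / (2 * k) > 0" using e k by simp
      then obtain d1 where d1: "d1 > 0" "\<And>y. dist y q < d1 \<Longrightarrow> dist (X i y) (X i q) < e / (2 * k)"
        using XC unfolding continuous_at_eps_delta by blast
      obtain d2 where d2: "d2 > 0" "ball (0, q) d2 \<subseteq> U" using opU inU open_contains_ball by blast
      define d where "d = min (min d1 d2) (e / (2 * k\<^sup>2 * (\<bar>C\<bar> + 1)))"
      have "d > 0" using d1 d2 e k by (simp add: d_def add_nonneg_pos)
      moreover have "norm (H z - H (0, q) - ((fst (z - (0, q)) \<bullet> c') *\<^sub>R X i q + snd (z - (0, q)))) \<le> e * norm (z - (0, q))"
        if z: "norm (z - (0, q)) < d" for z
      proof -
        obtain s y where zz: "z = (s, y)" by (cases z)
        let ?n = "norm (z - (0, q))"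
        have "z \<in> ball (0, q) d2" using z by (simp add: d_def dist_norm norm_minus_commute)
        then have "z \<in> U" using d2 by auto
        then have y: "y \<in> W" "\<bar>s \<bullet> c'\<bar> < T" using \<tau> by (auto simp: U_def P_def zz)
        have ns: "norm s \<le> ?n" "norm (y - q) \<le> ?n"
          using norm_fst_le[of s "y - q"] norm_snd_le[of "y - q" s] by (auto simp: zz)
        have sc: "\<bar>s \<bullet> c'\<bar> \<le> k * ?n"
        proof -
          have "\<bar>s \<bullet> c'\<bar> \<le> norm s * norm c'" by (rule Cauchy_Schwarz_ineq2)
          also have "\<dots> \<le> ?n * k" using ns by (intro mult_mono) (auto simp: k_def)
          finally show ?thesis by (simp add: mult.commute)
        qed
        have "H z - H (0, q) - ((fst (z - (0, q)) \<bullet> c') *\<^sub>R X i q + snd (z - (0, q)))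
          = (E i (s \<bullet> c') y - y - (s \<bullet> c') *\<^sub>R X i y) + (s \<bullet> c') *\<^sub>R (X i y - X i q)"
          unfolding H0 by (simp add: H_def P_def zz algebra_simps)
        also have "norm \<dots> \<le> C * (s \<bullet> c')\<^sup>2 + \<bar>s \<bullet> c'\<bar> * norm (X i y - X i q)"
          using step_first_order[OF i y(2,1)] by (intro order_trans[OF norm_triangle_ineq] add_mono) auto
        also have "\<dots> \<le> (\<bar>C\<bar> + 1) * (k * ?n)\<^sup>2 + (k * ?n) * (e / (2 * k))"
        proof (intro add_mono mult_mono)
          show "(s \<bullet> c')\<^sup>2 \<le> (k * ?n)\<^sup>2" using power_mono[OF sc abs_ge_zero, of 2] by simp
          have "dist y q < d1" using ns z by (simp add: d_def dist_norm)
          then show "norm (X i y - X i q) \<le> e / (2 * k)" using d1(2)[of y] by (simp add: dist_norm)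
        qed (use sc k e in auto)
        also have "\<dots> = ((\<bar>C\<bar> + 1) * k\<^sup>2 * ?n) * ?n + (e / 2) * ?n"
          using k by (simp add: power2_eq_square)
        also have "\<dots> \<le> (e / 2) * ?n + (e / 2) * ?n"
        proof (intro add_mono mult_right_mono)
          have "?n \<le> e / (2 * k\<^sup>2 * (\<bar>C\<bar> + 1))" using z by (simp add: d_def)
          moreover have "2 * k\<^sup>2 * (\<bar>C\<bar> + 1) > 0" using k by (simp add: add_nonneg_pos)
          ultimately have "?n * (2 * k\<^sup>2 * (\<bar>C\<bar> + 1)) \<le> e" by (simp add: pos_le_divide_eq)
          then show "(\<bar>C\<bar> + 1) * k\<^sup>2 * ?n \<le> e / 2" by (simp add: algebra_simps)
        qed auto
        also have "\<dots> = e * ?n" by simp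
        finally show ?thesis .
      qed
      ultimately show "\<exists>d>0. \<forall>z. norm (z - (0, q)) < d \<longrightarrow>
          norm (H z - H (0, q) - ((fst (z - (0, q)) \<bullet> c') *\<^sub>R X i q + snd (z - (0, q)))) \<le> e * norm (z - (0, q))"
        by blast
    qed
  qed
qed

lemma tangential_field: "i \<in> I \<Longrightarrow> tangential (X i)"
  unfolding tangential_def using field_in_directions span_base by blast

lemma directions_pullback:
  assumes i: "i \<in> I" and q: "q \<in> W" and t: "\<bar>t\<bar> < T"
    and M: "(E i t has_derivative M) (at q)" and N: "linear N" "\<And>h. N (M h) = h"
    and w: "w \<in> span (directions \<phi> \<epsilon> (E i t q))"
  shows "N w \<in> span (directions \<phi> (\<epsilon> + 2 * (c * \<bar>t\<bar>)) q)"
proof -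
  have "continuous_on W (\<lambda>y. (t, y))" by (intro continuous_intros)
  moreover have "(\<lambda>y. (t, y)) ` W \<subseteq> {-T<..<T} \<times> W" using t by auto
  ultimately have cont: "continuous_on W (E i t)"
    using continuous_on_compose2[OF step_cont[OF i], of W "\<lambda>y. (t, y)"] by simp
  have bN: "bounded_linear N" using N(1) by (simp add: linear_conv_bounded_linear)
  have "N ` directions \<phi> \<epsilon> (E i t q) \<subseteq> directions \<phi> (\<epsilon> + 2 * (c * \<bar>t\<bar>)) q"
  proof
    fix v assume "v \<in> N ` directions \<phi> \<epsilon> (E i t q)"
    then obtain u where u: "v = N u" "\<And>c'. movable \<phi> \<epsilon> (E i t q) (\<lambda>s. (s \<bullet> c') *\<^sub>R u)"
      by (auto simp: directions_def)
    have "movable \<phi> (\<epsilon> + 2 * (c * \<bar>t\<bar>)) q (\<lambda>s. N ((s \<bullet> c') *\<^sub>R u))" for c'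
      by (rule movable_conjugate[OF W q cont step_inj[OF i t] M bN N(2) slow[OF i t] u(2)])
    then show "v \<in> directions \<phi> (\<epsilon> + 2 * (c * \<bar>t\<bar>)) q"
      by (simp add: directions_def u linear_cmul[OF N(1)])
  qed
  then show ?thesis using w linear_span_image[OF N(1)] span_mono by blast
qed

text \<open>Let \<open>M t\<close> be the derivative of \<open>E i t\<close> at \<open>q\<close>.  Pulling back by steps keeps \<open>(M t)\<^sup>-\<^sup>1 Z (E i t q)\<close> in the span
  of the vectors attainable at \<open>q\<close>.  At \<open>t = 0\<close> this curve passes through \<open>Z q\<close> with velocity
  \<open>DZ (X q) - DX (Z q)\<close>, the bracket of \<open>X\<close> and \<open>Z\<close>, and the span is closed.\<close>

lemma tangential_bracket:
  assumes i: "i \<in> I" and Z: "tangential Z" and DZ: "\<And>y. y \<in> W \<Longrightarrow> (Z has_derivative DZ y) (at y)"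
  shows "tangential (\<lambda>y. DZ y (X i y) - DX i y (Z y))"
  unfolding tangential_def
proof (intro ballI allI impI)
  fix q and \<epsilon> :: real assume q: "q \<in> W" and \<epsilon>: "\<epsilon> > 0"
  define V where "V = span (directions \<phi> \<epsilon> q)"
  define \<beta> where "\<beta> = DZ q (X i q) - DX i q (Z q)"
  have bDX: "bounded_linear (DX i q)" using field_deriv[OF i q] has_derivative_bounded_linear by blast
  define k where "k = onorm (DX i q) + \<bar>C\<bar> * T + 1"
  have k: "k > 0" using onorm_pos_le[OF bDX] T by (simp add: k_def add_nonneg_pos)
  have ex: "\<exists>M N. (E i t has_derivative M) (at q) \<and> linear N \<and> (\<forall>h. N (M h) = h) \<and> (\<forall>h. M (N h) = h)
      \<and> (\<forall>h. norm (M h - h - t *\<^sub>R DX i q h) \<le> C * t\<^sup>2 * norm h)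
      \<and> (\<forall>h. norm (M h - h) \<le> k * \<bar>t\<bar> * norm h)"
    if t: "\<bar>t\<bar> < min T (1 / (2 * k))" for t
  proof -
    obtain M where M: "(E i t has_derivative M) (at q)" "\<And>h. norm (M h - h - t *\<^sub>R DX i q h) \<le> C * t\<^sup>2 * norm h"
      using step_deriv[OF i _ q, of t] t by auto
    have Mk: "norm (M h - h) \<le> k * \<bar>t\<bar> * norm h" for h
    proof -
      have "norm (M h - h) \<le> norm (M h - h - t *\<^sub>R DX i q h) + norm (t *\<^sub>R DX i q h)"
        using norm_triangle_ineq[of "M h - h - t *\<^sub>R DX i q h" "t *\<^sub>R DX i q h"] by simp
      also have "\<dots> \<le> (\<bar>C\<bar> * T) * \<bar>t\<bar> * norm h + \<bar>t\<bar> * (onorm (DX i q) * norm h)"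
      proof (intro add_mono)
        have "norm (M h - h - t *\<^sub>R DX i q h) \<le> C * t\<^sup>2 * norm h" by (rule M)
        also have "\<dots> \<le> (\<bar>C\<bar> * T) * \<bar>t\<bar> * norm h"
        proof (intro mult_right_mono)
          have "C * t\<^sup>2 \<le> \<bar>C\<bar> * t\<^sup>2" by (intro mult_right_mono) auto
          also have "\<dots> = \<bar>C\<bar> * \<bar>t\<bar> * \<bar>t\<bar>" by (simp add: power2_eq_square)
          also have "\<dots> \<le> \<bar>C\<bar> * T * \<bar>t\<bar>" using t by (intro mult_right_mono mult_left_mono) auto
          finally show "C * t\<^sup>2 \<le> \<bar>C\<bar> * T * \<bar>t\<bar>" .
        qed auto
        finally show "norm (M h - h - t *\<^sub>R DX i q h) \<le> (\<bar>C\<bar> * T) * \<bar>t\<bar> * norm h" .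
        show "norm (t *\<^sub>R DX i q h) \<le> \<bar>t\<bar> * (onorm (DX i q) * norm h)"
          using onorm[OF bDX] by (simp add: mult_left_mono)
      qed
      also have "\<dots> = (k - 1) * \<bar>t\<bar> * norm h" by (simp add: k_def algebra_simps)
      also have "\<dots> \<le> k * \<bar>t\<bar> * norm h" by (intro mult_right_mono) auto
      finally show ?thesis .
    qed
    have linM: "linear M" using M(1) has_derivative_linear by blast
    have "inj M"
    proof (rule linear_injective_0[OF linM, THEN iffD2], intro allI impI)
      fix h assume "M h = 0"
      then have "norm h \<le> k * \<bar>t\<bar> * norm h" using Mk[of h] by simp
      also have "\<dots> \<le> 1/2 * norm h" using t k by (intro mult_right_mono) (auto simp: field_simps)
      finally show "h = 0" by simp
    qed
    then obtain N where N: "linear N" "\<And>h. N (M h) = h" "\<And>h. M (N h) = h"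
      using linear_injective_isomorphism[OF linM] by blast
    show ?thesis by (rule exI[of _ M], rule exI[of _ N]) (simp add: M Mk N)
  qed
  define Good where "Good t M N \<longleftrightarrow> (E i t has_derivative M) (at q) \<and> linear N \<and> (\<forall>h. N (M h) = h) \<and> (\<forall>h. M (N h) = h)
      \<and> (\<forall>h. norm (M h - h - t *\<^sub>R DX i q h) \<le> C * t\<^sup>2 * norm h)
      \<and> (\<forall>h. norm (M h - h) \<le> k * \<bar>t\<bar> * norm h)" for t M N
  define M where "M t = (SOME M. \<exists>N. Good t M N)" for t
  define N where "N t = (SOME N. Good t (M t) N)" for t
  have good: "Good t (M t) (N t)" if "\<bar>t\<bar> < min T (1 / (2 * k))" for t
  proof -
    have "\<exists>M N. Good t M N" using ex[OF that] unfolding Good_def .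
    then have "\<exists>N. Good t (M t) N" unfolding M_def by (rule someI_ex)
    then show ?thesis unfolding N_def by (rule someI_ex)
  qed
  define a where "a t = Z (E i t q) - M t (Z q)" for t
  define b where "b t = N t (a t)" for t
  have ev: "eventually (\<lambda>t. \<bar>t\<bar> < d) (at (0::real))" if "d > 0" for d
    using that unfolding eventually_at by (auto simp: dist_real_def)
  have small: "eventually (\<lambda>t. \<bar>t\<bar> < min T (1 / (2 * k))) (at 0)" using T k by (intro ev) auto
  have dE: "((\<lambda>t. E i t q) has_derivative (\<lambda>t. t *\<^sub>R X i q)) (at 0)"
  proof (rule has_derivative_quadraticI[OF _ T])
    show "bounded_linear (\<lambda>t. t *\<^sub>R X i q)" by (rule bounded_linear_scaleR_left)
    show "norm (E i t q - E i 0 q - (t - 0) *\<^sub>R X i q) \<le> C * (norm (t - 0))\<^sup>2" if "dist t 0 < T" for t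
      using step_first_order[OF i _ q, of t] that by (simp add: step_zero[OF i q])
  qed
  have "((\<lambda>t. Z (E i t q)) has_derivative (\<lambda>t. DZ q (t *\<^sub>R X i q))) (at 0)"
    by (rule has_derivative_compose[where g=Z, OF dE]) (simp add: step_zero[OF i q] DZ[OF q])
  moreover have "DZ q (t *\<^sub>R X i q) = t *\<^sub>R DZ q (X i q)" for t
    using linear_cmul[OF has_derivative_linear[OF DZ[OF q]]] by simp
  ultimately have "((\<lambda>t. Z (E i t q)) has_derivative (\<lambda>t. t *\<^sub>R DZ q (X i q))) (at 0)" by simp
  then have r: "((\<lambda>t. norm (Z (E i t q) - Z q - t *\<^sub>R DZ q (X i q)) / \<bar>t\<bar>) \<longlongrightarrow> 0) (at 0)"
    by (simp add: has_derivative_at step_zero[OF i q])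
  have a_lim: "((\<lambda>t. a t /\<^sub>R t) \<longlongrightarrow> \<beta>) (at 0)"
  proof (rule LIM_zero_cancel, rule Lim_null_comparison)
    have "((\<lambda>t. norm (Z (E i t q) - Z q - t *\<^sub>R DZ q (X i q)) / \<bar>t\<bar> + C * \<bar>t\<bar> * norm (Z q))
        \<longlongrightarrow> 0 + C * \<bar>0\<bar> * norm (Z q)) (at 0)"
      by (intro tendsto_intros r)
    then show "((\<lambda>t. norm (Z (E i t q) - Z q - t *\<^sub>R DZ q (X i q)) / \<bar>t\<bar> + C * \<bar>t\<bar> * norm (Z q)) \<longlongrightarrow> 0) (at 0)"
      by simp
    show "\<forall>\<^sub>F t in at 0. norm (a t /\<^sub>R t - \<beta>)
        \<le> norm (Z (E i t q) - Z q - t *\<^sub>R DZ q (X i q)) / \<bar>t\<bar> + C * \<bar>t\<bar> * norm (Z q)"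
      using small eventually_neq_at_within[of 0]
    proof eventually_elim
      fix t :: real assume t: "\<bar>t\<bar> < min T (1 / (2 * k))" "t \<noteq> 0"
      have "a t - t *\<^sub>R \<beta> = (Z (E i t q) - Z q - t *\<^sub>R DZ q (X i q)) - (M t (Z q) - Z q - t *\<^sub>R DX i q (Z q))"
        by (simp add: a_def \<beta>_def algebra_simps)
      also have "norm \<dots> \<le> norm (Z (E i t q) - Z q - t *\<^sub>R DZ q (X i q)) + C * t\<^sup>2 * norm (Z q)"
        by (rule order_trans[OF norm_triangle_ineq4 add_left_mono]) (use good[OF t(1)] in \<open>simp add: Good_def\<close>)
      finally have le: "norm (a t - t *\<^sub>R \<beta>) / \<bar>t\<bar>
          \<le> (norm (Z (E i t q) - Z q - t *\<^sub>R DZ q (X i q)) + C * t\<^sup>2 * norm (Z q)) / \<bar>t\<bar>"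
        by (rule divide_right_mono) simp
      have "norm (a t /\<^sub>R t - \<beta>) = norm ((a t - t *\<^sub>R \<beta>) /\<^sub>R t)"
        using t(2) by (simp add: scaleR_diff_right)
      also have "\<dots> = norm (a t - t *\<^sub>R \<beta>) / \<bar>t\<bar>" by (simp add: divide_inverse mult.commute)
      finally have eq: "norm (a t /\<^sub>R t - \<beta>) = norm (a t - t *\<^sub>R \<beta>) / \<bar>t\<bar>" .
      have "C * t\<^sup>2 * norm (Z q) / \<bar>t\<bar> = C * \<bar>t\<bar> * norm (Z q)"
        using t(2) by (cases "t \<ge> 0") (auto simp: power2_eq_square)
      then show "norm (a t /\<^sub>R t - \<beta>)
          \<le> norm (Z (E i t q) - Z q - t *\<^sub>R DZ q (X i q)) / \<bar>t\<bar> + C * \<bar>t\<bar> * norm (Z q)"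
        using le unfolding eq add_divide_distrib by simp
    qed
  qed
  have b_lim: "((\<lambda>t. b t /\<^sub>R t) \<longlongrightarrow> \<beta>) (at 0)"
  proof -
    have "((\<lambda>t. b t /\<^sub>R t - a t /\<^sub>R t) \<longlongrightarrow> 0) (at 0)"
    proof (rule Lim_null_comparison)
      have "((\<lambda>t. 2 * k * \<bar>t\<bar> * norm (a t /\<^sub>R t)) \<longlongrightarrow> 2 * k * \<bar>0\<bar> * norm \<beta>) (at 0)"
        by (intro tendsto_intros a_lim)
      then show "((\<lambda>t. 2 * k * \<bar>t\<bar> * norm (a t /\<^sub>R t)) \<longlongrightarrow> 0) (at 0)" by simp
      show "\<forall>\<^sub>F t in at 0. norm (b t /\<^sub>R t - a t /\<^sub>R t) \<le> 2 * k * \<bar>t\<bar> * norm (a t /\<^sub>R t)"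
        using small
      proof eventually_elim
        fix t :: real assume t: "\<bar>t\<bar> < min T (1 / (2 * k))"
        have Mb: "M t (b t) = a t" using good[OF t] by (simp add: Good_def b_def)
        have "norm (M t (b t) - b t) \<le> k * \<bar>t\<bar> * norm (b t)" using good[OF t] by (simp add: Good_def)
        then have ab: "norm (b t - a t) \<le> k * \<bar>t\<bar> * norm (b t)" by (simp add: Mb norm_minus_commute)
        have "k * \<bar>t\<bar> * norm (b t) \<le> 1/2 * norm (b t)"
          using t k by (intro mult_right_mono) (auto simp: field_simps)
        then have "norm (b t) \<le> 2 * norm (a t)"
          using ab norm_triangle_ineq2[of "b t" "a t"] by linarith
        then have "k * \<bar>t\<bar> * norm (b t) \<le> k * \<bar>t\<bar> * (2 * norm (a t))"
          using k by (intro mult_left_mono) auto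
        then have le: "norm (b t - a t) \<le> 2 * k * \<bar>t\<bar> * norm (a t)" using ab by simp
        have "norm (b t /\<^sub>R t - a t /\<^sub>R t) = \<bar>inverse t\<bar> * norm (b t - a t)"
          by (simp flip: scaleR_diff_right)
        also have "\<dots> \<le> \<bar>inverse t\<bar> * (2 * k * \<bar>t\<bar> * norm (a t))"
          using le by (intro mult_left_mono) auto
        also have "\<dots> = 2 * k * \<bar>t\<bar> * norm (a t /\<^sub>R t)" by simp
        finally show "norm (b t /\<^sub>R t - a t /\<^sub>R t) \<le> 2 * k * \<bar>t\<bar> * norm (a t /\<^sub>R t)" .
      qed
    qed
    from tendsto_add[OF this a_lim] show ?thesis by simp
  qed
  have "\<forall>\<^sub>F t in at 0. b t /\<^sub>R t \<in> V"
  proof -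
    have stay: "\<forall>\<^sub>F t in at 0. E i t q \<in> W"
    proof -
      have "((\<lambda>t. E i t q) \<longlongrightarrow> E i 0 q) (at 0)"
        using has_derivative_continuous[OF dE] by (simp add: continuous_within)
      then show ?thesis using W q step_zero[OF i q] by (auto dest: topological_tendstoD)
    qed
    have "\<epsilon> / (4 * (\<bar>c\<bar> + 1)) > 0" using \<epsilon> by (simp add: add_nonneg_pos)
    from small ev[OF this] stay show ?thesis
    proof eventually_elim
      fix t :: real
      assume t: "\<bar>t\<bar> < min T (1 / (2 * k))" "\<bar>t\<bar> < \<epsilon> / (4 * (\<bar>c\<bar> + 1))" and tW: "E i t q \<in> W"
      have M: "(E i t has_derivative M t) (at q)" and N: "linear (N t)" "\<And>h. N t (M t h) = h"
        using good[OF t(1)] by (auto simp: Good_def)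
      have "4 * (\<bar>c\<bar> + 1) > 0" by simp
      then have "4 * ((\<bar>c\<bar> + 1) * \<bar>t\<bar>) < \<epsilon>" using t(2) by (simp add: pos_less_divide_eq mult_ac)
      moreover have "c * \<bar>t\<bar> \<le> (\<bar>c\<bar> + 1) * \<bar>t\<bar>" by (intro mult_right_mono) auto
      ultimately have le: "\<epsilon> / 2 + 2 * (c * \<bar>t\<bar>) \<le> \<epsilon>" by linarith
      have "Z (E i t q) \<in> span (directions \<phi> (\<epsilon>/2) (E i t q))"
        using Z tW \<epsilon> by (simp add: tangential_def)
      from directions_pullback[OF i q _ M N this] t(1)
      have "N t (Z (E i t q)) \<in> span (directions \<phi> (\<epsilon> / 2 + 2 * (c * \<bar>t\<bar>)) q)" by simp
      then have 1: "N t (Z (E i t q)) \<in> V"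
        using span_mono[OF directions_mono[OF le]] by (auto simp: V_def)
      have 2: "Z q \<in> V" using Z q \<epsilon> by (simp add: tangential_def V_def)
      have "b t = N t (Z (E i t q)) - Z q"
        using linear_diff[OF N(1)] N(2) by (simp add: b_def a_def)
      then have "b t \<in> V" using 1 2 by (simp add: V_def span_diff)
      then show "b t /\<^sub>R t \<in> V" by (simp add: V_def span_scale)
    qed
  qed
  moreover have "closed V" by (simp add: V_def closed_subspace)
  ultimately have "\<beta> \<in> V" using Lim_in_closed_set[OF _ _ _ b_lim] by simp
  then show "DZ q (X i q) - DX i q (Z q) \<in> span (directions \<phi> \<epsilon> q)" by (simp add: V_def \<beta>_def)
qed

lemma tangential_sum:
  assumes "\<And>j. j \<in> J \<Longrightarrow> tangential (Y j)" and "\<And>y. y \<in> W \<Longrightarrow> Z y = (\<Sum>j\<in>J. a j y *\<^sub>R Y j y)"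
  shows "tangential Z"
  unfolding tangential_def
proof (intro ballI allI impI)
  fix y and \<epsilon> :: real assume "y \<in> W" "\<epsilon> > 0"
  then show "Z y \<in> span (directions \<phi> \<epsilon> y)"
    using assms unfolding tangential_def by (simp add: span_sum span_scale)
qed

lemma tangential_add:
  assumes "tangential Y" "tangential Y'" and "\<And>y. y \<in> W \<Longrightarrow> Z y = Y y + Y' y"
  shows "tangential Z"
  unfolding tangential_def
proof (intro ballI allI impI)
  fix y and \<epsilon> :: real assume "y \<in> W" "\<epsilon> > 0"
  then show "Z y \<in> span (directions \<phi> \<epsilon> y)"
    using assms unfolding tangential_def by (simp add: span_add)
qed

text \<open>The Chow-Rashevskii theorem in the form that is needed here: the cost \<open>\<epsilon>\<close> is arbitrary, so the neighbourhoods of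
  \<open>directions_span_imp_nearby\<close> prove continuity.\<close>

theorem tangential_span_imp_continuous:
  assumes q: "q \<in> W" and S: "span {Z q |Z. tangential Z} = UNIV"
  shows "isCont \<phi> q"
  unfolding continuous_at_eps_delta
proof (intro allI impI)
  fix e :: real assume e: "e > 0"
  define \<epsilon> where "\<epsilon> = e / (2 * DIM('e))"
  have \<epsilon>: "\<epsilon> > 0" using e by (simp add: \<epsilon>_def)
  have "{Z q |Z. tangential Z} \<subseteq> span (directions \<phi> \<epsilon> q)"
    using q \<epsilon> by (auto simp: tangential_def)
  from span_minimal[OF this subspace_span] have "span (directions \<phi> \<epsilon> q) = UNIV"
    unfolding S by (rule top.extremum_uniqueI)
  from directions_span_imp_nearby[OF this]
  obtain V where V: "open V" "q \<in> V" "\<And>y. y \<in> V \<Longrightarrow> \<bar>\<phi> y - \<phi> q\<bar> \<le> DIM('e) * \<epsilon>"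
    by blast
  have "DIM('e) * \<epsilon> < e" using e by (simp add: \<epsilon>_def)
  then have "\<bar>\<phi> y - \<phi> q\<bar> < e" if "y \<in> V" for y using V(3)[OF that] by linarith
  moreover obtain d where "d > 0" "ball q d \<subseteq> V" using V open_contains_ball by blast
  ultimately show "\<exists>d>0. \<forall>y. dist y q < d \<longrightarrow> dist (\<phi> y) (\<phi> q) < e"
    by (intro exI[of _ d]) (auto simp: dist_real_def dist_commute subset_eq)
qed

end

section \<open>Following a horizontal curve by short steps\<close>

lemma first_order_remainder:
  fixes \<sigma> :: "real \<Rightarrow> 'a::real_normed_vector"
  assumes th: "t \<le> t'" and der: "\<And>s. s \<in> {t..t'} \<Longrightarrow> (\<sigma> has_vector_derivative \<sigma>' s) (at s within {t..t'})"
    and osc: "\<And>s. s \<in> {t..t'} \<Longrightarrow> norm (\<sigma>' s - v) \<le> e"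
  shows "norm (\<sigma> t' - \<sigma> t - (t' - t) *\<^sub>R v) \<le> e * (t' - t)"
proof -
  have "norm ((\<sigma> t' - t' *\<^sub>R v) - (\<sigma> t - t *\<^sub>R v)) \<le> e * norm (t' - t)"
  proof (rule differentiable_bound[where S="{t..t'}" and f'="\<lambda>s h. h *\<^sub>R (\<sigma>' s - v)"])
    fix s assume s: "s \<in> {t..t'}"
    show "((\<lambda>s. \<sigma> s - s *\<^sub>R v) has_derivative (\<lambda>h. h *\<^sub>R (\<sigma>' s - v))) (at s within {t..t'})"
      using der[OF s] unfolding has_vector_derivative_def
      by (auto intro!: derivative_eq_intros simp: algebra_simps)
    have "e \<ge> 0" using osc[OF s] norm_ge_zero order_trans by blast
    then show "onorm (\<lambda>h. h *\<^sub>R (\<sigma>' s - v)) \<le> e"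
      using osc[OF s] by (intro onorm_bound) (auto simp: mult.commute[of e] intro: mult_left_mono)
  qed (use th in auto)
  then show ?thesis using th by (simp add: algebra_simps)
qed

lemma norm_combine4:
  fixes x :: "'a::real_normed_vector"
  assumes "norm x \<le> a" "norm y \<le> b" "norm z \<le> c" "norm w \<le> d"
  shows "norm (x + (y + z) - w) \<le> a + (b + c) + d"
  using norm_triangle_ineq4[of "x + (y + z)" w] norm_triangle_ineq[of x "y + z"] norm_triangle_ineq[of y z]
    assms by linarith

text \<open>An Euler scheme: the points \<open>p\<close> are produced by steps with the controls \<open>h u (t\<^sub>j)\<close> of the curve.  Their
  distance from the curve obeys \<open>e\<^sub>j\<^sub>+\<^sub>1 \<le> (1 + \<Lambda> h) e\<^sub>j + \<delta> h\<close> with \<open>\<Lambda> = L U\<close>, so that it is bounded by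
  \<open>\<delta> s exp (\<Lambda> s)\<close> after time \<open>s\<close>.  The lengths \<open>h \<bar>u (t\<^sub>j)\<bar>\<close> add up to the integral of \<open>\<bar>u\<bar>\<close> up to \<open>\<delta> (b - a)\<close>.\<close>

lemma step_chain_estimate:
  fixes \<sigma> u :: "real \<Rightarrow> 'e::euclidean_space" and Z :: "'e \<Rightarrow> 'e \<Rightarrow> 'e" and \<phi> :: "'e \<Rightarrow> real"
  assumes ab: "a \<le> b" and \<delta>: "\<delta> > 0" and const: "c \<ge> 0" "C \<ge> 0" "L \<ge> 0" "\<tau> > 0" "U \<ge> 0"
    and der: "\<And>t. t \<in> {a..b} \<Longrightarrow> (\<sigma> has_vector_derivative Z (\<sigma> t) (u t)) (at t within {a..b})"
    and cont: "continuous_on {a..b} (\<lambda>t. Z (\<sigma> t) (u t))" "continuous_on {a..b} u"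
    and U: "\<And>t. t \<in> {a..b} \<Longrightarrow> norm (u t) \<le> U"
    and scale: "\<And>p h w. p \<in> B \<Longrightarrow> Z p (h *\<^sub>R w) = h *\<^sub>R Z p w"
    and lip: "\<And>p q w. p \<in> B \<Longrightarrow> q \<in> B \<Longrightarrow> norm (Z p w - Z q w) \<le> L * norm (p - q) * norm w"
    and step: "\<And>p w. p \<in> B \<Longrightarrow> norm w \<le> \<tau> \<Longrightarrow>
        \<exists>q. norm (q - p - Z p w) \<le> C * (norm w)\<^sup>2 \<and> \<bar>\<phi> q - \<phi> p\<bar> \<le> c * norm w"
    and tube: "\<And>t p. t \<in> {a..b} \<Longrightarrow> norm (p - \<sigma> t) \<le> \<delta> * (b - a) * exp (L * U * (b - a)) \<Longrightarrow> p \<in> B"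
  shows "\<exists>p. norm (p - \<sigma> b) \<le> \<delta> * (b - a) * exp (L * U * (b - a)) \<and>
      \<bar>\<phi> p - \<phi> (\<sigma> a)\<bar> \<le> c * (integral {a..b} (\<lambda>t. norm (u t)) + \<delta> * (b - a))"
proof -
  define \<Lambda> where "\<Lambda> = L * U"
  have \<Lambda>: "\<Lambda> \<ge> 0" using const by (simp add: \<Lambda>_def)
  define \<rho> where "\<rho> s = \<delta> * s * exp (\<Lambda> * s)" for s
  define J where "J t = integral {a..t} (\<lambda>t. norm (u t))" for t
  have \<rho>_mono: "\<rho> s \<le> \<rho> (b - a)" if "0 \<le> s" "s \<le> b - a" for s
    unfolding \<rho>_def using that \<delta> \<Lambda> by (intro mult_mono) (auto intro: mult_left_mono)
  have sB: "\<sigma> t \<in> B" if "t \<in> {a..b}" for t using tube[OF that, of "\<sigma> t"] \<delta> ab by simp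
  have uc: "uniformly_continuous_on {a..b} (\<lambda>t. Z (\<sigma> t) (u t))" "uniformly_continuous_on {a..b} u"
    using cont by (auto intro: compact_uniformly_continuous)
  obtain d1 where d1: "d1 > 0" "\<And>s t. s \<in> {a..b} \<Longrightarrow> t \<in> {a..b} \<Longrightarrow> dist s t < d1 \<Longrightarrow>
      dist (Z (\<sigma> s) (u s)) (Z (\<sigma> t) (u t)) < \<delta> / 2"
    using uc(1) \<delta> unfolding uniformly_continuous_on_def by (meson half_gt_zero)
  obtain d2 where d2: "d2 > 0" "\<And>s t. s \<in> {a..b} \<Longrightarrow> t \<in> {a..b} \<Longrightarrow> dist s t < d2 \<Longrightarrow> dist (u s) (u t) < \<delta>"
    using uc(2) \<delta> unfolding uniformly_continuous_on_def by meson
  \<comment> \<open>The step length must respect the moduli of continuity of the velocity and of the control, the bound \<open>\<tau>\<close>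
    on admissible steps, and must make the quadratic step error at most \<open>\<delta> h / 2\<close>.\<close>
  define m where "m = min (min d1 d2) (min (\<tau> / (U + 1)) (\<delta> / (2 * C * U\<^sup>2 + 1)))"
  have C1: "2 * C * U\<^sup>2 + 1 > 0" using const by (simp add: add_nonneg_pos)
  have m: "m > 0" using d1 d2 const \<delta> C1 by (simp add: m_def)
  obtain n :: nat where n: "(b - a) / m < real n" using reals_Archimedean2 by blast
  have n0: "n > 0" using n ab m by (cases n) (auto simp: field_simps)
  define h where "h = (b - a) / n"
  have h: "0 \<le> h" "h < m"
    using ab n n0 m by (auto simp: h_def field_simps)
  have bounds: "h < d1" "h < d2" "h * (U + 1) \<le> \<tau>" "h * (2 * C * U\<^sup>2 + 1) \<le> \<delta>"
  proof -
    have "h \<le> \<tau> / (U + 1)" "h \<le> \<delta> / (2 * C * U\<^sup>2 + 1)" using h by (auto simp: m_def)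
    then show "h * (U + 1) \<le> \<tau>" "h * (2 * C * U\<^sup>2 + 1) \<le> \<delta>"
      using C1 const by (auto simp: pos_le_divide_eq)
  qed (use h in \<open>auto simp: m_def\<close>)
  define t where "t j = a + real j * h" for j :: nat
  have tn: "t n = b" using n0 by (simp add: t_def h_def)
  have tin: "t j \<in> {a..b}" if "j \<le> n" for j
  proof -
    have "real j * h \<le> real n * h" using that h by (intro mult_right_mono) auto
    then show ?thesis using h tn by (simp add: t_def)
  qed
  have ts: "t (Suc j) = t j + h" for j by (simp add: t_def algebra_simps)
  have "\<exists>p. norm (p - \<sigma> (t j)) \<le> \<rho> (t j - a) \<and> \<bar>\<phi> p - \<phi> (\<sigma> a)\<bar> \<le> c * (J (t j) + \<delta> * (t j - a))" if "j \<le> n" for j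
    using that
  proof (induction j)
    case 0
    have "J a = 0" by (simp add: J_def)
    then show ?case by (intro exI[of _ "\<sigma> a"]) (simp add: t_def \<rho>_def)
  next
    case (Suc j)
    define s where "s = t j"
    obtain p where p: "norm (p - \<sigma> s) \<le> \<rho> (s - a)" "\<bar>\<phi> p - \<phi> (\<sigma> a)\<bar> \<le> c * (J s + \<delta> * (s - a))"
      using Suc by (auto simp: s_def)
    have s: "s \<in> {a..b}" "s + h \<in> {a..b}" using tin[of j] tin[OF Suc.prems] Suc.prems by (auto simp: s_def ts)
    have pB: "p \<in> B"
    proof (rule tube[OF s(1)])
      show "norm (p - \<sigma> s) \<le> \<delta> * (b - a) * exp (L * U * (b - a))"
        using p(1) \<rho>_mono[of "s - a"] s by (auto simp: \<rho>_def \<Lambda>_def)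
    qed
    define w where "w = h *\<^sub>R u s"
    have nw: "norm w \<le> h * U" using U[OF s(1)] h by (simp add: w_def mult_left_mono)
    have "norm w \<le> \<tau>" using nw bounds(3) h by (simp add: algebra_simps)
    from step[OF pB this] obtain q where
      q: "norm (q - p - Z p w) \<le> C * (norm w)\<^sup>2" "\<bar>\<phi> q - \<phi> p\<bar> \<le> c * norm w" by blast
    have sub: "{s..s + h} \<subseteq> {a..b}" using s by auto
    have rem: "norm (\<sigma> (s + h) - \<sigma> s - ((s + h) - s) *\<^sub>R Z (\<sigma> s) (u s)) \<le> \<delta> / 2 * ((s + h) - s)"
    proof (rule first_order_remainder)
      fix r assume r: "r \<in> {s..s + h}"
      then have r': "r \<in> {a..b}" using sub by auto
      show "(\<sigma> has_vector_derivative Z (\<sigma> r) (u r)) (at r within {s..s + h})"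
        using der[OF r'] sub has_vector_derivative_within_subset by blast
      have "dist r s < d1" using r bounds(1) by (auto simp: dist_real_def)
      from d1(2)[OF r' s(1) this] show "norm (Z (\<sigma> r) (u r) - Z (\<sigma> s) (u s)) \<le> \<delta> / 2"
        by (simp add: dist_norm)
    qed (use h in simp)
    have "q - \<sigma> (s + h) = (p - \<sigma> s) + ((q - p - Z p w) + (Z p w - Z (\<sigma> s) w))
        - (\<sigma> (s + h) - \<sigma> s - h *\<^sub>R Z (\<sigma> s) (u s))"
      using scale[OF sB[OF s(1)]] by (simp add: w_def algebra_simps)
    also have "norm \<dots> \<le> norm (p - \<sigma> s) + (C * (norm w)\<^sup>2 + L * norm (p - \<sigma> s) * norm w) + \<delta> / 2 * h"
      by (rule norm_combine4[OF order_refl q(1) lip[OF pB sB[OF s(1)]]]) (use rem in simp)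
    also have "\<dots> \<le> norm (p - \<sigma> s) + (C * (h * U)\<^sup>2 + L * norm (p - \<sigma> s) * (h * U)) + \<delta> / 2 * h"
      using nw const h \<delta> by (intro add_mono mult_left_mono power_mono order_refl) auto
    also have "\<dots> = norm (p - \<sigma> s) * (1 + \<Lambda> * h) + h * (h * (C * U\<^sup>2)) + \<delta> / 2 * h"
      by (simp add: \<Lambda>_def power2_eq_square algebra_simps)
    also have "\<dots> \<le> \<rho> (s - a) * (1 + \<Lambda> * h) + h * (\<delta> / 2) + \<delta> / 2 * h"
      using p(1) bounds(4) h \<Lambda> by (intro add_mono mult_right_mono mult_left_mono) (auto simp: algebra_simps)
    also have "\<dots> = \<rho> (s - a) * (1 + \<Lambda> * h) + \<delta> * h" by (simp add: algebra_simps)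
    also have "\<dots> \<le> \<rho> (s - a) * exp (\<Lambda> * h) + \<delta> * h * exp (\<Lambda> * (s + h - a))"
    proof (intro add_mono mult_left_mono)
      show "\<rho> (s - a) \<ge> 0" using s \<delta> by (simp add: \<rho>_def)
      show "\<delta> * h \<le> \<delta> * h * exp (\<Lambda> * (s + h - a))"
        using h \<delta> \<Lambda> s mult_left_mono[of 1 "exp (\<Lambda> * (s + h - a))" "\<delta> * h"] by simp
    qed auto
    also have "\<dots> = \<rho> (s + h - a)"
    proof -
      have "exp (\<Lambda> * (s + h - a)) = exp (\<Lambda> * (s - a)) * exp (\<Lambda> * h)"
        by (simp add: exp_add[symmetric] algebra_simps)
      then show ?thesis by (simp add: \<rho>_def algebra_simps)
    qed
    finally have 1: "norm (q - \<sigma> (s + h)) \<le> \<rho> (s + h - a)" .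
    have intg: "(\<lambda>t. norm (u t)) integrable_on {a..b}"
      by (intro integrable_continuous_real continuous_on_norm cont)
    have "J (s + h) = J s + integral {s..s + h} (\<lambda>t. norm (u t))"
      unfolding J_def using s h integrable_subinterval_real[OF intg]
      by (intro Henstock_Kurzweil_Integration.integral_combine[symmetric]) auto
    moreover have "integral {s..s + h} (\<lambda>t. norm (u s) - \<delta>) \<le> integral {s..s + h} (\<lambda>t. norm (u t))"
    proof (rule integral_le)
      fix r assume r: "r \<in> {s..s + h}"
      then have "dist r s < d2" using bounds(2) by (auto simp: dist_real_def)
      then have "norm (u r - u s) < \<delta>" using d2(2)[of r s] r sub s by (auto simp: dist_norm)
      then show "norm (u s) - \<delta> \<le> norm (u r)" using norm_triangle_ineq2[of "u s" "u r"]
        by (simp add: norm_minus_commute)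
    qed (use integrable_subinterval_real[OF intg sub] in auto)
    ultimately have "h * norm (u s) \<le> J (s + h) - J s + \<delta> * h" using h by (simp add: algebra_simps)
    then have nwJ: "c * norm w \<le> c * (J (s + h) - J s + \<delta> * h)"
      using h const by (intro mult_left_mono) (auto simp: w_def)
    have "\<bar>\<phi> q - \<phi> (\<sigma> a)\<bar> \<le> c * (J s + \<delta> * (s - a)) + c * norm w" using p(2) q(2) by linarith
    also have "\<dots> \<le> c * (J (s + h) + \<delta> * (s + h - a))" using nwJ by (simp add: algebra_simps)
    finally show ?case using 1 by (intro exI[of _ q]) (simp add: ts s_def)
  qed
  from this[of n] show ?thesis by (simp add: tn \<rho>_def J_def \<Lambda>_def)
qed

text \<open>The chains of \<open>step_chain_estimate\<close> miss the end point of the curve by an arbitrarily small error, which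
  the continuity of \<open>\<phi>\<close> absorbs.\<close>

lemma slow_along_horizontal_curve:
  fixes \<sigma> u :: "real \<Rightarrow> 'e::euclidean_space" and Z :: "'e \<Rightarrow> 'e \<Rightarrow> 'e" and \<phi> :: "'e \<Rightarrow> real"
  assumes ab: "a \<le> b" and const: "c \<ge> 0" "C \<ge> 0" "L \<ge> 0" "\<tau> > 0"
    and B: "open B" "\<sigma> ` {a..b} \<subseteq> B"
    and der: "\<And>t. t \<in> {a..b} \<Longrightarrow> (\<sigma> has_vector_derivative Z (\<sigma> t) (u t)) (at t within {a..b})"
    and cont: "continuous_on {a..b} (\<lambda>t. Z (\<sigma> t) (u t))" "continuous_on {a..b} u"
    and scale: "\<And>p h w. p \<in> B \<Longrightarrow> Z p (h *\<^sub>R w) = h *\<^sub>R Z p w"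
    and lip: "\<And>p q w. p \<in> B \<Longrightarrow> q \<in> B \<Longrightarrow> norm (Z p w - Z q w) \<le> L * norm (p - q) * norm w"
    and step: "\<And>p w. p \<in> B \<Longrightarrow> norm w \<le> \<tau> \<Longrightarrow>
        \<exists>q. norm (q - p - Z p w) \<le> C * (norm w)\<^sup>2 \<and> \<bar>\<phi> q - \<phi> p\<bar> \<le> c * norm w"
    and \<phi>: "isCont \<phi> (\<sigma> b)"
  shows "\<bar>\<phi> (\<sigma> b) - \<phi> (\<sigma> a)\<bar> \<le> c * integral {a..b} (\<lambda>t. norm (u t))"
proof (rule field_le_epsilon)
  fix e :: real assume e: "e > 0"
  have "compact (u ` {a..b})" using cont by (intro compact_continuous_image) auto
  then have "bounded (u ` {a..b})" by (rule compact_imp_bounded)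
  then obtain U where U: "U > 0" "\<And>t. t \<in> {a..b} \<Longrightarrow> norm (u t) \<le> U"
    unfolding bounded_pos by auto
  have "continuous_on {a..b} \<sigma>" by (rule continuous_on_vector_derivative[OF der])
  then have "compact (\<sigma> ` {a..b})" by (intro compact_continuous_image) auto
  from compact_subset_open_imp_ball_epsilon_subset[OF this B]
  obtain \<eta> where \<eta>: "\<eta> > 0" "(\<Union>x\<in>\<sigma> ` {a..b}. ball x \<eta>) \<subseteq> B" .
  have "e / 2 > 0" using e by simp
  then obtain d where d: "d > 0" "\<And>p. dist p (\<sigma> b) < d \<Longrightarrow> dist (\<phi> p) (\<phi> (\<sigma> b)) < e / 2"
    using \<phi> unfolding continuous_at_eps_delta by metis
  define K where "K = (b - a) * exp (L * U * (b - a)) + 1"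
  have K: "K > 0" using ab by (simp add: K_def add_nonneg_pos)
  define k where "k = c * (b - a) + 1"
  have k: "k > 0" using ab const by (simp add: k_def add_nonneg_pos)
  define \<delta> where "\<delta> = min (min \<eta> d / (2 * K)) (e / (2 * k))"
  have \<delta>: "\<delta> > 0" using \<eta> d e K k by (simp add: \<delta>_def)
  have "\<delta> * (b - a) * exp (L * U * (b - a)) \<le> \<delta> * K" using \<delta> by (simp add: K_def algebra_simps)
  also have "\<dots> \<le> min \<eta> d / (2 * K) * K" using K by (intro mult_right_mono) (auto simp: \<delta>_def)
  also have "\<dots> = min \<eta> d / 2" using K by simp
  also have "\<dots> < min \<eta> d" using \<eta> d by linarith
  finally have small: "\<delta> * (b - a) * exp (L * U * (b - a)) < min \<eta> d" .
  have "\<exists>p. norm (p - \<sigma> b) \<le> \<delta> * (b - a) * exp (L * U * (b - a)) \<and>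
      \<bar>\<phi> p - \<phi> (\<sigma> a)\<bar> \<le> c * (integral {a..b} (\<lambda>t. norm (u t)) + \<delta> * (b - a))"
  proof (rule step_chain_estimate[OF ab \<delta> const _ der cont U(2) scale lip step])
    fix t p assume t: "t \<in> {a..b}" and "norm (p - \<sigma> t) \<le> \<delta> * (b - a) * exp (L * U * (b - a))"
    then have "p \<in> ball (\<sigma> t) \<eta>" using small by (simp add: dist_norm norm_minus_commute)
    then show "p \<in> B" using \<eta>(2) t by blast
  qed (use U in auto)
  then obtain p where p: "norm (p - \<sigma> b) < min \<eta> d"
    "\<bar>\<phi> p - \<phi> (\<sigma> a)\<bar> \<le> c * (integral {a..b} (\<lambda>t. norm (u t)) + \<delta> * (b - a))"
    using small by (meson le_less_trans)
  have "c * (\<delta> * (b - a)) \<le> \<delta> * k" using \<delta> by (simp add: k_def algebra_simps)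
  also have "\<dots> \<le> e / (2 * k) * k" using k by (intro mult_right_mono) (auto simp: \<delta>_def)
  also have "\<dots> = e / 2" using k by simp
  finally have "c * (\<delta> * (b - a)) \<le> e / 2" .
  moreover have "\<bar>\<phi> p - \<phi> (\<sigma> b)\<bar> < e / 2" using d(2)[of p] p(1) by (simp add: dist_norm dist_real_def)
  ultimately show "\<bar>\<phi> (\<sigma> b) - \<phi> (\<sigma> a)\<bar> \<le> c * integral {a..b} (\<lambda>t. norm (u t)) + e"
    using p(2) unfolding distrib_left by linarith
qed

section \<open>Charts and coordinate changes\<close>

definition coord_change :: "('m, 'e::euclidean_space) chart \<Rightarrow> ('m, 'e) chart \<Rightarrow> 'e \<Rightarrow> 'e" where
  "coord_change c d = snd d \<circ> chart_inv c"

text \<open>Tangent vectors are stored in the coordinates of \<open>chart_at A p\<close>; passing to and from the coordinates of a chart are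
  both instances of this map.\<close>

definition jacobian :: "('m, 'e::euclidean_space) chart \<Rightarrow> ('m, 'e) chart \<Rightarrow> 'm \<Rightarrow> 'e \<Rightarrow> 'e" where
  "jacobian c d p = frechet_derivative (coord_change c d) (at (snd c p))"

lemma to_coord_jacobian: "to_coord A c p = jacobian (chart_at A p) c p"
  and of_coord_jacobian: "of_coord A c p = jacobian c (chart_at A p) p"
  by (auto simp: to_coord_def of_coord_def jacobian_def coord_change_def)

locale atlas =
  fixes A :: "('m::{t2_space,second_countable_topology}, 'e::euclidean_space) chart set"
  assumes atlas: "smooth_atlas A"
begin

lemma chart:
  assumes "c \<in> A"
  shows "open (fst c)" "open (snd c ` fst c)" "continuous_on (fst c) (snd c)"
    "continuous_on (snd c ` fst c) (chart_inv c)"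
    "p \<in> fst c \<Longrightarrow> chart_inv c (snd c p) = p"
    "x \<in> snd c ` fst c \<Longrightarrow> snd c (chart_inv c x) = x"
    "x \<in> snd c ` fst c \<Longrightarrow> chart_inv c x \<in> fst c"
  using atlas assms unfolding smooth_atlas_def homeomorphism_def by auto

lemma chart_at: "chart_at A p \<in> A" "p \<in> fst (chart_at A p)"
proof -
  have "p \<in> (\<Union>c\<in>A. fst c)" using atlas by (simp add: smooth_atlas_def)
  then have "\<exists>c. c \<in> A \<and> p \<in> fst c" by auto
  from someI_ex[OF this] show "chart_at A p \<in> A" "p \<in> fst (chart_at A p)" by (auto simp: chart_at_def)
qed

lemma chart_image_eq:
  assumes "c \<in> A"
  shows "snd c ` (fst c \<inter> U) = snd c ` fst c \<inter> chart_inv c -` U"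
  using chart(5,6,7)[OF assms] by (auto simp: image_iff)

lemma open_chart_image:
  assumes "c \<in> A" "open U"
  shows "open (snd c ` (fst c \<inter> U))"
  unfolding chart_image_eq[OF assms(1)]
  using chart[OF assms(1)] assms(2) by (intro continuous_open_preimage) auto

lemma coord_change_smooth:
  "c \<in> A \<Longrightarrow> d \<in> A \<Longrightarrow> smooth_on (snd c ` (fst c \<inter> fst d)) (coord_change c d)"
  using atlas unfolding smooth_atlas_def coord_change_def by blast

lemma open_overlap: "c \<in> A \<Longrightarrow> d \<in> A \<Longrightarrow> open (snd c ` (fst c \<inter> fst d))"
  using open_chart_image chart(1) by blast

lemma coord_change_apply: "c \<in> A \<Longrightarrow> p \<in> fst c \<Longrightarrow> coord_change c d (snd c p) = snd d p"
  by (simp add: coord_change_def chart)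

lemma coord_change_has_derivative:
  assumes "c \<in> A" "d \<in> A" "p \<in> fst c" "p \<in> fst d"
  shows "(coord_change c d has_derivative jacobian c d p) (at (snd c p))"
  unfolding jacobian_def
  by (rule smooth_on_has_derivative[OF coord_change_smooth open_overlap]) (use assms in auto)

lemma linear_jacobian:
  assumes "c \<in> A" "d \<in> A" "p \<in> fst c" "p \<in> fst d"
  shows "linear (jacobian c d p)"
  using coord_change_has_derivative[OF assms] has_derivative_linear by blast

lemma jacobian_chain:
  assumes "c \<in> A" "d \<in> A" "e \<in> A" "p \<in> fst c" "p \<in> fst d" "p \<in> fst e"
  shows "jacobian d e p (jacobian c d p v) = jacobian c e p v"
proof -
  let ?S = "snd c ` (fst c \<inter> (fst d \<inter> fst e))"
  have "((\<lambda>x. coord_change d e (coord_change c d x)) has_derivative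
      (\<lambda>v. jacobian d e p (jacobian c d p v))) (at (snd c p))"
    by (rule has_derivative_compose[OF coord_change_has_derivative])
       (use assms coord_change_has_derivative[of d e p] in \<open>simp_all add: coord_change_apply\<close>)
  then have "(coord_change c e has_derivative (\<lambda>v. jacobian d e p (jacobian c d p v))) (at (snd c p))"
  proof (rule has_derivative_transform_within_open)
    show "open ?S" using assms chart(1) by (intro open_chart_image open_Int) auto
    show "coord_change d e (coord_change c d x) = coord_change c e x" if "x \<in> ?S" for x
      using that assms by (auto simp: coord_change_apply)
  qed (use assms in auto)
  from has_derivative_unique[OF this coord_change_has_derivative[OF assms(1,3,4,6)]] show ?thesis by metis
qed

lemma jacobian_same:
  assumes "c \<in> A" "p \<in> fst c"
  shows "jacobian c c p v = v"
proof -
  have "((\<lambda>x. x) has_derivative (\<lambda>v. v)) (at (snd c p))" by (rule has_derivative_ident)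
  then have "(coord_change c c has_derivative (\<lambda>v. v)) (at (snd c p))"
    by (rule has_derivative_transform_within_open[OF _ chart(2)[OF assms(1)]])
       (use assms in \<open>auto simp: coord_change_apply\<close>)
  from has_derivative_unique[OF this coord_change_has_derivative[OF assms(1,1,2,2)]] show ?thesis by metis
qed

lemma jacobian_inverse:
  assumes "c \<in> A" "d \<in> A" "p \<in> fst c" "p \<in> fst d"
  shows "jacobian d c p (jacobian c d p v) = v"
  using jacobian_chain[of c d c p] jacobian_same assms by simp

lemma to_coord_linear: "c \<in> A \<Longrightarrow> p \<in> fst c \<Longrightarrow> linear (to_coord A c p)"
  and of_coord_linear: "c \<in> A \<Longrightarrow> p \<in> fst c \<Longrightarrow> linear (of_coord A c p)"
  and of_to_coord: "c \<in> A \<Longrightarrow> p \<in> fst c \<Longrightarrow> of_coord A c p (to_coord A c p v) = v"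
  and to_of_coord: "c \<in> A \<Longrightarrow> p \<in> fst c \<Longrightarrow> to_coord A c p (of_coord A c p v) = v"
  and to_coord_chart_at: "to_coord A (chart_at A p) p v = v"
  and of_coord_chart_at: "of_coord A (chart_at A p) p v = v"
  and jacobian_to_coord: "c \<in> A \<Longrightarrow> d \<in> A \<Longrightarrow> p \<in> fst c \<Longrightarrow> p \<in> fst d \<Longrightarrow>
        jacobian c d p (to_coord A c p v) = to_coord A d p v"
  and of_coord_jacobian_apply: "c \<in> A \<Longrightarrow> d \<in> A \<Longrightarrow> p \<in> fst c \<Longrightarrow> p \<in> fst d \<Longrightarrow>
        of_coord A d p (jacobian c d p v) = of_coord A c p v"
  unfolding to_coord_jacobian of_coord_jacobian
  by (simp_all add: linear_jacobian jacobian_inverse jacobian_same jacobian_chain chart_at)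

lemma second_jacobian:
  assumes c: "c \<in> A" and d: "d \<in> A" and x: "x \<in> snd c ` (fst c \<inter> fst d)"
  shows "((\<lambda>y. frechet_derivative (coord_change c d) (at y) v) has_derivative
      (\<lambda>u. frechet_derivative (\<lambda>y. frechet_derivative (coord_change c d) (at y) v) (at x) u)) (at x)"
    and "frechet_derivative (\<lambda>y. frechet_derivative (coord_change c d) (at y) v) (at x) u
       = frechet_derivative (\<lambda>y. frechet_derivative (coord_change c d) (at y) u) (at x) v"
  subgoal
    by (rule smooth_on_has_derivative[OF smooth_on_frechet_derivative[OF coord_change_smooth[OF c d]
          open_overlap[OF c d]] open_overlap[OF c d] x])
  subgoal by (rule second_derivative_symmetric[OF coord_change_smooth[OF c d] open_overlap[OF c d] x])
  done

end

section \<open>The Levi-Civita connection in coordinates\<close>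

text \<open>The Riesz representation for a positive definite form: \<open>z \<mapsto> B z\<close> is injective, hence onto the functionals.\<close>

lemma bilinear_form_representation:
  fixes B :: "'e::euclidean_space \<Rightarrow> 'e \<Rightarrow> real"
  assumes B: "bilinear B" and pos: "\<forall>v. v \<noteq> 0 \<longrightarrow> B v v > 0" and l: "linear l"
  shows "\<exists>!z. \<forall>w. B z w = l w"
proof (rule ex_ex1I)
  have lin: "linear (\<lambda>z. B z w)" "linear (B z)" for z w using B by (auto simp: bilinear_def)
  define T where "T z = (\<Sum>b\<in>Basis. B z b *\<^sub>R b)" for z
  have T: "linear T"
    unfolding T_def using linear_add[OF lin(1)] linear_cmul[OF lin(1)]
    by (intro linearI) (simp_all add: scaleR_add_left sum.distrib scaleR_sum_right)
  have Tb: "T z \<bullet> b = B z b" if "b \<in> Basis" for z b using that by (simp add: T_def)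
  have Bz: "B z w = (\<Sum>b\<in>Basis. (w \<bullet> b) * B z b)" for z w
    using linear_basis_sum[OF lin(2), of z w] by simp
  have "inj T"
  proof (rule linear_injective_0[OF T, THEN iffD2], intro allI impI)
    fix z assume "T z = 0"
    then have "B z b = 0" if "b \<in> Basis" for b using Tb[OF that, of z] by simp
    then have "B z z = 0" by (subst Bz) simp
    then show "z = 0" using pos by force
  qed
  then have "surj T" using linear_injective_imp_surjective[OF T] by blast
  then obtain z where z: "T z = (\<Sum>b\<in>Basis. l b *\<^sub>R b)" by (metis surjD)
  have "B z w = l w" for w
  proof -
    have "B z b = l b" if "b \<in> Basis" for b using Tb[OF that, of z] that by (simp add: z)
    then show ?thesis using Bz[of z w] linear_basis_sum[OF l, of w] by simp
  qed
  then show "\<exists>z. \<forall>w. B z w = l w" by blast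
  fix z z' assume "\<forall>w. B z w = l w" "\<forall>w. B z' w = l w"
  then have "B (z - z') (z - z') = 0" using linear_diff[OF lin(1)] by simp
  then show "z = z'" using pos by (metis eq_iff_diff_eq_0 less_irrefl)
qed

text \<open>The classical derivation of the Levi-Civita connection at one point; \<open>T u v w\<close> stands for the derivative of the metric
  coefficient \<open>g(v, w)\<close> in direction \<open>u\<close>.\<close>

lemma koszul:
  fixes B :: "'e::euclidean_space \<Rightarrow> 'e \<Rightarrow> real" and T :: "'e \<Rightarrow> 'e \<Rightarrow> 'e \<Rightarrow> real"
  assumes B: "bilinear B" and sym: "\<And>u v. B u v = B v u" and pos: "\<forall>v. v \<noteq> 0 \<longrightarrow> B v v > 0"
    and T: "\<And>v w. linear (\<lambda>u. T u v w)" "\<And>u w. linear (\<lambda>v. T u v w)" "\<And>u v w. T u v w = T u w v"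
  defines "P \<equiv> \<lambda>\<Gamma>. bilinear \<Gamma> \<and> (\<forall>u v. \<Gamma> u v = \<Gamma> v u) \<and> (\<forall>u v w. T u v w = B (\<Gamma> u v) w + B v (\<Gamma> u w))"
  shows "\<exists>!\<Gamma>. P \<Gamma>" and "P \<Gamma> \<Longrightarrow> 2 * B (\<Gamma> u v) w = T u v w + T v u w - T w u v"
proof -
  have T3: "linear (\<lambda>w. T u v w)" for u v
  proof -
    have "(\<lambda>w. T u v w) = (\<lambda>w. T u w v)" using T(3) by blast
    then show ?thesis using T(2) by simp
  qed
  have lin: "linear (\<lambda>z. B z w)" "linear (B z)" for z w using B by (auto simp: bilinear_def)
  let ?l = "\<lambda>u v w. (T u v w + T v u w - T w u v) / 2"
  have l: "linear (?l u v)" for u v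
    using linear_add[OF T3] linear_cmul[OF T3] linear_add[OF T(1)] linear_cmul[OF T(1)]
    by (intro linearI) (simp_all add: field_simps)
  have formula: "2 * B (\<Gamma> u v) w = T u v w + T v u w - T w u v" if "P \<Gamma>" for \<Gamma> u v w
  proof -
    have *: "T u v w = B (\<Gamma> u v) w + B v (\<Gamma> u w)" "\<Gamma> u v = \<Gamma> v u" for u v w
      using that unfolding P_def by blast+
    have "T u v w + T v u w - T w u v
        = B (\<Gamma> u v) w + B v (\<Gamma> u w) + (B (\<Gamma> v u) w + B u (\<Gamma> v w)) - (B (\<Gamma> w u) v + B u (\<Gamma> w v))"
      by (simp only: *(1))
    then show ?thesis using sym[of v "\<Gamma> u w"] by (simp add: *(2)[of v u] *(2)[of w u] *(2)[of w v])
  qed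
  then show "P \<Gamma> \<Longrightarrow> 2 * B (\<Gamma> u v) w = T u v w + T v u w - T w u v" by blast
  have eqI: "z = z'" if "\<And>w. B z w = B z' w" for z z'
  proof -
    have "B (z - z') (z - z') = 0" using linear_diff[OF lin(1)] that by simp
    then show "z = z'" using pos by (metis eq_iff_diff_eq_0 less_irrefl)
  qed
  show "\<exists>!\<Gamma>. P \<Gamma>"
  proof (rule ex_ex1I)
    define \<Gamma> where "\<Gamma> u v = (THE z. \<forall>w. B z w = ?l u v w)" for u v
    have \<Gamma>: "B (\<Gamma> u v) w = ?l u v w" for u v w
      using theI'[OF bilinear_form_representation[OF B pos l]] unfolding \<Gamma>_def by blast
    have "linear (\<lambda>v. \<Gamma> u v)" for u
      by (intro linearI eqI)
         (simp_all add: \<Gamma> linear_add[OF lin(1)] linear_cmul[OF lin(1)] linear_add[OF T(1)] linear_cmul[OF T(1)]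
           linear_add[OF T(2)] linear_cmul[OF T(2)] linear_add[OF T3] linear_cmul[OF T3] field_simps)
    moreover have "linear (\<lambda>u. \<Gamma> u v)" for v
      by (intro linearI eqI)
         (simp_all add: \<Gamma> linear_add[OF lin(1)] linear_cmul[OF lin(1)] linear_add[OF T(1)] linear_cmul[OF T(1)]
           linear_add[OF T(2)] linear_cmul[OF T(2)] linear_add[OF T3] linear_cmul[OF T3] field_simps)
    moreover have "\<Gamma> u v = \<Gamma> v u" for u v
      by (rule eqI) (simp add: \<Gamma> T(3)[of _ u v])
    moreover have "T u v w = B (\<Gamma> u v) w + B v (\<Gamma> u w)" for u v w
      using sym[of v "\<Gamma> u w"] by (simp add: \<Gamma> T(3)[of u w v] T(3)[of w v u] T(3)[of v w u] field_simps)
    ultimately show "\<exists>\<Gamma>. P \<Gamma>" unfolding P_def bilinear_def by blast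
    fix \<Gamma> \<Gamma>' assume "P \<Gamma>" "P \<Gamma>'"
    then have "\<Gamma> u v = \<Gamma>' u v" for u v
      by (intro eqI) (use formula[of \<Gamma> u v] formula[of \<Gamma>' u v] in \<open>metis mult_cancel_left zero_neq_numeral\<close>)
    then show "\<Gamma> = \<Gamma>'" by blast
  qed
qed

locale riemannian = atlas A
  for A :: "('m::{t2_space,second_countable_topology}, 'e::euclidean_space) chart set" +
  fixes g :: "'m \<Rightarrow> 'e \<Rightarrow> 'e \<Rightarrow> real"
  assumes riem: "riemannian_metric A g"
begin

abbreviation "mc \<equiv> metric_coord A g"

definition dmc :: "('m, 'e) chart \<Rightarrow> 'e \<Rightarrow> 'e \<Rightarrow> 'e \<Rightarrow> 'e \<Rightarrow> real" where
  "dmc c x u v w = frechet_derivative (\<lambda>y. mc c y v w) (at x) u"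

lemma metric: "bilinear (g p)" "g p u v = g p v u" "v \<noteq> 0 \<Longrightarrow> g p v v > 0"
  using riem unfolding riemannian_metric_def by blast+

lemma mc_apply: "c \<in> A \<Longrightarrow> p \<in> fst c \<Longrightarrow> mc c (snd c p) u v = g p (of_coord A c p u) (of_coord A c p v)"
  by (simp add: metric_coord_def chart)

lemma mc_jacobian:
  assumes "c \<in> A" "d \<in> A" "p \<in> fst c" "p \<in> fst d"
  shows "mc d (snd d p) (jacobian c d p u) (jacobian c d p v) = mc c (snd c p) u v"
  using assms by (simp add: mc_apply of_coord_jacobian_apply)

lemma mc_bilinear:
  assumes "c \<in> A" "x \<in> snd c ` fst c"
  shows "bilinear (mc c x)" "linear (mc c x u)" "linear (\<lambda>u. mc c x u v)"
proof -
  obtain p where p: "x = snd c p" "p \<in> fst c" using assms by auto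
  have lin: "linear (g p u)" "linear (\<lambda>u. g p u v)" for u v using metric(1)[of p] by (auto simp: bilinear_def)
  have o: "linear (of_coord A c p)" using of_coord_linear assms p by blast
  have "linear (mc c x u)" "linear (\<lambda>u. mc c x u v)" for u v
    unfolding p(1)
    by (intro linearI; simp add: mc_apply[OF assms(1) p(2)] linear_add[OF o] linear_cmul[OF o]
        linear_add[OF lin(1)] linear_add[OF lin(2)] linear_cmul[OF lin(1)] linear_cmul[OF lin(2)])+
  then show "bilinear (mc c x)" "linear (mc c x u)" "linear (\<lambda>u. mc c x u v)" by (auto simp: bilinear_def)
qed

lemma mc_sym: "mc c x u v = mc c x v u"
  unfolding metric_coord_def Let_def by (rule metric(2))

lemma mc_pos:
  assumes "c \<in> A" "x \<in> snd c ` fst c" "v \<noteq> 0"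
  shows "mc c x v v > 0"
proof -
  obtain p where p: "x = snd c p" "p \<in> fst c" using assms by auto
  have "of_coord A c p v \<noteq> 0"
    using to_of_coord[OF assms(1) p(2), of v] assms(3) linear_0[OF to_coord_linear[OF assms(1) p(2)]] by auto
  then show ?thesis using metric(3) mc_apply[OF assms(1) p(2)] p by simp
qed

lemma mc_smooth: "c \<in> A \<Longrightarrow> smooth_on (snd c ` fst c) (\<lambda>x. mc c x u v)"
  using riem unfolding riemannian_metric_def by blast

lemma mc_has_derivative:
  assumes "c \<in> A" "x \<in> snd c ` fst c"
  shows "((\<lambda>y. mc c y v w) has_derivative (\<lambda>u. dmc c x u v w)) (at x)"
  unfolding dmc_def using smooth_on_has_derivative[OF mc_smooth chart(2)] assms by blast

lemma dmc_linear:
  assumes c: "c \<in> A" and x: "x \<in> snd c ` fst c"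
  shows "linear (\<lambda>u. dmc c x u v w)" "linear (\<lambda>v. dmc c x u v w)" "dmc c x u v w = dmc c x u w v"
proof -
  show "linear (\<lambda>u. dmc c x u v w)" using mc_has_derivative[OF c x] has_derivative_linear by blast
  show "dmc c x u v w = dmc c x u w v" unfolding dmc_def by (simp add: mc_sym[of c _ v w])
  show "linear (\<lambda>v. dmc c x u v w)"
  proof (rule linearI)
    fix v v' and r :: real
    have "((\<lambda>y. mc c y v w + mc c y v' w) has_derivative (\<lambda>u. dmc c x u v w + dmc c x u v' w)) (at x)"
      by (intro has_derivative_add mc_has_derivative c x)
    then have "((\<lambda>y. mc c y (v + v') w) has_derivative (\<lambda>u. dmc c x u v w + dmc c x u v' w)) (at x)"
      by (rule has_derivative_transform_within_open[OF _ chart(2)[OF c] x])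
         (simp add: linear_add[OF mc_bilinear(3)[OF c]])
    from has_derivative_unique[OF this mc_has_derivative[OF c x]]
    show "dmc c x u (v + v') w = dmc c x u v w + dmc c x u v' w" by metis
    have "((\<lambda>y. r * mc c y v w) has_derivative (\<lambda>u. r * dmc c x u v w)) (at x)"
      by (intro has_derivative_mult_right mc_has_derivative c x)
    then have "((\<lambda>y. mc c y (r *\<^sub>R v) w) has_derivative (\<lambda>u. r * dmc c x u v w)) (at x)"
      by (rule has_derivative_transform_within_open[OF _ chart(2)[OF c] x])
         (simp add: linear_cmul[OF mc_bilinear(3)[OF c]])
    from has_derivative_unique[OF this mc_has_derivative[OF c x]]
    show "dmc c x u (r *\<^sub>R v) w = r *\<^sub>R dmc c x u v w" by (metis real_scaleR_def)
  qed
qed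

lemma levi_civita:
  assumes c: "c \<in> A" and x: "x \<in> snd c ` fst c"
  defines "\<Gamma> \<equiv> levi_civita A g c x"
  shows "bilinear \<Gamma>" "2 * mc c x (\<Gamma> u v) w = dmc c x u v w + dmc c x v u w - dmc c x w u v"
proof -
  have pos: "\<forall>v. v \<noteq> 0 \<longrightarrow> mc c x v v > 0" using mc_pos[OF c x] by blast
  note k = koszul[OF mc_bilinear(1)[OF c x] mc_sym pos dmc_linear[OF c x]]
  have \<Gamma>: "bilinear \<Gamma> \<and> (\<forall>u v. \<Gamma> u v = \<Gamma> v u) \<and>
      (\<forall>u v w. dmc c x u v w = mc c x (\<Gamma> u v) w + mc c x v (\<Gamma> u w))"
    unfolding \<Gamma>_def levi_civita_def dmc_def[symmetric] using theI'[OF k(1)] .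
  then show "bilinear \<Gamma>" by blast
  show "2 * mc c x (\<Gamma> u v) w = dmc c x u v w + dmc c x v u w - dmc c x w u v"
    using k(2)[OF \<Gamma>] .
qed

text \<open>In a new chart \<open>x''\<close> acquires the term \<open>D\<^sup>2\<psi>(v, v)\<close> of the coordinate change \<open>\<psi>\<close>, and the Christoffel symbols
  lose it.  By the Koszul formula this is a computation with the derivatives of the metric coefficients, in which the
  remaining second derivatives of \<open>\<psi>\<close> cancel by symmetry.\<close>

lemma acceleration_covariant:
  assumes c: "c \<in> A" and d: "d \<in> A" and p: "p \<in> fst c" "p \<in> fst d"
  defines "x \<equiv> snd c p" and "y \<equiv> snd d p" and "J \<equiv> jacobian c d p"
  defines "J2 \<equiv> \<lambda>u v. frechet_derivative (\<lambda>x. frechet_derivative (coord_change c d) (at x) v) (at x) u"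
  shows "mc d y (J2 v v + J a + levi_civita A g d y (J v) (J v)) (J w)
       = mc c x (a + levi_civita A g c x v v) w"
proof -
  let ?D = "\<lambda>v z. frechet_derivative (coord_change c d) (at z) v"
  have xin: "x \<in> snd c ` fst c" "x \<in> snd c ` (fst c \<inter> fst d)" and yin: "y \<in> snd d ` fst d"
    using p by (auto simp: x_def y_def)
  note lin = linear_add[OF mc_bilinear(3)[OF d yin]]
  have lJ: "linear J" unfolding J_def by (rule linear_jacobian[OF c d p])
  have Jx: "J v = ?D v x" for v by (simp add: J_def jacobian_def x_def)
  have dy: "(coord_change c d has_derivative J) (at x)"
    unfolding J_def x_def by (rule coord_change_has_derivative[OF c d p])
  have phix: "coord_change c d x = y" using p c by (simp add: x_def y_def coord_change_apply)
  have key: "dmc c x u v w = dmc d y (J u) (J v) (J w) + mc d y (J2 u v) (J w) + mc d y (J v) (J2 u w)" for u v w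
  proof -
    have rep: "mc c z v w = (\<Sum>b\<in>Basis. \<Sum>b'\<in>Basis. (?D v z \<bullet> b) * (?D w z \<bullet> b') * mc d (coord_change c d z) b b')"
      if z: "z \<in> snd c ` (fst c \<inter> fst d)" for z
    proof -
      obtain q where q: "z = snd c q" "q \<in> fst c" "q \<in> fst d" using z by auto
      have qin: "snd d q \<in> snd d ` fst d" using q by auto
      have "mc c z v w = mc d (snd d q) (?D v z) (?D w z)"
        using mc_jacobian[OF c d q(2,3), of v w] by (simp add: jacobian_def q)
      also have "\<dots> = (\<Sum>b\<in>Basis. (?D v z \<bullet> b) * (\<Sum>b'\<in>Basis. (?D w z \<bullet> b') * mc d (snd d q) b b'))"
        using linear_basis_sum[OF mc_bilinear(3)[OF d qin], of "?D v z" "?D w z"]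
          linear_basis_sum[OF mc_bilinear(2)[OF d qin], of _ "?D w z"] by simp
      finally show ?thesis using coord_change_apply[OF c q(2), of d]
        by (simp add: q sum_distrib_left mult_ac)
    qed
    have dm: "((\<lambda>z. mc d (coord_change c d z) b b') has_derivative (\<lambda>u. dmc d y (J u) b b')) (at x)" for b b'
      by (rule has_derivative_compose[OF dy]) (use mc_has_derivative[OF d yin] phix in simp)
    have dD: "(?D v has_derivative (\<lambda>u. J2 u v)) (at x)" for v
      unfolding J2_def by (rule second_jacobian(1)[OF c d xin(2)])
    have dDb: "((\<lambda>z. ?D v z \<bullet> b) has_derivative (\<lambda>u. J2 u v \<bullet> b)) (at x)" for v b
      by (rule has_derivative_inner_left[OF dD])
    have "((\<lambda>z. \<Sum>b\<in>Basis. \<Sum>b'\<in>Basis. (?D v z \<bullet> b) * (?D w z \<bullet> b') * mc d (coord_change c d z) b b')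
      has_derivative (\<lambda>u. \<Sum>b\<in>Basis. \<Sum>b'\<in>Basis. (J v \<bullet> b) * (J w \<bullet> b') * dmc d y (J u) b b'
          + ((J v \<bullet> b) * (J2 u w \<bullet> b') + (J2 u v \<bullet> b) * (J w \<bullet> b')) * mc d y b b')) (at x)"
      using has_derivative_mult[OF has_derivative_mult[OF dDb dDb] dm] phix
      by (intro has_derivative_sum) (simp add: Jx)
    then have "((\<lambda>z. mc c z v w)
      has_derivative (\<lambda>u. \<Sum>b\<in>Basis. \<Sum>b'\<in>Basis. (J v \<bullet> b) * (J w \<bullet> b') * dmc d y (J u) b b'
          + ((J v \<bullet> b) * (J2 u w \<bullet> b') + (J2 u v \<bullet> b) * (J w \<bullet> b')) * mc d y b b')) (at x)"
      by (rule has_derivative_transform_within_open[OF _ open_overlap[OF c d] xin(2)]) (simp add: rep)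
    from has_derivative_unique[OF mc_has_derivative[OF c xin(1)] this]
    have "dmc c x u v w = (\<Sum>b\<in>Basis. \<Sum>b'\<in>Basis. (J v \<bullet> b) * (J w \<bullet> b') * dmc d y (J u) b b'
          + ((J v \<bullet> b) * (J2 u w \<bullet> b') + (J2 u v \<bullet> b) * (J w \<bullet> b')) * mc d y b b')" by metis
    also have "\<dots> = (\<Sum>b\<in>Basis. (J v \<bullet> b) * (\<Sum>b'\<in>Basis. (J w \<bullet> b') * dmc d y (J u) b b'))
        + (\<Sum>b\<in>Basis. (J v \<bullet> b) * (\<Sum>b'\<in>Basis. (J2 u w \<bullet> b') * mc d y b b'))
        + (\<Sum>b\<in>Basis. (J2 u v \<bullet> b) * (\<Sum>b'\<in>Basis. (J w \<bullet> b') * mc d y b b'))"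
      unfolding sum_distrib_left sum.distrib[symmetric] by (intro sum.cong refl) (simp add: algebra_simps)
    also have "\<dots> = dmc d y (J u) (J v) (J w) + mc d y (J v) (J2 u w) + mc d y (J2 u v) (J w)"
    proof -
      have e1: "mc d y v w = (\<Sum>b\<in>Basis. (v \<bullet> b) * (\<Sum>b'\<in>Basis. (w \<bullet> b') * mc d y b b'))" for v w
        using linear_basis_sum[OF mc_bilinear(3)[OF d yin], of v w]
          linear_basis_sum[OF mc_bilinear(2)[OF d yin], of _ w] by simp
      have l3: "linear (dmc d y u v)" for u v
      proof -
        have "dmc d y u v = (\<lambda>w. dmc d y u w v)" using dmc_linear(3)[OF d yin] by blast
        then show ?thesis using dmc_linear(2)[OF d yin] by simp
      qed
      have e2: "dmc d y u v w = (\<Sum>b\<in>Basis. (v \<bullet> b) * (\<Sum>b'\<in>Basis. (w \<bullet> b') * dmc d y u b b'))" for u v w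
        using linear_basis_sum[OF dmc_linear(2)[OF d yin], of u v w] linear_basis_sum[OF l3, of u _ w] by simp
      show ?thesis by (simp only: e1[symmetric] e2[symmetric])
    qed
    finally show ?thesis by simp
  qed
  have sym2: "J2 u v = J2 v u" for u v unfolding J2_def by (rule second_jacobian(2)[OF c d xin(2)])
  have "2 * mc c x (levi_civita A g c x v v) w = 2 * dmc c x v v w - dmc c x w v v"
    using levi_civita(2)[OF c xin(1), of v v w] by simp
  also have "\<dots> = 2 * dmc d y (J v) (J v) (J w) - dmc d y (J w) (J v) (J v) + 2 * mc d y (J2 v v) (J w)"
    using mc_sym[of d y "J v"] by (simp add: key sym2[of w v])
  also have "\<dots> = 2 * mc d y (levi_civita A g d y (J v) (J v)) (J w) + 2 * mc d y (J2 v v) (J w)"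
    using levi_civita(2)[OF d yin, of "J v" "J v" "J w"] by simp
  finally have "mc c x (levi_civita A g c x v v) w
      = mc d y (levi_civita A g d y (J v) (J v)) (J w) + mc d y (J2 v v) (J w)" by simp
  moreover have "mc d y (J a) (J w) = mc c x a w"
    unfolding J_def x_def y_def by (rule mc_jacobian[OF c d p])
  ultimately show ?thesis by (simp add: lin linear_add[OF mc_bilinear(3)[OF c xin(1)]])
qed

end

section \<open>Velocities and brackets in coordinates\<close>

lemma has_derivative_linear_apply:
  fixes u :: "'a::euclidean_space \<Rightarrow> 'b::euclidean_space" and M :: "'a \<Rightarrow> 'b \<Rightarrow> 'c::real_normed_vector"
  assumes S: "x \<in> S" and lin: "\<And>y. y \<in> S \<Longrightarrow> linear (M y)" and linN: "\<And>h. linear (\<lambda>v. N v h)"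
    and M: "\<And>v. ((\<lambda>y. M y v) has_derivative N v) (at x within S)"
    and u: "(u has_derivative u') (at x within S)"
  shows "((\<lambda>y. M y (u y)) has_derivative (\<lambda>h. N (u x) h + M x (u' h))) (at x within S)"
proof -
  have "((\<lambda>y. \<Sum>b\<in>Basis. (u y \<bullet> b) *\<^sub>R M y b) has_derivative
      (\<lambda>h. \<Sum>b\<in>Basis. (u x \<bullet> b) *\<^sub>R N b h + (u' h \<bullet> b) *\<^sub>R M x b)) (at x within S)"
    by (intro has_derivative_sum has_derivative_scaleR has_derivative_inner_left u M)
  moreover have "(\<Sum>b\<in>Basis. (u x \<bullet> b) *\<^sub>R N b h + (u' h \<bullet> b) *\<^sub>R M x b) = N (u x) h + M x (u' h)" for h
    using linear_basis_sum[OF linN, of "u x" h] linear_basis_sum[OF lin[OF S], of "u' h"] by (simp add: sum.distrib)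
  ultimately have "((\<lambda>y. \<Sum>b\<in>Basis. (u y \<bullet> b) *\<^sub>R M y b) has_derivative
      (\<lambda>h. N (u x) h + M x (u' h))) (at x within S)" by simp
  then show ?thesis
    by (rule has_derivative_transform[OF S, rotated]) (simp add: linear_basis_sum[OF lin])
qed

lemma vector_derivative_thick:
  fixes J :: "real set"
  assumes J: "thick J" and t: "t \<in> J" and f: "(f has_vector_derivative v) (at t within J)"
  shows "vector_derivative f (at t within J) = v"
proof -
  have "t islimpt J"
    unfolding islimpt_approachable
  proof (intro allI impI)
    fix e :: real assume "e > 0"
    then obtain d where "0 < \<bar>d\<bar>" "\<bar>d\<bar> < e" "t + d *\<^sub>R 1 \<in> J"
      using J t unfolding thick_def by (metis Basis_real_def singletonI)
    then show "\<exists>x'\<in>J. x' \<noteq> t \<and> dist x' t < e" by (intro bexI[of _ "t + d"]) (auto simp: dist_real_def)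
  qed
  then have "at t within J \<noteq> bot" by (simp add: trivial_limit_within)
  from vector_derivative_within[OF this f] show ?thesis .
qed

context atlas
begin

lemma curve_stays_near:
  fixes \<gamma> :: "real \<Rightarrow> 'm"
  assumes "continuous_on J \<gamma>" "t \<in> J" "open V" "\<gamma> t \<in> V"
  obtains d where "d > 0" "\<And>s. s \<in> J \<Longrightarrow> dist s t < d \<Longrightarrow> \<gamma> s \<in> V"
proof -
  have "(\<gamma> \<longlongrightarrow> \<gamma> t) (at t within J)" using assms by (simp add: continuous_on_def)
  then have "\<forall>\<^sub>F s in at t within J. \<gamma> s \<in> V" using assms by (auto dest: topological_tendstoD)
  then obtain d where "d > 0" "\<forall>s\<in>J. s \<noteq> t \<and> dist s t < d \<longrightarrow> \<gamma> s \<in> V"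
    unfolding eventually_at by auto
  then show ?thesis using that assms by metis
qed

lemma at_within_preimage:
  fixes \<gamma> :: "real \<Rightarrow> 'm"
  assumes "continuous_on J \<gamma>" "t \<in> J" "open V" "\<gamma> t \<in> V"
  shows "at t within (J \<inter> \<gamma> -` V) = at t within J"
proof -
  obtain \<delta> where \<delta>: "\<delta> > 0" "\<And>s. s \<in> J \<Longrightarrow> dist s t < \<delta> \<Longrightarrow> \<gamma> s \<in> V"
    using curve_stays_near[OF assms] by blast
  show ?thesis by (rule at_within_nhd[of t "ball t \<delta>"]) (use \<delta> in \<open>auto simp: dist_commute\<close>)
qed

lemma curve_coord_change:
  assumes cont: "continuous_on J \<gamma>" and t: "t \<in> J" and c: "c \<in> A" "\<gamma> t \<in> fst c" and d: "d \<in> A" "\<gamma> t \<in> fst d"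
    and der: "((snd c \<circ> \<gamma>) has_vector_derivative v) (at t within J)"
  shows "((snd d \<circ> \<gamma>) has_vector_derivative jacobian c d (\<gamma> t) v) (at t within J)"
proof -
  have "open (fst c \<inter> fst d)" using chart c d by blast
  then obtain \<delta> where \<delta>: "\<delta> > 0" "\<And>s. s \<in> J \<Longrightarrow> dist s t < \<delta> \<Longrightarrow> \<gamma> s \<in> fst c \<inter> fst d"
    using curve_stays_near[OF cont t, of "fst c \<inter> fst d"] c d by blast
  have "((\<lambda>s. coord_change c d ((snd c \<circ> \<gamma>) s)) has_derivative (\<lambda>h. jacobian c d (\<gamma> t) (h *\<^sub>R v))) (at t within J)"
    by (rule has_derivative_compose[OF der[unfolded has_vector_derivative_def]])
       (use coord_change_has_derivative[OF c(1) d(1) c(2) d(2)] in simp)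
  then have "((\<lambda>s. coord_change c d ((snd c \<circ> \<gamma>) s)) has_vector_derivative jacobian c d (\<gamma> t) v) (at t within J)"
    using linear_cmul[OF linear_jacobian[OF c(1) d(1) c(2) d(2)]] by (simp add: has_vector_derivative_def)
  then show ?thesis
    by (rule has_vector_derivative_transform_within[OF _ \<delta>(1) t]) (use \<delta>(2) c d in \<open>simp add: coord_change_apply\<close>)
qed

lemma velocity_eq:
  assumes cont: "continuous_on J \<gamma>" and t: "t \<in> J" and J: "thick J" and c: "c \<in> A" "\<gamma> t \<in> fst c"
    and der: "((snd c \<circ> \<gamma>) has_vector_derivative v) (at t within J)"
  shows "velocity A J \<gamma> t = of_coord A c (\<gamma> t) v" "to_coord A c (\<gamma> t) (velocity A J \<gamma> t) = v"
proof -
  from vector_derivative_thick[OF J t curve_coord_change[OF cont t c chart_at der]]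
  show "velocity A J \<gamma> t = of_coord A c (\<gamma> t) v" by (simp add: velocity_def of_coord_jacobian)
  then show "to_coord A c (\<gamma> t) (velocity A J \<gamma> t) = v" using c by (simp add: to_of_coord)
qed

lemma field_coord_apply: "c \<in> A \<Longrightarrow> p \<in> fst c \<Longrightarrow> field_coord A c X (snd c p) = to_coord A c p (X p)"
  by (simp add: field_coord_def chart)

text \<open>The bracket is defined in the chart that happens to be chosen at each point.  In the transformation
  to the chart \<open>c\<close> the second derivatives of the coordinate change enter both terms symmetrically and cancel.\<close>

lemma lie_bracket_coord:
  assumes X: "\<And>c. c \<in> A \<Longrightarrow> smooth_on (snd c ` fst c) (field_coord A c X)"
    and Y: "\<And>c. c \<in> A \<Longrightarrow> smooth_on (snd c ` fst c) (field_coord A c Y)"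
    and c: "c \<in> A" "x \<in> snd c ` fst c"
  shows "field_coord A c (lie_bracket A X Y) x =
    frechet_derivative (field_coord A c Y) (at x) (field_coord A c X x)
    - frechet_derivative (field_coord A c X) (at x) (field_coord A c Y x)"
proof -
  obtain p where p: "x = snd c p" "p \<in> fst c" using c by auto
  define d where "d = chart_at A p"
  have d: "d \<in> A" "p \<in> fst d" using chart_at by (auto simp: d_def)
  define y where "y = snd d p"
  have y: "y \<in> snd d ` (fst d \<inter> fst c)" "y \<in> snd d ` fst d" using d p by (auto simp: y_def)
  have chy: "coord_change d c y = x" using d by (simp add: y_def p coord_change_apply)
  let ?D = "\<lambda>z v. frechet_derivative (coord_change d c) (at z) v"
  let ?D2 = "\<lambda>v u. frechet_derivative (\<lambda>z. frechet_derivative (coord_change d c) (at z) v) (at y) u"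
  have jac: "jacobian d c q = ?D (snd d q)" for q by (simp add: jacobian_def)
  have lin: "linear (?D z)" if z: "z \<in> snd d ` (fst d \<inter> fst c)" for z
    using z linear_jacobian[OF d(1) c(1)] by (auto simp flip: jac)
  have sym: "?D2 v u = ?D2 u v" for u v using second_jacobian(2)[OF d(1) c(1) y(1)] .
  have linD2: "linear (\<lambda>v. ?D2 v h)" for h
  proof -
    have "(\<lambda>v. ?D2 v h) = ?D2 h" by (intro ext sym)
    then show ?thesis using second_jacobian(1)[OF d(1) c(1) y(1), of h] has_derivative_linear by auto
  qed
  have key: "frechet_derivative (field_coord A c X) (at x) (?D y u)
      = ?D2 (field_coord A d X y) u + ?D y (frechet_derivative (field_coord A d X) (at y) u)"
    if X: "\<And>c. c \<in> A \<Longrightarrow> smooth_on (snd c ` fst c) (field_coord A c X)" for X u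
  proof -
    have dX: "(field_coord A d X has_derivative frechet_derivative (field_coord A d X) (at y)) (at y)"
      by (rule smooth_on_has_derivative[OF X chart(2) y(2)]) (rule d(1), rule d(1))
    have 1: "((\<lambda>z. ?D z (field_coord A d X z)) has_derivative
        (\<lambda>u. ?D2 (field_coord A d X y) u + ?D y (frechet_derivative (field_coord A d X) (at y) u)))
        (at y within snd d ` (fst d \<inter> fst c))"
      by (rule has_derivative_linear_apply[OF y(1) lin linD2])
         (use second_jacobian(1)[OF d(1) c(1) y(1)] dX has_derivative_at_withinI in blast)+
    have "(coord_change d c has_derivative ?D y) (at y)"
      using coord_change_has_derivative[OF d(1) c(1) d(2) p(2)] by (simp add: jac y_def)
    from has_derivative_compose[OF this, of "field_coord A c X"]
    have 2: "((\<lambda>z. field_coord A c X (coord_change d c z)) has_derivative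
        (\<lambda>u. frechet_derivative (field_coord A c X) (at x) (?D y u))) (at y)"
      using smooth_on_has_derivative[OF X[OF c(1)] chart(2)[OF c(1)] c(2)] by (simp add: chy)
    have eq: "field_coord A c X (coord_change d c z) = ?D z (field_coord A d X z)"
      if z: "z \<in> snd d ` (fst d \<inter> fst c)" for z
    proof -
      obtain q where q: "z = snd d q" "q \<in> fst d" "q \<in> fst c" using z by auto
      show ?thesis using jacobian_to_coord[OF d(1) c(1) q(2,3), of "X q"]
        by (simp add: q coord_change_apply[OF d(1)] field_coord_apply[OF d(1)] field_coord_apply[OF c(1)] jac)
    qed
    have "((\<lambda>z. ?D z (field_coord A d X z)) has_derivative
        (\<lambda>u. frechet_derivative (field_coord A c X) (at x) (?D y u))) (at y)"
      by (rule has_derivative_transform_within_open[OF 2 open_overlap[OF d(1) c(1)] y(1) eq])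
    from has_derivative_unique[OF this 1[unfolded at_within_open[OF y(1) open_overlap[OF d(1) c(1)]]]]
    show ?thesis by (rule fun_cong)
  qed
  have XY: "field_coord A d X y = X p" "field_coord A d Y y = Y p"
    using to_coord_chart_at[of p] by (simp_all add: y_def field_coord_apply[OF d] d_def chart_at field_coord_apply)
  have Fx: "field_coord A c X x = ?D y (X p)" for X
  proof -
    have "to_coord A d p (X p) = X p" using to_coord_chart_at by (simp add: d_def)
    then show ?thesis using jacobian_to_coord[OF d(1) c(1) d(2) p(2), of "X p"]
      by (simp add: p field_coord_apply[OF c(1)] jac y_def)
  qed
  have "field_coord A c (lie_bracket A X Y) x = ?D y (lie_bracket A X Y p)" by (rule Fx)
  also have "\<dots> = ?D y (frechet_derivative (field_coord A d Y) (at y) (X p))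
      - ?D y (frechet_derivative (field_coord A d X) (at y) (Y p))"
    by (simp add: lie_bracket_def Let_def y_def d_def[symmetric] linear_diff[OF lin[OF y(1), unfolded y_def]])
  also have "\<dots> = frechet_derivative (field_coord A c Y) (at x) (?D y (X p))
      - frechet_derivative (field_coord A c X) (at x) (?D y (Y p))"
    using sym[of "X p" "Y p"] key[of X "Y p"] key[of Y "X p"] X Y by (simp add: XY)
  finally show ?thesis by (simp add: Fx)
qed

lemma lie_bracket_smooth:
  assumes X: "\<And>c. c \<in> A \<Longrightarrow> smooth_on (snd c ` fst c) (field_coord A c X)"
    and Y: "\<And>c. c \<in> A \<Longrightarrow> smooth_on (snd c ` fst c) (field_coord A c Y)" and c: "c \<in> A"
  shows "smooth_on (snd c ` fst c) (field_coord A c (lie_bracket A X Y))"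
proof -
  let ?S = "snd c ` fst c"
  have th: "thick ?S" using chart(2)[OF c] open_thick by blast
  have D: "smooth_on ?S (\<lambda>x. frechet_derivative (field_coord A c X) (at x) (u x))"
    if "smooth_on ?S (field_coord A c X)" "smooth_on ?S u" for X u
  proof (rule smooth_on_linear_apply[OF th _ _ that(2)])
    show "linear (frechet_derivative (field_coord A c X) (at x))" if "x \<in> ?S" for x
      using smooth_on_has_derivative[OF \<open>smooth_on ?S (field_coord A c X)\<close> chart(2)[OF c] that]
      by (rule has_derivative_linear)
    show "smooth_on ?S (\<lambda>x. frechet_derivative (field_coord A c X) (at x) b)" for b
      by (rule smooth_on_frechet_derivative[OF that(1) chart(2)[OF c]])
  qed
  have "smooth_on ?S (\<lambda>x. frechet_derivative (field_coord A c Y) (at x) (field_coord A c X x)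
    - frechet_derivative (field_coord A c X) (at x) (field_coord A c Y x))"
    by (intro smooth_on_diff th D X Y c)
  moreover have "field_coord A c (lie_bracket A X Y) x = frechet_derivative (field_coord A c Y) (at x) (field_coord A c X x)
    - frechet_derivative (field_coord A c X) (at x) (field_coord A c Y x)" if "x \<in> ?S" for x
    by (rule lie_bracket_coord) (use X Y c that in auto)
  ultimately show ?thesis using smooth_on_cong[of ?S "field_coord A c (lie_bracket A X Y)"] by simp
qed

lemma commutator_smooth:
  assumes "commutator A \<Sigma> j X" "c \<in> A"
  shows "smooth_on (snd c ` fst c) (field_coord A c X)"
  using assms
proof (induction arbitrary: c rule: commutator.induct)
  case (field X)
  then show ?case by (auto simp: horizontal_field_def smooth_field_on_def)
next
  case (bracket X i Y)
  have "smooth_on (snd c ` fst c) (field_coord A c X)" if "c \<in> A" for c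
    using bracket(1) that by (auto simp: horizontal_field_def smooth_field_on_def)
  then show ?case using lie_bracket_smooth bracket by blast
qed

end

section \<open>Orthonormal frames\<close>

lemma smooth_on_bilinear_form:
  fixes B :: "'a::euclidean_space \<Rightarrow> 'e::euclidean_space \<Rightarrow> 'e \<Rightarrow> real"
  assumes S: "thick S" and B: "\<And>x u. x \<in> S \<Longrightarrow> linear (B x u)" "\<And>x v. x \<in> S \<Longrightarrow> linear (\<lambda>u. B x u v)"
    and sm: "\<And>u v. smooth_on S (\<lambda>x. B x u v)" and u: "smooth_on S u" and v: "smooth_on S v"
  shows "smooth_on S (\<lambda>x. B x (u x) (v x))"
proof (rule smooth_on_linear_apply[OF S B(1) _ v])
  show "smooth_on S (\<lambda>x. B x (u x) b)" for b
    by (rule smooth_on_linear_apply[OF S B(2) sm u])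
qed

lemma continuous_on_bilinear_form:
  fixes B :: "'a::euclidean_space \<Rightarrow> 'e::euclidean_space \<Rightarrow> 'e \<Rightarrow> real"
  assumes S: "thick S" and B: "\<And>x u. x \<in> S \<Longrightarrow> linear (B x u)" "\<And>x v. x \<in> S \<Longrightarrow> linear (\<lambda>u. B x u v)"
    and c: "\<And>u v. continuous_on S (\<lambda>x. B x u v)" and u: "continuous_on S u" and v: "continuous_on S v"
  shows "continuous_on S (\<lambda>x. B x (u x) (v x))"
proof -
  have c0: "Ck_on 0 S (\<lambda>x. B x a b)" "Ck_on 0 S u" "Ck_on 0 S v" for a b using c u v by simp_all
  have "Ck_on 0 S (\<lambda>x. B x (u x) b)" for b
    by (rule Ck_on_linear_apply[where M="\<lambda>x u. B x u b", OF S B(2) c0(1,2)])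
  from Ck_on_linear_apply[where M="\<lambda>x. B x (u x)", OF S B(1) this c0(3)]
  have "Ck_on 0 S (\<lambda>x. B x (u x) (v x))" .
  then show ?thesis by simp
qed

text \<open>Induction on the number of fields.  The orthogonalized field \<open>Y\<close> vanishes nowhere because the span has full
  dimension \<open>k\<close>, so that normalizing it is smooth.\<close>

lemma gram_schmidt:
  fixes B :: "'e::euclidean_space \<Rightarrow> 'e \<Rightarrow> 'e \<Rightarrow> real" and X :: "nat \<Rightarrow> 'e \<Rightarrow> 'e"
  assumes S: "open S" and B: "\<And>x u. x \<in> S \<Longrightarrow> linear (B x u)" "\<And>x v. x \<in> S \<Longrightarrow> linear (\<lambda>u. B x u v)"
    and sym: "\<And>x u v. B x u v = B x v u" and pos: "\<And>x v. x \<in> S \<Longrightarrow> v \<noteq> 0 \<Longrightarrow> B x v v > 0"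
    and sm: "\<And>u v. smooth_on S (\<lambda>x. B x u v)" and X: "\<And>i. i < k \<Longrightarrow> smooth_on S (X i)"
    and dim: "\<And>x. x \<in> S \<Longrightarrow> dim ((\<lambda>i. X i x) ` {..<k}) = k" and n: "n \<le> k"
  shows "\<exists>Z. (\<forall>i<n. smooth_on S (Z i)) \<and> (\<forall>x\<in>S. (\<forall>i<n. \<forall>j<n. B x (Z i x) (Z j x) = (if i = j then 1 else 0)) \<and>
      span ((\<lambda>i. Z i x) ` {..<n}) = span ((\<lambda>i. X i x) ` {..<n}))"
  using n
proof (induction n)
  case 0
  then show ?case by simp
next
  case (Suc n)
  then obtain Z where Z: "\<And>i. i < n \<Longrightarrow> smooth_on S (Z i)"
    and orth: "\<And>x i j. x \<in> S \<Longrightarrow> i < n \<Longrightarrow> j < n \<Longrightarrow> B x (Z i x) (Z j x) = (if i = j then 1 else 0)"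
    and sp: "\<And>x. x \<in> S \<Longrightarrow> span ((\<lambda>i. Z i x) ` {..<n}) = span ((\<lambda>i. X i x) ` {..<n})"
    by force
  have th: "thick S" using S by (rule open_thick)
  define a where "a i x = B x (X n x) (Z i x)" for i x
  define Y where "Y x = X n x - (\<Sum>i<n. a i x *\<^sub>R Z i x)" for x
  define s where "s x = B x (Y x) (Y x) powr (- 1/2)" for x
  define Z' where "Z' = Z(n := \<lambda>x. s x *\<^sub>R Y x)"
  have smB: "smooth_on S (\<lambda>x. B x (u x) (v x))" if "smooth_on S u" "smooth_on S v" for u v
    using smooth_on_bilinear_form[OF th B sm that] .
  have Xn: "smooth_on S (X n)" using X Suc.prems by simp
  have Y: "smooth_on S Y" unfolding Y_def a_def
    by (intro smooth_on_diff smooth_on_sum smooth_on_scaleR smB th Xn Z) auto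
  have Zsp: "Z i x \<in> span ((\<lambda>i. X i x) ` {..<n})" if "x \<in> S" "i < n" for x i
    using sp[OF that(1)] that(2) span_base[of "Z i x" "(\<lambda>i. Z i x) ` {..<n}"] by auto
  have sumsp: "(\<Sum>i<n. a i x *\<^sub>R Z i x) \<in> span ((\<lambda>i. X i x) ` {..<n})" if "x \<in> S" for x
    using Zsp[OF that] by (intro span_sum span_scale) auto
  have Y0: "Y x \<noteq> 0" if x: "x \<in> S" for x
  proof
    assume "Y x = 0"
    then have in_span: "X n x \<in> span ((\<lambda>i. X i x) ` {..<n})" using sumsp[OF x] by (simp add: Y_def)
    let ?V = "(\<lambda>i. X i x) ` {..<k}"
    have cardle: "card ?V \<le> k" using card_image_le[of "{..<k}"] by simp
    have ind: "independent ?V"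
      by (rule card_le_dim_spanning[of _ ?V]) (use cardle dim[OF x] span_superset[of ?V] in auto)
    then have "card ?V = k" using dim[OF x] dim_eq_card_independent by metis
    then have inj: "inj_on (\<lambda>i. X i x) {..<k}" by (intro eq_card_imp_inj_on) auto
    have "(\<lambda>i. X i x) ` {..<n} \<subseteq> ?V - {X n x}"
      using inj Suc.prems unfolding inj_on_def by fastforce
    then have "X n x \<in> span (?V - {X n x})" using in_span span_mono by blast
    moreover have "X n x \<in> ?V" using Suc.prems by auto
    ultimately show False using ind unfolding dependent_def by blast
  qed
  have BY: "B x (Y x) (Y x) > 0" if "x \<in> S" for x using pos[OF that Y0[OF that]] .
  have s: "smooth_on S s" unfolding s_def by (intro smooth_on_powr th smB Y BY)
  have spos: "s x > 0" "s x * s x * B x (Y x) (Y x) = 1" if "x \<in> S" for x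
  proof -
    show "s x > 0" using BY[OF that] by (simp add: s_def)
    have "s x * s x = B x (Y x) (Y x) powr (- 1)" unfolding s_def by (simp add: powr_add[symmetric])
    then show "s x * s x * B x (Y x) (Y x) = 1" using BY[OF that] by (simp add: powr_minus)
  qed
  have YZ: "B x (Y x) (Z j x) = 0" if x: "x \<in> S" and j: "j < n" for x j
  proof -
    have "B x (Y x) (Z j x) = a j x - (\<Sum>i<n. a i x * B x (Z i x) (Z j x))"
      unfolding Y_def
      by (simp add: linear_diff[OF B(2)[OF x]] linear_sum[OF B(2)[OF x]] linear_cmul[OF B(2)[OF x]] a_def)
    also have "(\<Sum>i<n. a i x * B x (Z i x) (Z j x)) = (\<Sum>i<n. if i = j then a i x else 0)"
      using orth[OF x _ j] by (intro sum.cong) auto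
    also have "\<dots> = a j x" using j by simp
    finally show ?thesis by simp
  qed
  show ?case
  proof (intro exI[of _ Z'] conjI allI ballI impI)
    show "smooth_on S (Z' i)" if "i < Suc n" for i
      using that Z smooth_on_scaleR[OF th s Y] by (auto simp: Z'_def less_Suc_eq)
    fix x assume x: "x \<in> S"
    have sB: "B x (s x *\<^sub>R Y x) v = s x * B x (Y x) v" "B x v (s x *\<^sub>R Y x) = s x * B x v (Y x)" for v
      using linear_cmul[OF B(1)[OF x]] linear_cmul[OF B(2)[OF x]] by auto
    show "B x (Z' i x) (Z' j x) = (if i = j then 1 else 0)" if "i < Suc n" "j < Suc n" for i j
      using that orth[OF x, of i j] YZ[OF x] spos(2)[OF x] sym[of x "Z _ x" "Y x"]
      by (auto simp: Z'_def less_Suc_eq sB mult_ac)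
    let ?ZX = "span ((\<lambda>i. X i x) ` {..<n})"
    have i1: "(\<lambda>i. Z' i x) ` {..<Suc n} = insert (s x *\<^sub>R Y x) ((\<lambda>i. Z i x) ` {..<n})"
      by (auto simp: Z'_def lessThan_Suc)
    have i2: "(\<lambda>i. X i x) ` {..<Suc n} = insert (X n x) ((\<lambda>i. X i x) ` {..<n})"
      by (simp add: lessThan_Suc)
    have Xsub: "?ZX \<subseteq> span (insert (X n x) ((\<lambda>i. X i x) ` {..<n}))" by (rule span_mono) auto
    have Zsub: "?ZX \<subseteq> span (insert (s x *\<^sub>R Y x) ((\<lambda>i. Z i x) ` {..<n}))"
      unfolding sp[OF x, symmetric] by (rule span_mono) auto
    have "s x *\<^sub>R Y x \<in> span (insert (X n x) ((\<lambda>i. X i x) ` {..<n}))"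
      unfolding Y_def using Xsub sumsp[OF x] by (intro span_scale span_diff) (auto intro: span_base)
    moreover have "(\<lambda>i. Z i x) ` {..<n} \<subseteq> span (insert (X n x) ((\<lambda>i. X i x) ` {..<n}))"
      using Zsp[OF x] Xsub by auto
    moreover have "X n x \<in> span (insert (s x *\<^sub>R Y x) ((\<lambda>i. Z i x) ` {..<n}))"
    proof -
      have "X n x = (1 / s x) *\<^sub>R (s x *\<^sub>R Y x) + (\<Sum>i<n. a i x *\<^sub>R Z i x)"
        using spos(1)[OF x] by (simp add: Y_def)
      also have "\<dots> \<in> span (insert (s x *\<^sub>R Y x) ((\<lambda>i. Z i x) ` {..<n}))"
      proof (rule span_add)
        show "(1 / s x) *\<^sub>R (s x *\<^sub>R Y x) \<in> span (insert (s x *\<^sub>R Y x) ((\<lambda>i. Z i x) ` {..<n}))"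
          by (rule span_scale, rule span_base, rule insertI1)
        show "(\<Sum>i<n. a i x *\<^sub>R Z i x) \<in> span (insert (s x *\<^sub>R Y x) ((\<lambda>i. Z i x) ` {..<n}))"
          using Zsub sumsp[OF x] by blast
      qed
      finally show ?thesis .
    qed
    moreover have "(\<lambda>i. X i x) ` {..<n} \<subseteq> span (insert (s x *\<^sub>R Y x) ((\<lambda>i. Z i x) ` {..<n}))"
      by (rule order_trans[OF span_superset Zsub])
    ultimately show "span ((\<lambda>i. Z' i x) ` {..<Suc n}) = span ((\<lambda>i. X i x) ` {..<Suc n})"
      unfolding i1 i2 span_eq by simp
  qed
qed

lemma (in riemannian) orthonormal_frame:
  assumes \<Sigma>: "distribution A k \<Sigma>" and c: "c \<in> A" "p \<in> fst c"
  obtains S Z where "open S" "snd c p \<in> S" "S \<subseteq> snd c ` fst c" "\<forall>i<k. smooth_on S (Z i)"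
    "\<forall>x\<in>S. \<forall>i<k. \<forall>j<k. mc c x (Z i x) (Z j x) = (if i = j then 1 else 0)"
    "\<forall>x\<in>S. to_coord A c (chart_inv c x) ` \<Sigma> (chart_inv c x) = span ((\<lambda>i. Z i x) ` {..<k})"
proof -
  obtain U X where U: "open U" "p \<in> U" and X: "\<And>i. i < k \<Longrightarrow> smooth_field_on A U (X i)"
    and sp: "\<And>q. q \<in> U \<Longrightarrow> \<Sigma> q = span ((\<lambda>i. X i q) ` {..<k})"
    using \<Sigma> unfolding distribution_def by metis
  have dim\<Sigma>: "dim (\<Sigma> q) = k" for q using \<Sigma> by (simp add: distribution_def)
  define S where "S = snd c ` (fst c \<inter> U)"
  have S: "open S" "snd c p \<in> S" "S \<subseteq> snd c ` fst c"
    using open_chart_image[OF c(1) U(1)] c U by (auto simp: S_def)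
  have img: "to_coord A c (chart_inv c x) ` \<Sigma> (chart_inv c x) = span ((\<lambda>i. field_coord A c (X i) x) ` {..<k})"
    and dim: "dim ((\<lambda>i. field_coord A c (X i) x) ` {..<k}) = k" if x: "x \<in> S" for x
  proof -
    obtain q where q: "x = snd c q" "q \<in> fst c" "q \<in> U" using x by (auto simp: S_def)
    have lin: "linear (to_coord A c q)" using to_coord_linear c q by blast
    have inj: "inj (to_coord A c q)" using of_to_coord[OF c(1) q(2)] by (rule inj_on_inverseI)
    have eq: "(\<lambda>i. field_coord A c (X i) x) ` {..<k} = to_coord A c q ` (\<lambda>i. X i q) ` {..<k}"
      by (simp add: image_image q field_coord_apply[OF c(1)])
    show "to_coord A c (chart_inv c x) ` \<Sigma> (chart_inv c x) = span ((\<lambda>i. field_coord A c (X i) x) ` {..<k})"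
      unfolding eq linear_span_image[OF lin] using q sp chart(5)[OF c(1)] by simp
    have "dim (to_coord A c q ` (\<lambda>i. X i q) ` {..<k}) = dim ((\<lambda>i. X i q) ` {..<k})"
      by (rule dim_image_eq[OF lin]) (rule inj_on_subset[OF inj], simp)
    also have "\<dots> = dim (\<Sigma> q)" using sp[OF q(3)] by (simp add: dim_span)
    finally show "dim ((\<lambda>i. field_coord A c (X i) x) ` {..<k}) = k" unfolding eq dim\<Sigma> .
  qed
  have th: "thick S" by (rule open_thick[OF S(1)])
  have "\<exists>Z. (\<forall>i<k. smooth_on S (Z i)) \<and> (\<forall>x\<in>S. (\<forall>i<k. \<forall>j<k. mc c x (Z i x) (Z j x) = (if i = j then 1 else 0)) \<and>
      span ((\<lambda>i. Z i x) ` {..<k}) = span ((\<lambda>i. field_coord A c (X i) x) ` {..<k}))"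
  proof (rule gram_schmidt[where B="mc c" and X="\<lambda>i. field_coord A c (X i)" and k=k and n=k, OF S(1)])
    fix x u v
    show "mc c x u v = mc c x v u" by (rule mc_sym)
    show "smooth_on S (\<lambda>x. mc c x u v)" using smooth_on_subset[OF mc_smooth[OF c(1)] S(3) th] .
    assume x: "x \<in> S"
    then have x': "x \<in> snd c ` fst c" using S(3) by (rule subsetD[rotated])
    show "linear (mc c x u)" by (rule mc_bilinear(2)[OF c(1) x'])
    show "linear (\<lambda>u. mc c x u v)" by (rule mc_bilinear(3)[OF c(1) x'])
    show "mc c x v v > 0" if "v \<noteq> 0" by (rule mc_pos[OF c(1) x' that])
    show "dim ((\<lambda>i. field_coord A c (X i) x) ` {..<k}) = k" by (rule dim[OF x])
  next
    fix i assume "i < k"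
    then have "smooth_field_on A U (X i)" by (rule X)
    then show "smooth_on S (field_coord A c (X i))" using c(1) by (simp add: smooth_field_on_def S_def)
  qed simp
  then obtain Z where Z: "\<forall>i<k. smooth_on S (Z i)"
    "\<forall>x\<in>S. (\<forall>i<k. \<forall>j<k. mc c x (Z i x) (Z j x) = (if i = j then 1 else 0)) \<and>
      span ((\<lambda>i. Z i x) ` {..<k}) = span ((\<lambda>i. field_coord A c (X i) x) ` {..<k})" by blast
  show ?thesis
  proof (rule that[OF S Z(1)])
    show "\<forall>x\<in>S. \<forall>i<k. \<forall>j<k. mc c x (Z i x) (Z j x) = (if i = j then 1 else 0)" using Z(2) by simp
    show "\<forall>x\<in>S. to_coord A c (chart_inv c x) ` \<Sigma> (chart_inv c x) = span ((\<lambda>i. Z i x) ` {..<k})"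
      using Z(2) img by simp
  qed
qed

section \<open>The geodesic equation\<close>

text \<open>The vectors \<open>\<beta> i\<close> embed the \<open>k\<close> coefficients of a horizontal vector into the model space \<open>'e\<close>.  Thereby the
  state space of the geodesic equation is the Euclidean space \<open>'e \<times> 'e\<close> for every rank \<open>k\<close>.\<close>

locale framed_chart = riemannian A g
  for A :: "('m::{t2_space,second_countable_topology}, 'e::euclidean_space) chart set" and g +
  fixes \<Sigma> :: "'m \<Rightarrow> 'e set" and k :: nat and c :: "('m, 'e) chart" and S :: "'e set"
    and Z :: "nat \<Rightarrow> 'e \<Rightarrow> 'e" and \<beta> :: "nat \<Rightarrow> 'e"
  assumes cA: "c \<in> A" and S: "open S" "S \<subseteq> snd c ` fst c"
    and Z_smooth: "\<And>i. i < k \<Longrightarrow> smooth_on S (Z i)"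
    and Z_orth: "\<And>x i j. x \<in> S \<Longrightarrow> i < k \<Longrightarrow> j < k \<Longrightarrow> mc c x (Z i x) (Z j x) = (if i = j then 1 else 0)"
    and Z_span: "\<And>x. x \<in> S \<Longrightarrow>
        to_coord A c (chart_inv c x) ` \<Sigma> (chart_inv c x) = span ((\<lambda>i. Z i x) ` {..<k})"
    and \<beta>: "\<And>i. i < k \<Longrightarrow> \<beta> i \<in> Basis" "inj_on \<beta> {..<k}"
begin

definition frame :: "'e \<Rightarrow> 'e \<Rightarrow> 'e" where
  "frame x w = (\<Sum>i<k. (w \<bullet> \<beta> i) *\<^sub>R Z i x)"

definition dframe :: "'e \<Rightarrow> 'e \<Rightarrow> 'e \<Rightarrow> 'e" where
  "dframe x w v = (\<Sum>i<k. (w \<bullet> \<beta> i) *\<^sub>R frechet_derivative (Z i) (at x) v)"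

text \<open>The derivative of the \<open>i\<close>-th coefficient along a geodesic.  The second line is \<open>g(\<Gamma>(v, v), Z\<^sub>i)\<close> by the Koszul
  formula; this form shows the smoothness without solving for \<open>\<Gamma>\<close>.\<close>

definition force :: "nat \<Rightarrow> 'e \<Rightarrow> 'e \<Rightarrow> real" where
  "force i x w = - (mc c x (dframe x w (frame x w)) (Z i x)
      + (dmc c x (frame x w) (frame x w) (Z i x) - dmc c x (Z i x) (frame x w) (frame x w) / 2))"

definition geodesic_field :: "'e \<times> 'e \<Rightarrow> 'e \<times> 'e" where
  "geodesic_field z = (frame (fst z) (snd z), \<Sum>i<k. force i (fst z) (snd z) *\<^sub>R \<beta> i)"

lemma in_chart: "x \<in> S \<Longrightarrow> x \<in> snd c ` fst c" using S by blast

lemma \<beta>_inner: "i < k \<Longrightarrow> j < k \<Longrightarrow> \<beta> i \<bullet> \<beta> j = (if i = j then 1 else 0)"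
  using \<beta> by (simp add: inner_Basis inj_on_eq_iff)

lemma Z_has_derivative: "i < k \<Longrightarrow> x \<in> S \<Longrightarrow> (Z i has_derivative frechet_derivative (Z i) (at x)) (at x)"
  using smooth_on_has_derivative[OF Z_smooth S(1)] .

lemma frame_has_derivative: "x \<in> S \<Longrightarrow> ((\<lambda>x. frame x w) has_derivative dframe x w) (at x)"
  unfolding frame_def dframe_def
  by (intro has_derivative_sum has_derivative_scaleR_right Z_has_derivative) auto

lemma frame_linear: "linear (frame x)"
  unfolding frame_def
  by (rule linearI) (simp_all add: inner_add_left scaleR_add_left sum.distrib scaleR_sum_right)

lemma dframe_linear: "linear (\<lambda>w. dframe x w v)"
  unfolding dframe_def
  by (rule linearI) (simp_all add: inner_add_left scaleR_add_left sum.distrib scaleR_sum_right)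

lemma frame_basis: "i < k \<Longrightarrow> frame x (\<beta> i) = Z i x"
proof -
  assume i: "i < k"
  have "frame x (\<beta> i) = (\<Sum>j<k. if j = i then Z j x else 0)"
    unfolding frame_def using i by (intro sum.cong) (auto simp: \<beta>_inner)
  then show ?thesis using i by simp
qed

lemma frame_in_span: "frame x w \<in> span ((\<lambda>i. Z i x) ` {..<k})"
  unfolding frame_def by (intro span_sum span_scale span_base) auto

lemma frame_expansion:
  assumes x: "x \<in> S" and v: "v \<in> span ((\<lambda>i. Z i x) ` {..<k})"
  shows "v = (\<Sum>i<k. mc c x v (Z i x) *\<^sub>R Z i x)"
proof -
  note l = mc_bilinear(3)[OF cA in_chart[OF x]]
  have "subspace {v. v = (\<Sum>i<k. mc c x v (Z i x) *\<^sub>R Z i x)}"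
  proof (rule subspaceI; unfold mem_Collect_eq)
    fix r v assume "v = (\<Sum>i<k. mc c x v (Z i x) *\<^sub>R Z i x)"
    then have "r *\<^sub>R v = r *\<^sub>R (\<Sum>i<k. mc c x v (Z i x) *\<^sub>R Z i x)" by (rule arg_cong)
    also have "\<dots> = (\<Sum>i<k. mc c x (r *\<^sub>R v) (Z i x) *\<^sub>R Z i x)"
      by (simp add: linear_cmul[OF l] scaleR_sum_right)
    finally show "r *\<^sub>R v = (\<Sum>i<k. mc c x (r *\<^sub>R v) (Z i x) *\<^sub>R Z i x)" .
  qed (simp_all add: linear_0[OF l] linear_add[OF l] scaleR_add_left sum.distrib)
  moreover have "Z j x = (\<Sum>i<k. mc c x (Z j x) (Z i x) *\<^sub>R Z i x)" if j: "j < k" for j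
  proof -
    have "(\<Sum>i<k. mc c x (Z j x) (Z i x) *\<^sub>R Z i x) = (\<Sum>i<k. if i = j then Z i x else 0)"
      using Z_orth[OF x j] by (intro sum.cong) auto
    then show ?thesis using j by simp
  qed
  then have "(\<lambda>i. Z i x) ` {..<k} \<subseteq> {v. v = (\<Sum>i<k. mc c x v (Z i x) *\<^sub>R Z i x)}" by blast
  ultimately have "span ((\<lambda>i. Z i x) ` {..<k}) \<subseteq> {v. v = (\<Sum>i<k. mc c x v (Z i x) *\<^sub>R Z i x)}"
    by (intro span_minimal)
  then show ?thesis using v by blast
qed

lemma smooth_on_prod: "smooth_on S f \<Longrightarrow> smooth_on (S \<times> (UNIV :: 'e set)) (\<lambda>z. f (fst z))"
proof -
  assume f: "smooth_on S f"
  have th: "thick (S \<times> (UNIV :: 'e set))" using S(1) by (intro open_thick open_Times) auto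
  show ?thesis by (rule smooth_on_compose[OF th f smooth_on_fst[OF th smooth_on_ident[OF th]]]) auto
qed

lemma geodesic_field_smooth: "smooth_on (S \<times> UNIV) geodesic_field"
proof -
  let ?P = "S \<times> (UNIV :: 'e set)"
  have P: "open ?P" using S(1) by (simp add: open_Times)
  have th: "thick ?P" "thick S" using P S(1) by (auto intro: open_thick)
  have w: "smooth_on ?P (\<lambda>z. snd z \<bullet> b)" for b
    by (intro smooth_on_inner_left smooth_on_snd smooth_on_ident th)
  have Zs: "smooth_on ?P (\<lambda>z. Z i (fst z))" if "i < k" for i using smooth_on_prod[OF Z_smooth[OF that]] .
  have fr: "smooth_on ?P (\<lambda>z. frame (fst z) (snd z))" unfolding frame_def
    by (intro smooth_on_sum smooth_on_scaleR th w Zs) auto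
  have DZ: "smooth_on ?P (\<lambda>z. frechet_derivative (Z i) (at (fst z)) (u z))"
    if i: "i < k" and u: "smooth_on ?P u" for i u
  proof (rule smooth_on_linear_apply[OF th(1) _ _ u])
    show "linear (frechet_derivative (Z i) (at (fst z)))" if "z \<in> ?P" for z
      using that by (intro has_derivative_linear[OF Z_has_derivative[OF i]]) auto
    show "smooth_on ?P (\<lambda>z. frechet_derivative (Z i) (at (fst z)) b)" for b
      by (rule smooth_on_prod[OF smooth_on_frechet_derivative[OF Z_smooth[OF i] S(1)]])
  qed
  have dfr: "smooth_on ?P (\<lambda>z. dframe (fst z) (snd z) (frame (fst z) (snd z)))" unfolding dframe_def
    by (intro smooth_on_sum smooth_on_scaleR th w DZ fr) auto
  have m: "smooth_on S (\<lambda>x. mc c x u v)" for u v by (rule smooth_on_subset[OF mc_smooth[OF cA] S(2) th(2)])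
  have M: "smooth_on ?P (\<lambda>z. mc c (fst z) (u z) (v z))" if "smooth_on ?P u" "smooth_on ?P v" for u v
  proof (rule smooth_on_bilinear_form[OF th(1) _ _ _ that])
    fix z assume "z \<in> ?P"
    then have z: "fst z \<in> snd c ` fst c" using in_chart by auto
    show "linear (mc c (fst z) u)" "linear (\<lambda>u. mc c (fst z) u v)" for u v
      using mc_bilinear[OF cA z] by blast+
  qed (rule smooth_on_prod[OF m])
  have dm: "smooth_on S (\<lambda>x. dmc c x u v w)" for u v w
    unfolding dmc_def by (rule smooth_on_frechet_derivative[OF m S(1)])
  have DM: "smooth_on ?P (\<lambda>z. dmc c (fst z) (u z) (v z) (w z))"
    if u: "smooth_on ?P u" and v: "smooth_on ?P v" and w: "smooth_on ?P w" for u v w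
  proof -
    have lin: "linear (\<lambda>u. dmc c (fst z) u v w)" "linear (\<lambda>v. dmc c (fst z) u v w)" "linear (dmc c (fst z) u v)"
      if "z \<in> ?P" for z u v w
    proof -
      have z: "fst z \<in> snd c ` fst c" using that in_chart by auto
      show "linear (\<lambda>u. dmc c (fst z) u v w)" "linear (\<lambda>v. dmc c (fst z) u v w)"
        using dmc_linear[OF cA z] by blast+
      have "dmc c (fst z) u v = (\<lambda>w. dmc c (fst z) u w v)" by (rule ext) (rule dmc_linear(3)[OF cA z])
      then show "linear (dmc c (fst z) u v)" using dmc_linear(2)[OF cA z] by simp
    qed
    have 1: "smooth_on ?P (\<lambda>z. dmc c (fst z) (u z) b b')" for b b'
      by (rule smooth_on_linear_apply[where M="\<lambda>z u. dmc c (fst z) u b b'", OF th(1) lin(1) smooth_on_prod[OF dm] u])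
    have 2: "smooth_on ?P (\<lambda>z. dmc c (fst z) (u z) (v z) b')" for b'
      by (rule smooth_on_linear_apply[where M="\<lambda>z v. dmc c (fst z) (u z) v b'", OF th(1) lin(2) 1 v])
    show ?thesis
      by (rule smooth_on_linear_apply[where M="\<lambda>z. dmc c (fst z) (u z) (v z)", OF th(1) lin(3) 2 w])
  qed
  have "smooth_on ?P (\<lambda>z. force i (fst z) (snd z))" if i: "i < k" for i
  proof -
    have "smooth_on ?P (\<lambda>z. dmc c (fst z) (Z i (fst z)) (frame (fst z) (snd z)) (frame (fst z) (snd z)) * (1/2))"
      by (intro smooth_on_mult smooth_on_const DM fr Zs i th)
    then show ?thesis unfolding force_def
      by (intro smooth_on_minus smooth_on_add smooth_on_diff M DM dfr fr Zs i th) simp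
  qed
  then show ?thesis unfolding geodesic_field_def
    by (intro smooth_on_Pair smooth_on_sum smooth_on_scaleR smooth_on_const fr th) auto
qed

text \<open>Testing with \<open>Z\<^sub>i\<close> suffices, and there \<open>force i\<close> was chosen to cancel the two other terms.\<close>

lemma geodesic_equation:
  assumes x: "x \<in> S" and z: "z \<in> span ((\<lambda>i. Z i x) ` {..<k})"
  shows "mc c x (dframe x u (frame x u) + frame x (\<Sum>i<k. force i x u *\<^sub>R \<beta> i)
      + levi_civita A g c x (frame x u) (frame x u)) z = 0"
proof -
  note x' = in_chart[OF x]
  note addl = linear_add[OF mc_bilinear(3)[OF cA x']]
  let ?a = "dframe x u (frame x u) + frame x (\<Sum>i<k. force i x u *\<^sub>R \<beta> i)
      + levi_civita A g c x (frame x u) (frame x u)"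
  have "subspace {z. mc c x ?a z = 0}"
    using linear_0[OF mc_bilinear(2)[OF cA x']] linear_add[OF mc_bilinear(2)[OF cA x']]
      linear_cmul[OF mc_bilinear(2)[OF cA x']] by (simp add: subspace_def)
  moreover have "mc c x ?a (Z i x) = 0" if i: "i < k" for i
  proof -
    have "frame x (\<Sum>i<k. force i x u *\<^sub>R \<beta> i) = (\<Sum>j<k. force j x u *\<^sub>R Z j x)"
      by (simp add: linear_sum[OF frame_linear] linear_cmul[OF frame_linear] frame_basis)
    then have "mc c x (frame x (\<Sum>i<k. force i x u *\<^sub>R \<beta> i)) (Z i x) = (\<Sum>j<k. force j x u * mc c x (Z j x) (Z i x))"
      by (simp add: linear_sum[OF mc_bilinear(3)[OF cA x']] linear_cmul[OF mc_bilinear(3)[OF cA x']])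
    also have "\<dots> = (\<Sum>j<k. if j = i then force j x u else 0)"
      using Z_orth[OF x _ i] by (intro sum.cong) auto
    also have "\<dots> = force i x u" using i by simp
    finally show ?thesis using levi_civita(2)[OF cA x', of "frame x u" "frame x u" "Z i x"]
      by (simp add: addl force_def)
  qed
  ultimately show ?thesis using span_minimal[of "(\<lambda>i. Z i x) ` {..<k}" "{z. mc c x ?a z = 0}"] z by blast
qed

lemma horizontal_proj_eq_0:
  assumes x: "x \<in> S" and p: "p = chart_inv c x" and v: "\<And>z. z \<in> \<Sigma> p \<Longrightarrow> g p v z = 0"
  shows "horizontal_proj g \<Sigma> p v = 0"
  unfolding horizontal_proj_def
proof (rule the_equality)
  have pc: "p \<in> fst c" using chart(7)[OF cA in_chart[OF x]] by (simp add: p)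
  have "0 \<in> to_coord A c p ` \<Sigma> p" using Z_span[OF x] span_zero by (simp add: p)
  then obtain z where "z \<in> \<Sigma> p" "to_coord A c p z = 0" by auto
  then have "0 \<in> \<Sigma> p" using of_to_coord[OF cA pc, of z] linear_0[OF of_coord_linear[OF cA pc]] by simp
  then show "0 \<in> \<Sigma> p \<and> (\<forall>z\<in>\<Sigma> p. g p (v - 0) z = 0)" using v by simp
  fix w assume w: "w \<in> \<Sigma> p \<and> (\<forall>z\<in>\<Sigma> p. g p (v - w) z = 0)"
  have lin: "linear (\<lambda>u. g p u w)" using metric(1) by (simp add: bilinear_def)
  have "g p w w = g p v w - g p (v - w) w" by (simp add: linear_diff[OF lin])
  then have "g p w w = 0" using v w by simp
  then show "w = 0" using metric(3)[of w p] by force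
qed

text \<open>The definition of a geodesic refers at time \<open>t\<close> to the chart \<open>d\<close> chosen at \<open>\<gamma> t\<close>, while the equation is solved
  in the chart \<open>c\<close>.  The covariant derivative is therefore computed in \<open>d\<close> from the derivative of \<open>J(x) v\<close> with the Jacobian
  \<open>J\<close> of the coordinate change, and \<open>acceleration_covariant\<close> leads back to \<open>c\<close>.\<close>

lemma geodesic_solution:
  assumes T: "T > 0"
    and y: "\<And>t. t \<in> {-T..T} \<Longrightarrow> (y has_vector_derivative geodesic_field (y t)) (at t within {-T..T})"
    and yS: "\<And>t. t \<in> {-T..T} \<Longrightarrow> fst (y t) \<in> S"
  shows "nonholonomic_geodesic A g \<Sigma> {-T..T} (\<lambda>t. chart_inv c (fst (y t)))"
proof -
  define J where "J = {-T..T}"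
  define x where "x t = fst (y t)" for t
  define u where "u t = snd (y t)" for t
  define \<gamma> where "\<gamma> t = chart_inv c (x t)" for t
  define v where "v t = frame (x t) (u t)" for t
  define u' where "u' t = (\<Sum>i<k. force i (x t) (u t) *\<^sub>R \<beta> i)" for t
  have thJ: "thick J" using T by (auto simp: J_def intro!: thick_interval is_interval_cc)
  have xS: "x t \<in> S" if "t \<in> J" for t using yS that by (simp add: x_def J_def)
  have y': "(y has_vector_derivative (v t, u' t)) (at t within J)" if "t \<in> J" for t
    using y[of t] that by (simp add: J_def v_def u'_def x_def u_def geodesic_field_def)
  have dx: "(x has_vector_derivative v t) (at t within J)" if "t \<in> J" for t
    using bounded_linear.has_vector_derivative[OF bounded_linear_fst y'[OF that]] by (simp add: x_def[abs_def])
  have du: "(u has_vector_derivative u' t) (at t within J)" if "t \<in> J" for t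
    using bounded_linear.has_vector_derivative[OF bounded_linear_snd y'[OF that]] by (simp add: u_def[abs_def])
  have "y ` J \<subseteq> S \<times> UNIV"
  proof
    fix z assume "z \<in> y ` J"
    then obtain t where "t \<in> J" "z = y t" by blast
    then show "z \<in> S \<times> UNIV" using xS[of t] by (simp add: x_def mem_Times_iff)
  qed
  then have "smooth_on J y"
    by (rule solution_smooth[OF geodesic_field_smooth thJ]) (use y in \<open>simp add: J_def\<close>)
  then have smx: "smooth_on J x" using smooth_on_fst[OF thJ] by (simp add: x_def[abs_def])
  have \<gamma>c: "\<gamma> t \<in> fst c" "snd c (\<gamma> t) = x t" if "t \<in> J" for t
    using chart[OF cA] in_chart[OF xS[OF that]] by (auto simp: \<gamma>_def)
  have overlap: "x t \<in> snd c ` (fst c \<inter> fst d)" if "t \<in> J" "\<gamma> t \<in> fst d" for t d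
    by (rule image_eqI[of _ _ "\<gamma> t"]) (use \<gamma>c[OF that(1)] that(2) in auto)
  have cont: "continuous_on J \<gamma>"
    unfolding \<gamma>_def
    by (rule continuous_on_compose2[OF chart(4)[OF cA] smooth_on_imp_continuous_on[OF smx]])
       (use xS in_chart in auto)
  have dcg: "((snd c \<circ> \<gamma>) has_vector_derivative v t) (at t within J)" if "t \<in> J" for t
    by (rule has_vector_derivative_transform[OF that _ dx[OF that]]) (simp add: \<gamma>c)
  have vel: "velocity A J \<gamma> t = of_coord A c (\<gamma> t) (v t)" "to_coord A c (\<gamma> t) (velocity A J \<gamma> t) = v t"
    if "t \<in> J" for t
    using velocity_eq[OF cont that thJ cA \<gamma>c(1)[OF that] dcg[OF that]] by auto
  have "smooth_curve A J \<gamma>"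
    unfolding smooth_curve_def
  proof (intro conjI ballI)
    show "is_interval J" "interior J \<noteq> {}" using T by (auto simp: J_def is_interval_cc)
    fix d assume d: "d \<in> A"
    have "openin (top_of_set J) (J \<inter> \<gamma> -` fst d)"
      by (rule continuous_openin_preimage_gen[OF cont chart(1)[OF d]])
    then have thK: "thick (J \<inter> \<gamma> -` fst d)" by (rule thick_openin[OF thJ])
    have "x ` (J \<inter> \<gamma> -` fst d) \<subseteq> snd c ` (fst c \<inter> fst d)" using overlap by blast
    from smooth_on_compose[OF thK coord_change_smooth[OF cA d] smooth_on_subset[OF smx _ thK] this]
    show "smooth_on (J \<inter> \<gamma> -` fst d) (snd d \<circ> \<gamma>)"
      by (simp add: coord_change_def \<gamma>_def[abs_def] comp_def)
  qed (rule cont)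
  moreover have "velocity A J \<gamma> t \<in> \<Sigma> (\<gamma> t)" if "t \<in> J" for t
  proof -
    have "v t \<in> to_coord A c (\<gamma> t) ` \<Sigma> (\<gamma> t)"
      using Z_span[OF xS[OF that]] frame_in_span by (simp add: \<gamma>_def v_def)
    then obtain z where "z \<in> \<Sigma> (\<gamma> t)" "v t = to_coord A c (\<gamma> t) z" by auto
    then show ?thesis using vel(1)[OF that] of_to_coord[OF cA \<gamma>c(1)[OF that]] by simp
  qed
  moreover have "horizontal_deriv_along A g \<Sigma> J \<gamma> (velocity A J \<gamma>) t = 0" if t: "t \<in> J" for t
    unfolding horizontal_deriv_along_def
  proof (rule horizontal_proj_eq_0[OF xS[OF t]])
    show "\<gamma> t = chart_inv c (x t)" by (simp add: \<gamma>_def)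
    fix z assume z: "z \<in> \<Sigma> (\<gamma> t)"
    define d where "d = chart_at A (\<gamma> t)"
    have d: "d \<in> A" "\<gamma> t \<in> fst d" using chart_at by (auto simp: d_def)
    define K where "K = J \<inter> \<gamma> -` fst d"
    have tK: "t \<in> K" using t d by (simp add: K_def)
    have atK: "at t within K = at t within J"
      unfolding K_def by (rule at_within_preimage[OF cont t chart(1)[OF d(1)] d(2)])
    let ?D = "\<lambda>q a. frechet_derivative (coord_change c d) (at q) a"
    let ?D2 = "\<lambda>a h. frechet_derivative (\<lambda>q. frechet_derivative (coord_change c d) (at q) a) (at (x t)) h"
    have jac: "jacobian c d (\<gamma> s) = ?D (x s)" if "s \<in> J" for s using \<gamma>c(2)[OF that] by (simp add: jacobian_def)
    have xin: "x t \<in> snd c ` (fst c \<inter> fst d)" by (rule overlap[OF t d(2)])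
    have linD: "linear (?D (x s))" if "s \<in> K" for s
      using linear_jacobian[OF cA d(1), of "\<gamma> s"] that \<gamma>c(1)[of s] jac[of s] by (auto simp: K_def)
    have sym: "?D2 a b = ?D2 b a" for a b using second_jacobian(2)[OF cA d(1) xin] .
    have linD2': "linear (?D2 a)" for a
      using has_derivative_linear[OF second_jacobian(1)[OF cA d(1) xin]] .
    have linD2: "linear (\<lambda>a. ?D2 a h)" for h
    proof -
      have "(\<lambda>a. ?D2 a h) = ?D2 h" by (rule ext) (rule sym)
      then show ?thesis using linD2'[of h] by (simp only:)
    qed
    have dxK: "(x has_derivative (\<lambda>h. h *\<^sub>R v t)) (at t within K)"
      and duK: "(u has_derivative (\<lambda>h. h *\<^sub>R u' t)) (at t within K)"
      unfolding atK using dx[OF t] du[OF t] by (simp_all add: has_vector_derivative_def)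
    have dfl: "linear (\<lambda>h. dframe (x t) w h)" for w
      using has_derivative_linear[OF frame_has_derivative[OF xS[OF t]]] .
    have dv: "(v has_derivative (\<lambda>h. dframe (x t) (u t) (h *\<^sub>R v t) + frame (x t) (h *\<^sub>R u' t))) (at t within K)"
      unfolding v_def
    proof (rule has_derivative_linear_apply[where M="\<lambda>s. frame (x s)", OF tK frame_linear dframe_linear _ duK])
      show "((\<lambda>s. frame (x s) w) has_derivative (\<lambda>h. dframe (x t) w (h *\<^sub>R frame (x t) (u t)))) (at t within K)" for w
        using has_derivative_compose[OF dxK frame_has_derivative[OF xS[OF t]]] by (simp add: v_def)
    qed
    have "((\<lambda>s. ?D (x s) (v s)) has_derivative
        (\<lambda>h. ?D2 (v t) (h *\<^sub>R v t) + ?D (x t) (dframe (x t) (u t) (h *\<^sub>R v t) + frame (x t) (h *\<^sub>R u' t)))) (at t within K)"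
      by (rule has_derivative_linear_apply[where M="\<lambda>s. ?D (x s)" and N="\<lambda>a h. ?D2 a (h *\<^sub>R v t)",
            OF tK linD linD2 has_derivative_compose[OF dxK second_jacobian(1)[OF cA d(1) xin]] dv])
    moreover define a where "a = dframe (x t) (u t) (v t) + frame (x t) (u' t)"
    ultimately have "((\<lambda>s. ?D (x s) (v s)) has_vector_derivative ?D2 (v t) (v t) + ?D (x t) a) (at t within K)"
      by (simp add: has_vector_derivative_def linear_cmul[OF linD2'] linear_cmul[OF dfl] linear_cmul[OF frame_linear]
          linear_cmul[OF linD[OF tK]] flip: scaleR_add_right)
    then have "((\<lambda>s. to_coord A d (\<gamma> s) (velocity A J \<gamma> s)) has_vector_derivative ?D2 (v t) (v t) + ?D (x t) a) (at t within K)"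
    proof (rule has_vector_derivative_transform[OF tK, rotated])
      fix s assume "s \<in> K"
      then have s: "s \<in> J" "\<gamma> s \<in> fst d" by (auto simp: K_def)
      show "to_coord A d (\<gamma> s) (velocity A J \<gamma> s) = ?D (x s) (v s)"
        using jacobian_to_coord[OF cA d(1) \<gamma>c(1)[OF s(1)] s(2), of "velocity A J \<gamma> s"] vel(2)[OF s(1)] jac[OF s(1)]
        by simp
    qed
    then have "vector_derivative (\<lambda>s. to_coord A d (\<gamma> s) (velocity A J \<gamma> s)) (at t within J) = ?D2 (v t) (v t) + ?D (x t) a"
      unfolding atK by (rule vector_derivative_thick[OF thJ t])
    moreover have velJ: "velocity A J \<gamma> t = ?D (x t) (v t)"
      using vel(1)[OF t] jac[OF t] by (simp add: of_coord_jacobian d_def)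
    ultimately have cov: "cov_deriv_along A g J \<gamma> (velocity A J \<gamma>) t = ?D2 (v t) (v t) + ?D (x t) a
        + levi_civita A g d (snd d (\<gamma> t)) (?D (x t) (v t)) (?D (x t) (v t))"
      by (simp add: cov_deriv_along_def Let_def flip: d_def)
    let ?w = "to_coord A c (\<gamma> t) z"
    have zJ: "z = ?D (x t) ?w"
      using jacobian_to_coord[OF cA d(1) \<gamma>c(1)[OF t] d(2), of z] to_coord_chart_at[of "\<gamma> t" z] jac[OF t]
      by (simp add: d_def)
    have wsp: "?w \<in> span ((\<lambda>i. Z i (x t)) ` {..<k})"
      using Z_span[OF xS[OF t]] z by (auto simp: \<gamma>_def)
    have gmc: "g (\<gamma> t) e e' = mc d (snd d (\<gamma> t)) e e'" for e e'
      using mc_apply[OF d, of e e'] of_coord_chart_at[of "\<gamma> t"] by (simp add: d_def)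
    have "g (\<gamma> t) (cov_deriv_along A g J \<gamma> (velocity A J \<gamma>) t) (?D (x t) ?w)
        = mc c (x t) (a + levi_civita A g c (x t) (v t) (v t)) ?w"
      using acceleration_covariant[OF cA d(1) \<gamma>c(1)[OF t] d(2), of "v t" a ?w]
      by (simp only: gmc cov \<gamma>c(2)[OF t] jac[OF t])
    also have "\<dots> = 0"
      using geodesic_equation[OF xS[OF t] wsp, of "u t"] by (simp add: a_def v_def u'_def)
    finally show "g (\<gamma> t) (cov_deriv_along A g J \<gamma> (velocity A J \<gamma>) t) z = 0" using zJ by simp
  qed
  ultimately show ?thesis unfolding nonholonomic_geodesic_def by (simp add: J_def \<gamma>_def[abs_def] x_def)
qed

end

section \<open>Convexity along geodesics\<close>

text \<open>Let \<open>s = t / T\<close>.  Concavity of \<open>K - q\<close> between \<open>0\<close> and \<open>T\<close>, respectively between \<open>-T\<close> and \<open>t\<close>, and positivity at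
  the outer points give \<open>(1 - s) (K - q 0) \<le> K - q t \<le> (1 + s) (K - q 0)\<close>.\<close>

lemma convex_log_bound_nonneg:
  fixes q :: "real \<Rightarrow> real"
  assumes q: "convex_on {-T..T} q" and K: "\<And>t. t \<in> {-T..T} \<Longrightarrow> q t < K" and T: "T > 0"
    and t: "0 \<le> t" "t \<le> T / 2"
  shows "\<bar>ln (K - q t) - ln (K - q 0)\<bar> \<le> 2 / T * t"
proof -
  have pos: "K - q t > 0" "K - q 0 > 0" "K - q T > 0" "K - q (-T) > 0"
    using K[of t] K[of 0] K[of T] K[of "-T"] T t by auto
  define s where "s = t / T"
  have s: "0 \<le> s" "s \<le> 1/2" "t = s * T" using T t by (auto simp: s_def field_simps)
  have "q ((1 - s) *\<^sub>R 0 + s *\<^sub>R T) \<le> (1 - s) * q 0 + s * q T"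
    using T s by (intro convex_onD[OF q]) auto
  then have "(1 - s) * (K - q 0) + s * (K - q T) \<le> K - q t" by (simp add: s(3) algebra_simps)
  then have low: "(1 - s) * (K - q 0) \<le> K - q t" using mult_nonneg_nonneg[OF s(1), of "K - q T"] pos by linarith
  define r where "r = s / (1 + s)"
  have r: "0 \<le> r" "r \<le> 1" "1 - r = 1 / (1 + s)" using s by (auto simp: r_def field_simps)
  have "q ((1 - r) *\<^sub>R t + r *\<^sub>R (-T)) \<le> (1 - r) * q t + r * q (-T)"
    using T t r by (intro convex_onD[OF q]) auto
  moreover have "(1 - r) *\<^sub>R t + r *\<^sub>R (-T) = 0"
    using s(1) unfolding r(3) by (simp add: r_def s(3) field_simps)
  ultimately have "(1 - r) * (K - q t) + r * (K - q (-T)) \<le> K - q 0" by (simp add: algebra_simps)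
  then have "(1 - r) * (K - q t) \<le> K - q 0" using mult_nonneg_nonneg[OF r(1), of "K - q (-T)"] pos by linarith
  then have up: "K - q t \<le> (1 + s) * (K - q 0)" using s(1) by (simp add: r(3) field_simps)
  have "ln (K - q t) \<le> ln ((1 + s) * (K - q 0))" using up pos s by (subst ln_le_cancel_iff) auto
  also have "\<dots> = ln (1 + s) + ln (K - q 0)" using s pos by (intro ln_mult_pos) auto
  also have "\<dots> \<le> s + ln (K - q 0)" using ln_add_one_self_le_self[OF s(1)] by simp
  finally have 1: "ln (K - q t) - ln (K - q 0) \<le> s" by simp
  have "ln ((1 - s) * (K - q 0)) \<le> ln (K - q t)" using low pos s by (subst ln_le_cancel_iff) auto
  moreover have "ln ((1 - s) * (K - q 0)) = ln (1 - s) + ln (K - q 0)" using s pos by (intro ln_mult_pos) auto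
  moreover have "- s - 2 * s\<^sup>2 \<le> ln (1 - s)" using ln_one_minus_pos_lower_bound[OF s(1,2)] .
  moreover have "2 * s\<^sup>2 \<le> s" using s mult_left_mono[of s "1/2" s] by (simp add: power2_eq_square)
  ultimately have 2: "- (2 * s) \<le> ln (K - q t) - ln (K - q 0)" by linarith
  have "2 / T * t = 2 * s" by (simp add: s_def)
  then show ?thesis using 1 2 s(1) by linarith
qed

lemma convex_log_bound:
  fixes q :: "real \<Rightarrow> real"
  assumes q: "convex_on {-T..T} q" and K: "\<And>t. t \<in> {-T..T} \<Longrightarrow> q t < K" and T: "T > 0"
    and t: "\<bar>t\<bar> \<le> T / 2"
  shows "\<bar>ln (K - q t) - ln (K - q 0)\<bar> \<le> 2 / T * \<bar>t\<bar>"
proof (cases "t \<ge> 0")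
  case True
  then show ?thesis using convex_log_bound_nonneg[OF q K T, of t] t by simp
next
  case False
  have q': "convex_on {-T..T} (\<lambda>t. q (- t))"
  proof (rule convex_onI)
    fix s x y :: real assume "0 < s" "s < 1" "x \<in> {-T..T}" "y \<in> {-T..T}"
    then show "q (- ((1 - s) *\<^sub>R x + s *\<^sub>R y)) \<le> (1 - s) * q (- x) + s * q (- y)"
      using convex_onD[OF q, of s "-x" "-y"] by (auto simp: algebra_simps)
  qed simp
  have "\<bar>ln (K - q (- (- t))) - ln (K - q (- 0))\<bar> \<le> 2 / T * (- t)"
    by (rule convex_log_bound_nonneg[OF q' _ T]) (use K t False in auto)
  then show ?thesis using False by simp
qed

section \<open>Continuity of a convex function\<close>

text \<open>The radius \<open>R\<close> refers to the product of positions and coefficients.  Points within \<open>R / 4\<close> of the centre and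
  coefficient vectors of length at most \<open>\<rho> = R / 8\<close>, as introduced below, are admissible initial data for all times in \<open>[-T, T]\<close>.\<close>

locale convex_chart = framed_chart A g \<Sigma> k c S Z \<beta>
  for A :: "('m::{t2_space,second_countable_topology}, 'e::euclidean_space) chart set"
    and g \<Sigma> k c S Z \<beta> +
  fixes \<Omega> :: "'m set" and f :: "'m \<Rightarrow> real" and K :: real and a :: 'e and R M L C T :: real
  assumes convex: "n_convex_fun A g \<Sigma> \<Omega> f"
    and in_\<Omega>: "\<And>x. x \<in> S \<Longrightarrow> chart_inv c x \<in> \<Omega>"
    and below_K: "\<And>x. x \<in> S \<Longrightarrow> f (chart_inv c x) < K"
    and ball_S: "cball (a, 0 :: 'e) R \<subseteq> S \<times> UNIV"
    and flow_data: "local_flow geodesic_field (\<lambda>z. Blinfun (frechet_derivative geodesic_field (at z))) (a, 0) R M L C T"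
begin

sublocale lf: local_flow geodesic_field "\<lambda>z. Blinfun (frechet_derivative geodesic_field (at z))" "(a, 0)" R M L C T
  by (rule flow_data)

definition \<phi> :: "'e \<Rightarrow> real" where
  "\<phi> x = ln (K - f (chart_inv c x))"

definition \<rho> :: real where
  "\<rho> = R / 8"

text \<open>The initial coefficients are scaled down by \<open>\<rho>\<close>, and the time is scaled up to make \<open>t\<close> the length of the step for a
  unit vector \<open>w\<close>.\<close>

definition step :: "'e \<Rightarrow> real \<Rightarrow> 'e \<Rightarrow> 'e" where
  "step w t y = fst (lf.flow (y, \<rho> *\<^sub>R w) (t / \<rho>))"

abbreviation "W \<equiv> ball a (R/4)"

lemma \<rho>_pos: "\<rho> > 0" using lf.pos by (simp add: \<rho>_def)

lemma start_in:
  fixes w :: 'e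
  assumes "y \<in> W" "norm w \<le> 1"
  shows "(y, \<rho> *\<^sub>R w) \<in> ball (a, 0) (R/2)" "(y, \<rho> *\<^sub>R w) \<in> cball (a, 0) (R/2)"
proof -
  have "dist (a, 0) (y, \<rho> *\<^sub>R w) \<le> dist a y + dist 0 (\<rho> *\<^sub>R w)"
    unfolding dist_Pair_Pair using sqrt_sum_squares_le_sum by auto
  moreover have "dist 0 (\<rho> *\<^sub>R w) \<le> \<rho>" using assms(2) \<rho>_pos by (simp add: mult_left_le)
  ultimately have "dist (a, 0) (y, \<rho> *\<^sub>R w) \<le> dist a y + R / 8" unfolding \<rho>_def by linarith
  also have "\<dots> < R / 2" using assms(1) lf.pos by simp
  finally show "(y, \<rho> *\<^sub>R w) \<in> ball (a, 0) (R/2)" by simp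
  then show "(y, \<rho> *\<^sub>R w) \<in> cball (a, 0) (R/2)" by simp
qed

lemma W_sub: "W \<subseteq> S"
proof
  fix y assume "y \<in> W"
  then have "(y, 0 :: 'e) \<in> cball (a, 0) R" using start_in(2)[of y 0] lf.pos by (auto simp: dist_Pair_Pair)
  then show "y \<in> S" using ball_S by auto
qed

lemma flow_in_S: "z \<in> cball (a, 0) (R/2) \<Longrightarrow> t \<in> {-T..T} \<Longrightarrow> fst (lf.flow z t) \<in> S"
proof -
  assume "z \<in> cball (a, 0) (R/2)" "t \<in> {-T..T}"
  then have "lf.flow z t \<in> S \<times> UNIV" using lf.flow(2)[of z t] ball_S by blast
  then show ?thesis by (simp add: mem_Times_iff)
qed

lemma slow_along_geodesic:
  assumes z: "z \<in> cball (a, 0) (R/2)" and t: "\<bar>t\<bar> \<le> T / 2"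
  shows "\<bar>\<phi> (fst (lf.flow z t)) - \<phi> (fst z)\<bar> \<le> 2 / T * \<bar>t\<bar>"
proof -
  let ?\<gamma> = "\<lambda>t. chart_inv c (fst (lf.flow z t))"
  have "nonholonomic_geodesic A g \<Sigma> {-T..T} ?\<gamma>"
    by (rule geodesic_solution[OF lf.pos(2) lf.flow(3)[OF z] flow_in_S[OF z]])
  moreover have "?\<gamma> ` {-T..T} \<subseteq> \<Omega>" using in_\<Omega> flow_in_S[OF z] by auto
  ultimately have "convex_on {-T..T} (f \<circ> ?\<gamma>)" using convex unfolding n_convex_fun_def by blast
  then have "\<bar>ln (K - (f \<circ> ?\<gamma>) t) - ln (K - (f \<circ> ?\<gamma>) 0)\<bar> \<le> 2 / T * \<bar>t\<bar>"
    by (rule convex_log_bound) (use below_K flow_in_S[OF z] lf.pos t in auto)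
  then show ?thesis using lf.flow(1)[OF z] by (simp add: \<phi>_def)
qed

lemma slow_step:
  assumes "y \<in> W" "norm w \<le> 1" "\<bar>t\<bar> \<le> \<rho> * T / 2"
  shows "\<bar>\<phi> (step w t y) - \<phi> y\<bar> \<le> 2 / (T * \<rho>) * \<bar>t\<bar>"
proof -
  have "\<bar>t / \<rho>\<bar> \<le> T / 2" using assms(3) \<rho>_pos by (simp add: field_simps)
  then show ?thesis
    using slow_along_geodesic[OF start_in(2)[OF assms(1,2)], of "t / \<rho>"] \<rho>_pos by (simp add: step_def)
qed

lemma scaled_time: "\<bar>t\<bar> \<le> \<rho> * T / 2 \<Longrightarrow> \<bar>t / \<rho>\<bar> \<le> T"
proof -
  assume "\<bar>t\<bar> \<le> \<rho> * T / 2"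
  then have "\<bar>t / \<rho>\<bar> \<le> T / 2" using \<rho>_pos by (simp add: field_simps)
  then show ?thesis using lf.pos by linarith
qed

lemma step_first_order:
  assumes "y \<in> W" "norm w \<le> 1" "\<bar>t\<bar> \<le> \<rho> * T / 2"
  shows "norm (step w t y - y - t *\<^sub>R frame y w) \<le> L * M / \<rho>\<^sup>2 * t\<^sup>2"
proof -
  let ?z = "(y, \<rho> *\<^sub>R w)"
  have "step w t y - y - t *\<^sub>R frame y w = fst (lf.flow ?z (t/\<rho>) - ?z - (t/\<rho>) *\<^sub>R geodesic_field ?z)"
    using \<rho>_pos by (simp add: step_def geodesic_field_def linear_cmul[OF frame_linear])
  also have "norm \<dots> \<le> norm (lf.flow ?z (t/\<rho>) - ?z - (t/\<rho>) *\<^sub>R geodesic_field ?z)" by (rule norm_fst_le[of "fst z" "snd z" for z, simplified])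
  also have "\<dots> \<le> L * M * (t/\<rho>)\<^sup>2"
    by (rule lf.flow_first_order[OF start_in(2)[OF assms(1,2)] scaled_time[OF assms(3)]])
  finally show ?thesis by (simp add: power_divide)
qed

lemma step_has_derivative:
  assumes y: "y \<in> W" and i: "i < k" and t: "\<bar>t\<bar> \<le> \<rho> * T / 2"
  shows "\<exists>N. (step (\<beta> i) t has_derivative N) (at y) \<and>
    (\<forall>h. norm (N h - h - t *\<^sub>R frechet_derivative (Z i) (at y) h) \<le> (2 * L\<^sup>2 + \<bar>C\<bar> * M) / \<rho>\<^sup>2 * t\<^sup>2 * norm h)"
proof -
  have n1: "norm (\<beta> i) \<le> 1" using \<beta>(1)[OF i] by simp
  let ?w = "\<rho> *\<^sub>R \<beta> i"
  let ?z = "(y, ?w)" and ?D = "frechet_derivative geodesic_field (at (y, \<rho> *\<^sub>R \<beta> i))"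
  obtain \<Phi> :: "('e \<times> 'e) \<Rightarrow>\<^sub>L ('e \<times> 'e)"
    where \<Phi>: "((\<lambda>q. lf.flow q (t/\<rho>)) has_derivative blinfun_apply \<Phi>) (at ?z)"
      "norm (\<Phi> - id_blinfun - (t/\<rho>) *\<^sub>R Blinfun ?D) \<le> (2 * L\<^sup>2 + \<bar>C\<bar> * M) * (t/\<rho>)\<^sup>2"
    using lf.flow_differentiable[OF start_in(1)[OF y n1] scaled_time[OF t]] by blast
  have yS: "y \<in> S" using W_sub y by blast
  have dpair: "((\<lambda>x. (x, ?w)) has_derivative (\<lambda>h. (h, 0))) (at y)"
    by (intro has_derivative_Pair has_derivative_ident has_derivative_const)
  have "open (S \<times> (UNIV :: 'e set))" using S(1) by (simp add: open_Times)
  then have dF: "(geodesic_field has_derivative ?D) (at ?z)"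
    using smooth_on_has_derivative[OF geodesic_field_smooth] yS by blast
  have Bl: "blinfun_apply (Blinfun ?D) = ?D"
    by (rule bounded_linear_Blinfun_apply[OF has_derivative_bounded_linear[OF dF]])
  have "((\<lambda>x. fst (geodesic_field (x, ?w))) has_derivative (\<lambda>h. fst (?D (h, 0)))) (at y)"
    by (intro has_derivative_fst has_derivative_compose[OF dpair dF])
  moreover have "(\<lambda>x. fst (geodesic_field (x, ?w))) = (\<lambda>x. \<rho> *\<^sub>R Z i x)"
    by (simp add: geodesic_field_def linear_cmul[OF frame_linear] frame_basis[OF i])
  moreover have "((\<lambda>x. \<rho> *\<^sub>R Z i x) has_derivative (\<lambda>h. \<rho> *\<^sub>R frechet_derivative (Z i) (at y) h)) (at y)"
    by (intro has_derivative_scaleR_right Z_has_derivative i yS)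
  ultimately have eq: "fst (?D (h, 0)) = \<rho> *\<^sub>R frechet_derivative (Z i) (at y) h" for h
    using has_derivative_unique by metis
  define N where "N h = fst (blinfun_apply \<Phi> (h, 0))" for h
  have "(step (\<beta> i) t has_derivative N) (at y)"
    unfolding step_def N_def by (intro has_derivative_fst has_derivative_compose[OF dpair \<Phi>(1)])
  moreover have "norm (N h - h - t *\<^sub>R frechet_derivative (Z i) (at y) h) \<le> (2 * L\<^sup>2 + \<bar>C\<bar> * M) / \<rho>\<^sup>2 * t\<^sup>2 * norm h" for h
  proof -
    have "N h - h - t *\<^sub>R frechet_derivative (Z i) (at y) h
        = fst (blinfun_apply (\<Phi> - id_blinfun - (t/\<rho>) *\<^sub>R Blinfun ?D) (h, 0))"
      using \<rho>_pos by (simp add: N_def minus_blinfun.rep_eq scaleR_blinfun.rep_eq Bl eq)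
    also have "norm \<dots> \<le> norm (blinfun_apply (\<Phi> - id_blinfun - (t/\<rho>) *\<^sub>R Blinfun ?D) (h, 0))"
      by (rule norm_fst_le[of "fst z" "snd z" for z, simplified])
    also have "\<dots> \<le> norm (\<Phi> - id_blinfun - (t/\<rho>) *\<^sub>R Blinfun ?D) * norm (h, 0 :: 'e)" by (rule norm_blinfun)
    also have "\<dots> \<le> ((2 * L\<^sup>2 + \<bar>C\<bar> * M) * (t/\<rho>)\<^sup>2) * norm h"
      using \<Phi>(2) order_trans[OF norm_ge_zero \<Phi>(2)] by (intro mult_mono) auto
    finally show ?thesis by (simp add: power_divide)
  qed
  ultimately show ?thesis by blast
qed

lemma step_inj:
  assumes w: "norm w \<le> 1" and t: "\<bar>t\<bar> \<le> \<rho> * T / 2"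
  shows "inj_on (step w t) W"
proof (rule inj_onI)
  fix y y' assume y: "y \<in> W" "y' \<in> W" and eq: "step w t y = step w t y'"
  let ?z = "(y, \<rho> *\<^sub>R w)" and ?z' = "(y', \<rho> *\<^sub>R w)"
  have "norm ((lf.flow ?z (t/\<rho>) - ?z) - (lf.flow ?z' (t/\<rho>) - ?z')) \<le> 2 * L * \<bar>t/\<rho>\<bar> * norm (?z - ?z')"
    by (rule lf.flow_lipschitz(2)[OF start_in(2)[OF y(1) w] start_in(2)[OF y(2) w] scaled_time[OF t]])
  moreover have "2 * L * \<bar>t/\<rho>\<bar> \<le> 1/4"
    using lf.LT mult_left_mono[OF scaled_time[OF t], of "2 * L"] lf.const_nonneg by simp
  then have "2 * L * \<bar>t/\<rho>\<bar> * norm (?z - ?z') \<le> 1/4 * norm (?z - ?z')" by (rule mult_right_mono) simp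
  moreover have "norm (y - y') \<le> norm ((lf.flow ?z (t/\<rho>) - ?z) - (lf.flow ?z' (t/\<rho>) - ?z'))"
  proof -
    have "norm (fst ((lf.flow ?z (t/\<rho>) - ?z) - (lf.flow ?z' (t/\<rho>) - ?z')))
        \<le> norm ((lf.flow ?z (t/\<rho>) - ?z) - (lf.flow ?z' (t/\<rho>) - ?z'))"
      by (rule norm_fst_le[of "fst z" "snd z" for z, simplified])
    then show ?thesis using eq by (simp add: step_def norm_minus_commute)
  qed
  ultimately have "norm (y - y') \<le> 1/4 * norm (?z - ?z')" by linarith
  also have "norm (?z - ?z') = norm (y - y')" by (simp add: norm_Pair)
  finally show "y = y'" by simp
qed

sublocale steps: slow_steps \<phi> W "{..<k}" "\<lambda>i. step (\<beta> i)" Z "\<lambda>i y. frechet_derivative (Z i) (at y)"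
  "\<rho> * T / 2" "max (L * M / \<rho>\<^sup>2) ((2 * L\<^sup>2 + \<bar>C\<bar> * M) / \<rho>\<^sup>2)" "2 / (T * \<rho>)"
proof
  show "open W" by simp
  show "0 < \<rho> * T / 2" using \<rho>_pos lf.pos by simp
next
  fix i assume i: "i \<in> {..<k}"
  then have n1: "norm (\<beta> i) \<le> 1" using \<beta>(1) by simp
  let ?P = "\<lambda>z. ((snd z, \<rho> *\<^sub>R \<beta> i), fst z / \<rho>)"
  show "continuous_on ({- (\<rho> * T / 2)<..<\<rho> * T / 2} \<times> W) (\<lambda>z. step (\<beta> i) (fst z) (snd z))"
    unfolding step_def
  proof (rule continuous_on_fst, rule continuous_on_compose2[OF lf.continuous_on_flow, of _ ?P, simplified])
    show "continuous_on ({- (\<rho> * T / 2)<..<\<rho> * T / 2} \<times> W) ?P" using \<rho>_pos by (intro continuous_intros) auto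
    show "?P ` ({- (\<rho> * T / 2)<..<\<rho> * T / 2} \<times> W) \<subseteq> cball (a, 0) (R/2) \<times> {-T..T}"
    proof
      fix q assume "q \<in> ?P ` ({- (\<rho> * T / 2)<..<\<rho> * T / 2} \<times> W)"
      then obtain z where z: "z \<in> {- (\<rho> * T / 2)<..<\<rho> * T / 2} \<times> W" "q = ?P z" by blast
      define t y where "t = fst z" and "y = snd z"
      have q: "q = ((y, \<rho> *\<^sub>R \<beta> i), t / \<rho>)" "\<bar>t\<bar> \<le> \<rho> * T / 2" "y \<in> W"
        using z by (auto simp: t_def y_def mem_Times_iff)
      then show "q \<in> cball (a, 0) (R/2) \<times> {-T..T}"
      proof -
        have "t / \<rho> \<in> {-T..T}" using scaled_time[OF q(2)] unfolding atLeastAtMost_iff by linarith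
        then show ?thesis using start_in(2)[OF q(3) n1] q(1) by simp
      qed
    qed
  qed
  fix y assume y: "y \<in> W"
  then show "(Z i has_derivative frechet_derivative (Z i) (at y)) (at y)"
    using Z_has_derivative W_sub i by auto
next
  fix i and t :: real assume i: "i \<in> {..<k}" and "\<bar>t\<bar> < \<rho> * T / 2"
  then have t: "\<bar>t\<bar> \<le> \<rho> * T / 2" and n1: "norm (\<beta> i) \<le> 1" using \<beta>(1) by auto
  show "inj_on (step (\<beta> i) t) W" by (rule step_inj[OF n1 t])
  fix y assume y: "y \<in> W"
  show "\<bar>\<phi> (step (\<beta> i) t y) - \<phi> y\<bar> \<le> 2 / (T * \<rho>) * \<bar>t\<bar>" by (rule slow_step[OF y n1 t])
  have "norm (step (\<beta> i) t y - y - t *\<^sub>R Z i y) \<le> L * M / \<rho>\<^sup>2 * t\<^sup>2"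
    using step_first_order[OF y n1 t] frame_basis i by simp
  also have "\<dots> \<le> max (L * M / \<rho>\<^sup>2) ((2 * L\<^sup>2 + \<bar>C\<bar> * M) / \<rho>\<^sup>2) * t\<^sup>2" by (intro mult_right_mono) auto
  finally show "norm (step (\<beta> i) t y - y - t *\<^sub>R Z i y)
      \<le> max (L * M / \<rho>\<^sup>2) ((2 * L\<^sup>2 + \<bar>C\<bar> * M) / \<rho>\<^sup>2) * t\<^sup>2" .
  obtain N where N: "(step (\<beta> i) t has_derivative N) (at y)"
    "\<And>h. norm (N h - h - t *\<^sub>R frechet_derivative (Z i) (at y) h) \<le> (2 * L\<^sup>2 + \<bar>C\<bar> * M) / \<rho>\<^sup>2 * t\<^sup>2 * norm h"
    using step_has_derivative[OF y _ t] i by blast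
  have "(2 * L\<^sup>2 + \<bar>C\<bar> * M) / \<rho>\<^sup>2 * t\<^sup>2 * norm h
      \<le> max (L * M / \<rho>\<^sup>2) ((2 * L\<^sup>2 + \<bar>C\<bar> * M) / \<rho>\<^sup>2) * t\<^sup>2 * norm h" for h :: 'e
    by (intro mult_right_mono) auto
  then show "\<exists>N. (step (\<beta> i) t has_derivative N) (at y) \<and>
      (\<forall>h. norm (N h - h - t *\<^sub>R frechet_derivative (Z i) (at y) h)
        \<le> max (L * M / \<rho>\<^sup>2) ((2 * L\<^sup>2 + \<bar>C\<bar> * M) / \<rho>\<^sup>2) * t\<^sup>2 * norm h)"
    using N order_trans by blast
qed

lemma field_coord_frame:
  assumes X: "horizontal_field A \<Sigma> X" and x: "x \<in> S"
  shows "field_coord A c X x = (\<Sum>i<k. mc c x (field_coord A c X x) (Z i x) *\<^sub>R Z i x)"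
    (is "?X = _")
proof -
  have p: "chart_inv c x \<in> fst c" "snd c (chart_inv c x) = x" using chart[OF cA] in_chart[OF x] by auto
  have "X (chart_inv c x) \<in> \<Sigma> (chart_inv c x)" using X by (simp add: horizontal_field_def)
  then have "?X \<in> span ((\<lambda>i. Z i x) ` {..<k})"
    using field_coord_apply[OF cA p(1), of X] p Z_span[OF x] by auto
  then show ?thesis by (rule frame_expansion[OF x])
qed

text \<open>A horizontal field is \<open>X = \<Sum> h\<^sub>i Z\<^sub>i\<close> with smooth \<open>h\<^sub>i\<close>, thus \<open>[X, Y] = \<Sum> h\<^sub>i [Z\<^sub>i, Y] - \<Sum> (Y h\<^sub>i) Z\<^sub>i\<close>, and
  both sums are tangential at every point.\<close>

lemma commutator_tangential: "commutator A \<Sigma> j X \<Longrightarrow> steps.tangential (field_coord A c X)"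
proof (induction rule: commutator.induct)
  case (field X)
  show ?case
    by (rule steps.tangential_sum[where J="{..<k}" and Y=Z and a="\<lambda>i y. mc c y (field_coord A c X y) (Z i y)",
          OF steps.tangential_field])
       (use field_coord_frame[OF field] W_sub in auto)
next
  case (bracket X j Y)
  let ?X = "field_coord A c X" and ?Y = "field_coord A c Y"
  have smX: "smooth_on (snd d ` fst d) (field_coord A d X)" if "d \<in> A" for d
    using commutator_smooth[OF commutator.field[OF bracket(1)] that] .
  have smY: "smooth_on (snd d ` fst d) (field_coord A d Y)" if "d \<in> A" for d
    using commutator_smooth[OF bracket(2) that] .
  have th: "thick S" by (rule open_thick[OF S(1)])
  have dY: "(?Y has_derivative frechet_derivative ?Y (at y)) (at y)" if "y \<in> W" for y
    by (rule smooth_on_has_derivative[OF smY[OF cA] chart(2)[OF cA]]) (use that W_sub in_chart in blast)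
  have dX: "(?X has_derivative frechet_derivative ?X (at y)) (at y)" if "y \<in> W" for y
    by (rule smooth_on_has_derivative[OF smX[OF cA] chart(2)[OF cA]]) (use that W_sub in_chart in blast)
  define h where "h i y = mc c y (?X y) (Z i y)" for i y
  have smh: "smooth_on S (h i)" if i: "i < k" for i
    unfolding h_def
  proof (rule smooth_on_bilinear_form[where B="mc c" and u="?X" and v="Z i", OF th])
    show "linear (mc c x u)" if "x \<in> S" for x u by (rule mc_bilinear(2)[OF cA in_chart[OF that]])
    show "linear (\<lambda>u. mc c x u v)" if "x \<in> S" for x v by (rule mc_bilinear(3)[OF cA in_chart[OF that]])
    show "smooth_on S (\<lambda>x. mc c x u v)" for u v by (rule smooth_on_subset[OF mc_smooth[OF cA] S(2) th])
    show "smooth_on S ?X" by (rule smooth_on_subset[OF smX[OF cA] S(2) th])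
  qed (rule Z_smooth[OF i])
  have dh: "(h i has_derivative frechet_derivative (h i) (at y)) (at y)" if "i < k" "y \<in> W" for i y
    by (rule smooth_on_has_derivative[OF smh[OF that(1)] S(1)]) (use that W_sub in blast)
  have X_eq: "?X y = (\<Sum>i<k. h i y *\<^sub>R Z i y)" if "y \<in> W" for y
    using field_coord_frame[OF bracket(1)] W_sub that unfolding h_def by blast
  have DX: "frechet_derivative ?X (at y) v = (\<Sum>i<k. h i y *\<^sub>R frechet_derivative (Z i) (at y) v
      + frechet_derivative (h i) (at y) v *\<^sub>R Z i y)" if y: "y \<in> W" for y v
  proof -
    have "((\<lambda>y. \<Sum>i<k. h i y *\<^sub>R Z i y) has_derivative (\<lambda>v. \<Sum>i<k. h i y *\<^sub>R frechet_derivative (Z i) (at y) v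
      + frechet_derivative (h i) (at y) v *\<^sub>R Z i y)) (at y)"
      using y W_sub by (intro has_derivative_sum has_derivative_scaleR dh Z_has_derivative) auto
    then have "(?X has_derivative (\<lambda>v. \<Sum>i<k. h i y *\<^sub>R frechet_derivative (Z i) (at y) v
      + frechet_derivative (h i) (at y) v *\<^sub>R Z i y)) (at y)"
      by (rule has_derivative_transform_within_open[OF _ open_ball y]) (simp add: X_eq)
    from has_derivative_unique[OF dX[OF y] this] show ?thesis by (rule fun_cong)
  qed
  define P where "P y = (\<Sum>i<k. h i y *\<^sub>R (frechet_derivative ?Y (at y) (Z i y) - frechet_derivative (Z i) (at y) (?Y y)))" for y
  define Q where "Q y = (\<Sum>i<k. (- frechet_derivative (h i) (at y) (?Y y)) *\<^sub>R Z i y)" for y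
  have P: "steps.tangential P"
    by (rule steps.tangential_sum[where J="{..<k}" and a=h, OF steps.tangential_bracket[OF _ bracket(3) dY]])
       (auto simp: P_def)
  have Q: "steps.tangential Q"
    by (rule steps.tangential_sum[where J="{..<k}" and Y=Z
          and a="\<lambda>i y. - frechet_derivative (h i) (at y) (?Y y)", OF steps.tangential_field]) (auto simp: Q_def)
  show ?case
  proof (rule steps.tangential_add[OF P Q])
    fix y assume y: "y \<in> W"
    have "y \<in> snd c ` fst c" using y W_sub in_chart by blast
    then have "field_coord A c (lie_bracket A X Y) y = frechet_derivative ?Y (at y) (?X y) - frechet_derivative ?X (at y) (?Y y)"
      using lie_bracket_coord smX smY cA by blast
    also have "frechet_derivative ?Y (at y) (?X y) = (\<Sum>i<k. h i y *\<^sub>R frechet_derivative ?Y (at y) (Z i y))"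
      using has_derivative_linear[OF dY[OF y]] by (simp add: X_eq[OF y] linear_sum linear_cmul)
    finally show "field_coord A c (lie_bracket A X Y) y = P y + Q y"
      by (simp add: DX[OF y] P_def Q_def sum.distrib scaleR_diff_right sum_subtractf sum_negf)
  qed
qed

lemma continuous_\<phi>:
  assumes bg: "bracket_generating A \<Sigma>" and q: "q \<in> W"
  shows "isCont \<phi> q"
proof (rule steps.tangential_span_imp_continuous[OF q])
  have qc: "q \<in> snd c ` fst c" using q W_sub in_chart by blast
  define p where "p = chart_inv c q"
  have p: "p \<in> fst c" "snd c p = q" using chart[OF cA] qc by (auto simp: p_def)
  obtain l where l: "flag A \<Sigma> l p = UNIV" using bg unfolding bracket_generating_def by blast
  have lin: "linear (to_coord A c p)" by (rule to_coord_linear[OF cA p(1)])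
  have "to_coord A c p ` {X p |X j. j \<le> l \<and> commutator A \<Sigma> j X} \<subseteq> {Z q |Z. steps.tangential Z}"
  proof
    fix v assume "v \<in> to_coord A c p ` {X p |X j. j \<le> l \<and> commutator A \<Sigma> j X}"
    then obtain X j where X: "v = to_coord A c p (X p)" "commutator A \<Sigma> j X" by auto
    then show "v \<in> {Z q |Z. steps.tangential Z}"
      using field_coord_apply[OF cA p(1), of X] commutator_tangential[OF X(2)] p(2)
      by (intro CollectI exI[of _ "field_coord A c X"]) simp
  qed
  from span_mono[OF this]
  have "to_coord A c p ` UNIV \<subseteq> span {Z q |Z. steps.tangential Z}"
    using l by (simp add: linear_span_image[OF lin] flag_def)
  moreover have "surj (to_coord A c p)" using to_of_coord[OF cA p(1)] by (rule surjI)
  ultimately show "span {Z q |Z. steps.tangential Z} = UNIV" by auto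
qed

end

section \<open>Horizontal curves\<close>

context atlas
begin

lemma smooth_curve_coord:
  assumes sc: "smooth_curve A J \<gamma>" and d: "d \<in> A"
  obtains v where "continuous_on (J \<inter> \<gamma> -` fst d) v"
    "\<And>t. t \<in> J \<Longrightarrow> \<gamma> t \<in> fst d \<Longrightarrow> ((snd d \<circ> \<gamma>) has_vector_derivative v t) (at t within J)"
    "\<And>t. t \<in> J \<Longrightarrow> \<gamma> t \<in> fst d \<Longrightarrow> velocity A J \<gamma> t = of_coord A d (\<gamma> t) (v t)"
    "\<And>t. t \<in> J \<Longrightarrow> \<gamma> t \<in> fst d \<Longrightarrow> to_coord A d (\<gamma> t) (velocity A J \<gamma> t) = v t"
proof -
  let ?K = "J \<inter> \<gamma> -` fst d" and ?\<sigma> = "snd d \<circ> \<gamma>"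
  have J: "is_interval J" "interior J \<noteq> {}" and cont: "continuous_on J \<gamma>" and sm: "smooth_on ?K ?\<sigma>"
    using sc d unfolding smooth_curve_def by auto
  have thJ: "thick J" by (rule thick_interval[OF J])
  define v where "v t = frechet_derivative ?\<sigma> (at t within ?K) 1" for t
  have sm1: "Ck_on (Suc 0) ?K ?\<sigma>" using sm unfolding smooth_on_def by blast
  then have cv: "continuous_on ?K v" by (simp add: v_def)
  have der: "(?\<sigma> has_vector_derivative v t) (at t within J)" if t: "t \<in> J" "\<gamma> t \<in> fst d" for t
  proof -
    have D: "(?\<sigma> has_derivative frechet_derivative ?\<sigma> (at t within ?K)) (at t within ?K)"
      using Ck_on_has_derivative[OF sm1] t by blast
    have "frechet_derivative ?\<sigma> (at t within ?K) h = h *\<^sub>R v t" for h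
      using linear_cmul[OF has_derivative_linear[OF D], of h 1] by (simp add: v_def)
    then have "frechet_derivative ?\<sigma> (at t within ?K) = (\<lambda>h. h *\<^sub>R v t)" by blast
    then show ?thesis
      using D at_within_preimage[OF cont t(1) chart(1)[OF d] t(2)] by (simp add: has_vector_derivative_def)
  qed
  show ?thesis
  proof (rule that[OF cv der])
    show "velocity A J \<gamma> t = of_coord A d (\<gamma> t) (v t)" "to_coord A d (\<gamma> t) (velocity A J \<gamma> t) = v t"
      if "t \<in> J" "\<gamma> t \<in> fst d" for t
      using velocity_eq[OF cont that(1) thJ d that(2) der[OF that]] by auto
  qed
qed

end

context riemannian
begin

lemma continuous_on_mc:
  assumes K: "thick K" and d: "d \<in> A" and \<sigma>: "continuous_on K \<sigma>" "\<sigma> ` K \<subseteq> snd d ` fst d"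
    and u: "continuous_on K u" and v: "continuous_on K v"
  shows "continuous_on K (\<lambda>s. mc d (\<sigma> s) (u s) (v s))"
proof (rule continuous_on_bilinear_form[where B="\<lambda>s. mc d (\<sigma> s)", OF K _ _ _ u v])
  show "linear (mc d (\<sigma> s) w)" if "s \<in> K" for s w
    by (rule mc_bilinear(2)[OF d]) (use \<sigma>(2) that in blast)
  show "linear (\<lambda>u. mc d (\<sigma> s) u w)" if "s \<in> K" for s w
    by (rule mc_bilinear(3)[OF d]) (use \<sigma>(2) that in blast)
  show "continuous_on K (\<lambda>s. mc d (\<sigma> s) w w')" for w w'
    by (rule continuous_on_compose2[OF smooth_on_imp_continuous_on[OF mc_smooth[OF d]] \<sigma>])
qed

lemma speed_continuous:
  assumes sc: "smooth_curve A J \<gamma>"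
  shows "continuous_on J (\<lambda>t. sqrt (g (\<gamma> t) (velocity A J \<gamma> t) (velocity A J \<gamma> t)))"
proof (rule continuous_on_real_sqrt, unfold continuous_on_eq_continuous_within, intro ballI)
  fix t assume t: "t \<in> J"
  define d where "d = chart_at A (\<gamma> t)"
  have d: "d \<in> A" "\<gamma> t \<in> fst d" using chart_at by (auto simp: d_def)
  let ?K = "J \<inter> \<gamma> -` fst d"
  have cont: "continuous_on J \<gamma>" and thJ: "thick J"
    using sc thick_interval unfolding smooth_curve_def by auto
  have "openin (top_of_set J) ?K" by (rule continuous_openin_preimage_gen[OF cont chart(1)[OF d(1)]])
  then have thK: "thick ?K" by (rule thick_openin[OF thJ])
  obtain v where v: "continuous_on ?K v"
    "\<And>t. t \<in> J \<Longrightarrow> \<gamma> t \<in> fst d \<Longrightarrow> velocity A J \<gamma> t = of_coord A d (\<gamma> t) (v t)"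
    using smooth_curve_coord[OF sc d(1)] by metis
  have "continuous_on ?K (\<lambda>s. mc d (snd d (\<gamma> s)) (v s) (v s))"
  proof (rule continuous_on_mc[OF thK d(1) _ _ v(1) v(1)])
    show "continuous_on ?K (\<lambda>s. snd d (\<gamma> s))"
      by (rule continuous_on_compose2[OF chart(3)[OF d(1)] continuous_on_subset[OF cont]]) auto
  qed auto
  moreover have "mc d (snd d (\<gamma> s)) (v s) (v s) = g (\<gamma> s) (velocity A J \<gamma> s) (velocity A J \<gamma> s)" if "s \<in> ?K" for s
    using that v(2)[of s] mc_apply[OF d(1), of "\<gamma> s"] by simp
  ultimately have "continuous_on ?K (\<lambda>s. g (\<gamma> s) (velocity A J \<gamma> s) (velocity A J \<gamma> s))"
    by (rule continuous_on_eq)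
  then have "continuous (at t within ?K) (\<lambda>s. g (\<gamma> s) (velocity A J \<gamma> s) (velocity A J \<gamma> s))"
    using t d by (auto simp: continuous_on_eq_continuous_within)
  then show "continuous (at t within J) (\<lambda>s. g (\<gamma> s) (velocity A J \<gamma> s) (velocity A J \<gamma> s))"
    unfolding at_within_preimage[OF cont t chart(1)[OF d(1)] d(2)] .
qed

end

text \<open>Turns the almost everywhere condition in the definition of a horizontal curve into one that holds at all times of a
  smooth piece.\<close>

lemma continuous_AE_zero_imp_zero:
  fixes w :: "real \<Rightarrow> 'a::real_normed_vector"
  assumes st: "s < t" and w: "continuous_on {s..t} w" and ae: "AE r in lborel. r \<in> {s..t} \<longrightarrow> w r = 0"
    and r: "r \<in> {s..t}"
  shows "w r = 0"
proof -
  obtain N where N: "{r \<in> space lborel. \<not> (r \<in> {s..t} \<longrightarrow> w r = 0)} \<subseteq> N" "emeasure lborel N = 0" "N \<in> sets lborel"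
    using ae by (rule AE_E)
  have "N \<in> null_sets lborel" using N by auto
  then have "negligible N" by (simp add: negligible_iff_null_sets null_sets_completionI)
  moreover have "norm (w r) = 0" if "r \<in> {s..t} - N" for r using N(1) that by auto
  ultimately have "integral {s..t} (\<lambda>r. norm (w r)) = integral {s..t} (\<lambda>r. 0)"
    by (intro integral_spike[of N]) auto
  then have "integral {s..t} (\<lambda>r. norm (w r)) = 0" by simp
  moreover have "continuous_on {s..t} (\<lambda>r. norm (w r))" by (intro continuous_on_norm w)
  ultimately have "norm (w r) = 0"
    using integral_eq_0_iff[of s t "\<lambda>r. norm (w r)"] st r by auto
  then show ?thesis by simp
qed

context convex_chart
begin

definition controls :: "'e \<Rightarrow> 'e \<Rightarrow> 'e" where
  "controls x v = (\<Sum>i<k. mc c x v (Z i x) *\<^sub>R \<beta> i)"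

lemma frame_controls:
  assumes "x \<in> S" "v \<in> span ((\<lambda>i. Z i x) ` {..<k})"
  shows "frame x (controls x v) = v"
  using frame_expansion[OF assms]
  by (simp add: controls_def linear_sum[OF frame_linear] linear_cmul[OF frame_linear] frame_basis)

text \<open>The frame is orthonormal, so the length of a curve is the integral of the Euclidean norm of its controls.\<close>

lemma norm_controls:
  assumes x: "x \<in> S" and v: "v \<in> span ((\<lambda>i. Z i x) ` {..<k})"
  shows "norm (controls x v) = sqrt (mc c x v v)"
proof -
  let ?m = "\<lambda>i. mc c x v (Z i x)"
  note l = mc_bilinear(2)[OF cA in_chart[OF x]]
  have "controls x v \<bullet> \<beta> j = ?m j" if "j < k" for j
  proof -
    have "controls x v \<bullet> \<beta> j = (\<Sum>i<k. if i = j then ?m i else 0)"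
      unfolding controls_def inner_sum_left using that by (intro sum.cong) (auto simp: \<beta>_inner)
    then show ?thesis using that by simp
  qed
  then have "controls x v \<bullet> controls x v = (\<Sum>i<k. ?m i * ?m i)"
    by (subst (2) controls_def) (simp add: inner_sum_right)
  also have "\<dots> = mc c x v (\<Sum>i<k. ?m i *\<^sub>R Z i x)"
    by (simp add: linear_sum[OF l] linear_cmul[OF l])
  also have "\<dots> = mc c x v v" by (rule arg_cong[OF frame_expansion[OF x v, symmetric]])
  finally show ?thesis by (simp add: norm_eq_sqrt_inner)
qed

lemma frame_bound:
  "\<exists>B\<ge>0. \<forall>x\<in>W. \<forall>w. norm (frame x w) \<le> B * norm w \<and> (\<forall>y\<in>W. norm (frame x w - frame y w) \<le> B * norm (x - y) * norm w)"
proof -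
  have sub: "cball a (R/4) \<subseteq> S"
  proof
    fix y assume "y \<in> cball a (R/4)"
    then have "(y, 0 :: 'e) \<in> cball (a, 0) R" using lf.pos by (simp add: dist_Pair_Pair)
    then show "y \<in> S" using ball_S by auto
  qed
  have "\<exists>B\<ge>0. \<forall>x\<in>cball a (R/4). \<forall>y\<in>cball a (R/4). norm (Z i x - Z i y) \<le> B * norm (x - y)" if "i < k" for i
  proof -
    have "Ck_on 1 S (Z i)" using Z_smooth[OF that] by (simp add: smooth_on_def)
    from C1_lipschitz_on_cball[OF this S(1) sub] show ?thesis by blast
  qed
  then obtain B where B: "\<And>i. i < k \<Longrightarrow> B i \<ge> 0"
    "\<And>i x y. i < k \<Longrightarrow> x \<in> cball a (R/4) \<Longrightarrow> y \<in> cball a (R/4) \<Longrightarrow> norm (Z i x - Z i y) \<le> B i * norm (x - y)"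
    by metis
  define B1 where "B1 = (\<Sum>i<k. B i)"
  define B2 where "B2 = (\<Sum>i<k. norm (Z i a) + B i * (R/4))"
  have nonneg: "B1 \<ge> 0" "B2 \<ge> 0" unfolding B1_def B2_def using B(1) lf.pos by (auto intro!: sum_nonneg)
  have \<beta>w: "\<bar>w \<bullet> \<beta> i\<bar> \<le> norm w" if "i < k" for i w using Basis_le_norm[OF \<beta>(1)[OF that]] .
  have 1: "norm (frame x w) \<le> (B1 + B2) * norm w" if x: "x \<in> W" for x w
  proof -
    have "norm (frame x w) \<le> (\<Sum>i<k. norm w * (norm (Z i a) + B i * (R/4)))"
      unfolding frame_def
    proof (rule sum_norm_le)
      fix i assume "i \<in> {..<k}"
      then have i: "i < k" by simp
      have "norm (Z i x) \<le> norm (Z i a) + norm (Z i x - Z i a)" using norm_triangle_ineq[of "Z i a" "Z i x - Z i a"] by simp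
      also have "norm (Z i x - Z i a) \<le> B i * norm (x - a)" using B(2)[OF i, of x a] x lf.pos by simp
      also have "\<dots> \<le> B i * (R/4)" using B(1)[OF i] x by (intro mult_left_mono) (auto simp: dist_norm norm_minus_commute)
      finally show "norm ((w \<bullet> \<beta> i) *\<^sub>R Z i x) \<le> norm w * (norm (Z i a) + B i * (R/4))"
        using \<beta>w[OF i, of w] by (auto intro: mult_mono)
    qed
    also have "\<dots> = B2 * norm w" by (simp add: B2_def sum_distrib_left mult.commute)
    also have "\<dots> \<le> (B1 + B2) * norm w" using nonneg by (intro mult_right_mono) auto
    finally show ?thesis .
  qed
  have 2: "norm (frame x w - frame y w) \<le> (B1 + B2) * norm (x - y) * norm w" if x: "x \<in> W" "y \<in> W" for x y w
  proof -
    have "frame x w - frame y w = (\<Sum>i<k. (w \<bullet> \<beta> i) *\<^sub>R (Z i x - Z i y))"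
      by (simp add: frame_def sum_subtractf scaleR_diff_right)
    also have "norm \<dots> \<le> (\<Sum>i<k. norm w * (B i * norm (x - y)))"
      by (rule sum_norm_le) (use \<beta>w B(2) x in \<open>auto intro!: mult_mono\<close>)
    also have "\<dots> = B1 * norm (x - y) * norm w" by (simp add: B1_def sum_distrib_left sum_distrib_right mult_ac)
    also have "\<dots> \<le> (B1 + B2) * norm (x - y) * norm w" using nonneg by (intro mult_right_mono) auto
    finally show ?thesis .
  qed
  show ?thesis using 1 2 nonneg by (intro exI[of _ "B1 + B2"]) auto
qed

definition frame_const :: real where
  "frame_const = (SOME B. B \<ge> 0 \<and> (\<forall>x\<in>W. \<forall>w. norm (frame x w) \<le> B * norm w \<and>
      (\<forall>y\<in>W. norm (frame x w - frame y w) \<le> B * norm (x - y) * norm w)))"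

lemma frame_const:
  "frame_const \<ge> 0" "x \<in> W \<Longrightarrow> norm (frame x w) \<le> frame_const * norm w"
  "x \<in> W \<Longrightarrow> y \<in> W \<Longrightarrow> norm (frame x w - frame y w) \<le> frame_const * norm (x - y) * norm w"
  using someI_ex[OF frame_bound] unfolding frame_const_def[symmetric] by blast+

definition slope :: real where
  "slope = 2 / (T * \<rho>)"

lemma slope_nonneg: "slope \<ge> 0"
  using lf.pos \<rho>_pos by (simp add: slope_def)

lemma step_exists:
  assumes p: "p \<in> W" and w: "norm w \<le> \<rho> * T / 2"
  shows "\<exists>q. norm (q - p - frame p w) \<le> L * M / \<rho>\<^sup>2 * (norm w)\<^sup>2 \<and> \<bar>\<phi> q - \<phi> p\<bar> \<le> slope * norm w"
proof (cases "w = 0")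
  case True
  then show ?thesis by (intro exI[of _ p]) (simp add: linear_0[OF frame_linear])
next
  case False
  define e where "e = w /\<^sub>R norm w"
  have e: "norm e \<le> 1" "w = norm w *\<^sub>R e" using False by (auto simp: e_def)
  have "frame p w = norm w *\<^sub>R frame p e" using e(2) linear_cmul[OF frame_linear] by metis
  then show ?thesis
    using step_first_order[OF p e(1), of "norm w"] slow_step[OF p e(1), of "norm w"] w
    by (intro exI[of _ "step e (norm w) p"]) (simp add: slope_def)
qed

text \<open>The second estimate bounds lengths from below by coordinate distances; it controls curves that leave
  the chart neighbourhood.\<close>

lemma slow_along_smooth_horizontal_curve:
  assumes bg: "bracket_generating A \<Sigma>" and sc: "smooth_curve A J \<gamma>"
    and t12: "t1 < t2" "{t1..t2} \<subseteq> J"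
    and hor: "AE t in lborel. t \<in> {t1..t2} \<longrightarrow> velocity A J \<gamma> t \<in> \<Sigma> (\<gamma> t)"
    and inW: "\<forall>t\<in>{t1..t2}. \<gamma> t \<in> fst c \<and> snd c (\<gamma> t) \<in> W"
  defines "len \<equiv> integral {t1..t2} (\<lambda>t. sqrt (g (\<gamma> t) (velocity A J \<gamma> t) (velocity A J \<gamma> t)))"
  shows "\<bar>\<phi> (snd c (\<gamma> t2)) - \<phi> (snd c (\<gamma> t1))\<bar> \<le> slope * len"
    and "norm (snd c (\<gamma> t2) - snd c (\<gamma> t1)) \<le> frame_const * len"
proof -
  let ?I = "{t1..t2}"
  define \<sigma> where "\<sigma> t = snd c (\<gamma> t)" for t
  obtain v where v: "continuous_on (J \<inter> \<gamma> -` fst c) v"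
    "\<And>t. t \<in> J \<Longrightarrow> \<gamma> t \<in> fst c \<Longrightarrow> ((snd c \<circ> \<gamma>) has_vector_derivative v t) (at t within J)"
    "\<And>t. t \<in> J \<Longrightarrow> \<gamma> t \<in> fst c \<Longrightarrow> velocity A J \<gamma> t = of_coord A c (\<gamma> t) (v t)"
    "\<And>t. t \<in> J \<Longrightarrow> \<gamma> t \<in> fst c \<Longrightarrow> to_coord A c (\<gamma> t) (velocity A J \<gamma> t) = v t"
    using smooth_curve_coord[OF sc cA] by metis
  have IJ: "t \<in> J" "\<gamma> t \<in> fst c" "\<sigma> t \<in> W" "\<sigma> t \<in> S" if "t \<in> ?I" for t
    using t12 bspec[OF inW that] that W_sub by (auto simp: \<sigma>_def)
  have thI: "thick ?I" using t12 by (intro thick_interval is_interval_cc) (simp add: interior_atLeastAtMost_real)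
  have cv: "continuous_on ?I v" by (rule continuous_on_subset[OF v(1)]) (use IJ in auto)
  have d\<sigma>: "(\<sigma> has_vector_derivative v t) (at t within ?I)" if "t \<in> ?I" for t
    using has_vector_derivative_within_subset[OF v(2)[OF IJ(1,2)[OF that]] t12(2)] by (simp add: \<sigma>_def[abs_def] comp_def)
  have c\<sigma>: "continuous_on ?I \<sigma>" by (rule continuous_on_vector_derivative[OF d\<sigma>])
  have cZ: "continuous_on ?I (\<lambda>t. Z i (\<sigma> t))" if "i < k" for i
    by (rule continuous_on_compose2[OF smooth_on_imp_continuous_on[OF Z_smooth[OF that]] c\<sigma>]) (use IJ in auto)
  define u where "u t = controls (\<sigma> t) (v t)" for t
  have cu: "continuous_on ?I u"
    unfolding u_def controls_def
    by (intro continuous_on_sum continuous_on_scaleR continuous_on_const continuous_on_mc[OF thI cA c\<sigma> _ cv] cZ)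
       (use IJ in_chart in auto)
  have cfr: "continuous_on ?I (\<lambda>t. frame (\<sigma> t) (u t))"
    unfolding frame_def by (intro continuous_on_sum continuous_on_scaleR continuous_on_inner continuous_on_const cu cZ) auto
  have span: "v t \<in> span ((\<lambda>i. Z i (\<sigma> t)) ` {..<k})" if t: "t \<in> ?I" "velocity A J \<gamma> t \<in> \<Sigma> (\<gamma> t)" for t
  proof -
    have "v t \<in> to_coord A c (\<gamma> t) ` \<Sigma> (\<gamma> t)" 
      using v(4)[OF IJ(1,2)[OF t(1)]] by (intro image_eqI[where x="velocity A J \<gamma> t", OF _ t(2)]) simp
    then show ?thesis using Z_span[OF IJ(4)[OF t(1)]] chart(5)[OF cA IJ(2)[OF t(1)]] by (simp add: \<sigma>_def)
  qed
  have "v t - frame (\<sigma> t) (u t) = 0" if t: "t \<in> ?I" for t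
  proof (rule continuous_AE_zero_imp_zero[OF t12(1) _ _ t])
    show "continuous_on ?I (\<lambda>t. v t - frame (\<sigma> t) (u t))" by (intro continuous_on_diff cv cfr)
    show "AE t in lborel. t \<in> ?I \<longrightarrow> v t - frame (\<sigma> t) (u t) = 0"
      using hor by eventually_elim (use span frame_controls IJ(4) in \<open>auto simp: u_def\<close>)
  qed
  then have v_eq: "v t = frame (\<sigma> t) (u t)" if "t \<in> ?I" for t using that by simp
  have speed: "sqrt (g (\<gamma> t) (velocity A J \<gamma> t) (velocity A J \<gamma> t)) = norm (u t)" if t: "t \<in> ?I" for t
  proof -
    have "v t \<in> span ((\<lambda>i. Z i (\<sigma> t)) ` {..<k})" unfolding v_eq[OF t] by (rule frame_in_span)
    from norm_controls[OF IJ(4)[OF t] this] show ?thesis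
      using mc_apply[OF cA IJ(2)[OF t], of "v t" "v t"] v(3)[OF IJ(1,2)[OF t]] by (simp add: u_def \<sigma>_def)
  qed
  then have len: "len = integral ?I (\<lambda>t. norm (u t))" unfolding len_def by (intro integral_cong) auto
  have d\<sigma>': "(\<sigma> has_vector_derivative frame (\<sigma> t) (u t)) (at t within ?I)" if "t \<in> ?I" for t
    using d\<sigma>[OF that] v_eq[OF that] by simp
  have "\<bar>\<phi> (\<sigma> t2) - \<phi> (\<sigma> t1)\<bar> \<le> slope * integral ?I (\<lambda>t. norm (u t))"
  proof (rule slow_along_horizontal_curve[where B=W and Z=frame and L=frame_const and C="L * M / \<rho>\<^sup>2"
        and \<tau>="\<rho> * T / 2" and \<sigma>=\<sigma> and u=u])
    show "t1 \<le> t2" "0 \<le> slope" "0 \<le> frame_const" "0 < \<rho> * T / 2" "0 \<le> L * M / \<rho>\<^sup>2" "open W"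
      using t12 slope_nonneg frame_const lf.pos \<rho>_pos lf.const_nonneg by auto
    show "\<sigma> ` ?I \<subseteq> W" using IJ by auto
    show "isCont \<phi> (\<sigma> t2)" using continuous_\<phi>[OF bg IJ(3)] t12 by simp
    show "frame p (h *\<^sub>R w) = h *\<^sub>R frame p w" for p h w by (rule linear_cmul[OF frame_linear])
  qed (use d\<sigma>' cfr cu frame_const step_exists in auto)
  then show "\<bar>\<phi> (snd c (\<gamma> t2)) - \<phi> (snd c (\<gamma> t1))\<bar> \<le> slope * len" by (simp add: len \<sigma>_def)
  have int: "(v has_integral (\<sigma> t2 - \<sigma> t1)) ?I"
    by (rule fundamental_theorem_of_calculus) (use t12 d\<sigma> in auto)
  have "norm (integral ?I v) \<le> integral ?I (\<lambda>t. frame_const * norm (u t))"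
    by (rule integral_norm_bound_integral)
       (use int v_eq frame_const(2) IJ cu cv in \<open>auto intro!: integrable_continuous_real continuous_intros\<close>)
  then show "norm (snd c (\<gamma> t2) - snd c (\<gamma> t1)) \<le> frame_const * len"
    using integral_unique[OF int] by (simp add: len \<sigma>_def)
qed

end

section \<open>Lipschitz estimate along a piecewise smooth horizontal curve\<close>

lemma integral_on_subinterval:
  fixes h h' :: "real \<Rightarrow> real"
  assumes st: "s < t" and eq: "\<And>r. r \<in> {s<..<t} \<Longrightarrow> h r = h' r" and h': "continuous_on {s..t} h'"
  shows "h integrable_on {s..t}" "integral {s..t} h = integral {s..t} h'"
proof -
  have "(h' has_integral integral {s..t} h') {s..t}"
    by (intro integrable_integral integrable_continuous_real h')
  then have "(h has_integral integral {s..t} h') {s..t}"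
    by (rule has_integral_spike_finite[of "{s, t}", rotated 2]) (use eq in auto)
  then show "h integrable_on {s..t}" "integral {s..t} h = integral {s..t} h'" by auto
qed

lemma velocity_subinterval:
  assumes "{s..t} \<subseteq> {a..b}" "r \<in> {s<..<t}"
  shows "velocity A {a..b} \<gamma> r = velocity A {s..t} \<gamma> r"
proof -
  have "a < r" "r < b" "s < r" "r < t" using assms by auto
  then show ?thesis by (simp add: velocity_def at_within_Icc_at)
qed

context riemannian
begin

text \<open>The integrand of the length of a curve on \<open>[a, b]\<close>.  At break points it depends on the interval, which is
  why the interval is a parameter.\<close>

definition speed :: "real \<Rightarrow> real \<Rightarrow> (real \<Rightarrow> 'm) \<Rightarrow> real \<Rightarrow> real" where
  "speed a b \<gamma> t = sqrt (g (\<gamma> t) (velocity A {a..b} \<gamma> t) (velocity A {a..b} \<gamma> t))"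

lemma speed_nonneg: "speed a b \<gamma> t \<ge> 0"
proof -
  have "g p v v \<ge> 0" for p v
    using metric(3)[of v p] linear_0[of "g p 0"] metric(1)[of p] by (cases "v = 0") (auto simp: bilinear_def less_imp_le)
  then show ?thesis by (simp add: speed_def)
qed

lemma speed_on_piece:
  assumes J: "{s..t} \<subseteq> {a..b}" and sc: "smooth_curve A {s..t} \<gamma>" and r: "s \<le> r1" "r1 < r2" "r2 \<le> t"
  shows "speed a b \<gamma> integrable_on {r1..r2}" 
    "integral {r1..r2} (speed a b \<gamma>) = integral {r1..r2} (\<lambda>r. sqrt (g (\<gamma> r) (velocity A {s..t} \<gamma> r) (velocity A {s..t} \<gamma> r)))"
proof -
  have c: "continuous_on {r1..r2} (\<lambda>r. sqrt (g (\<gamma> r) (velocity A {s..t} \<gamma> r) (velocity A {s..t} \<gamma> r)))"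
    by (rule continuous_on_subset[OF speed_continuous[OF sc]]) (use r in auto)
  have "speed a b \<gamma> x = sqrt (g (\<gamma> x) (velocity A {s..t} \<gamma> x) (velocity A {s..t} \<gamma> x))" if "x \<in> {r1<..<r2}" for x
    using velocity_subinterval[OF J, of x A \<gamma>] that r by (simp add: speed_def)
  from integral_on_subinterval[OF r(2) this c]
  show "speed a b \<gamma> integrable_on {r1..r2}" 
    "integral {r1..r2} (speed a b \<gamma>) = integral {r1..r2} (\<lambda>r. sqrt (g (\<gamma> r) (velocity A {s..t} \<gamma> r) (velocity A {s..t} \<gamma> r)))"
    by auto
qed

end

lemma abs_exp_diff_le:
  fixes x y h :: real
  assumes "exp x \<le> h" "exp y \<le> h"
  shows "\<bar>exp x - exp y\<bar> \<le> h * \<bar>x - y\<bar>" "\<bar>exp x - exp y\<bar> \<le> h"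
proof -
  have le: "exp y - exp x \<le> exp y * (y - x)" for x y :: real
  proof -
    have "1 + (x - y) \<le> exp (x - y)" by (rule exp_ge_add_one_self)
    then have "exp y * (1 + (x - y)) \<le> exp y * exp (x - y)" by (intro mult_left_mono) auto
    then show ?thesis by (simp add: exp_diff algebra_simps)
  qed
  have *: "exp y - exp x \<le> h * \<bar>x - y\<bar>" if "exp y \<le> h" for x y :: real
  proof -
    have "exp y - exp x \<le> exp y * (y - x)" by (rule le)
    also have "\<dots> \<le> exp y * \<bar>x - y\<bar>" by (intro mult_left_mono) auto
    also have "\<dots> \<le> h * \<bar>x - y\<bar>" using that by (intro mult_right_mono) auto
    finally show ?thesis .
  qed
  show "\<bar>exp x - exp y\<bar> \<le> h * \<bar>x - y\<bar>" using *[OF assms(1), of y] *[OF assms(2), of x] by (simp add: abs_minus_commute abs_le_iff)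
  show "\<bar>exp x - exp y\<bar> \<le> h" using assms exp_gt_zero[of x] exp_gt_zero[of y] by linarith
qed

context convex_chart
begin

text \<open>The estimates on the smooth pieces add up, since both sides are additive in the interval.  Integrability of the speed is proved
  along with them because additivity of the integral depends on it.\<close>

lemma slow_along_curve:
  assumes bg: "bracket_generating A \<Sigma>" and hc: "horizontal_curve A \<Sigma> t0 t1 \<gamma>" and t: "t \<in> {t0..t1}"
    and inW: "\<forall>r\<in>{t0..t}. \<gamma> r \<in> fst c \<and> snd c (\<gamma> r) \<in> W"
  shows "speed t0 t1 \<gamma> integrable_on {t0..t1}"
    and "\<bar>\<phi> (snd c (\<gamma> t)) - \<phi> (snd c (\<gamma> t0))\<bar> \<le> slope * integral {t0..t} (speed t0 t1 \<gamma>)"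
    and "norm (snd c (\<gamma> t) - snd c (\<gamma> t0)) \<le> frame_const * integral {t0..t} (speed t0 t1 \<gamma>)"
proof -
  define \<sigma> where "\<sigma> r = snd c (\<gamma> r)" for r
  let ?sp = "speed t0 t1 \<gamma>"
  obtain n s where s: "s 0 = t0" "s n = t1" "\<And>i. i < n \<Longrightarrow> s i < s (Suc i)"
    and sc: "\<And>i. i < n \<Longrightarrow> smooth_curve A {s i..s (Suc i)} \<gamma>"
    using hc unfolding horizontal_curve_def piecewise_def by metis
  have mono: "s i \<le> s j" if "i \<le> j" "j \<le> n" for i j
    using that
  proof (induction j)
    case (Suc j)
    then show ?case using s(3)[of j] by (cases "i = Suc j") (auto simp: le_Suc_eq)
  qed auto
  have ae: "AE r in lborel. r \<in> {t0..t1} \<longrightarrow> velocity A {t0..t1} \<gamma> r \<in> \<Sigma> (\<gamma> r)"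
    using hc by (simp add: horizontal_curve_def)
  define good where "good r \<longleftrightarrow> ?sp integrable_on {t0..r} \<and> ((\<forall>q\<in>{t0..r}. \<gamma> q \<in> fst c \<and> \<sigma> q \<in> W) \<longrightarrow>
      \<bar>\<phi> (\<sigma> r) - \<phi> (\<sigma> t0)\<bar> \<le> slope * integral {t0..r} ?sp \<and>
      norm (\<sigma> r - \<sigma> t0) \<le> frame_const * integral {t0..r} ?sp)" for r
  have "\<forall>r\<in>{t0..s i}. good r" if "i \<le> n" for i
    using that
  proof (induction i)
    case 0
    then show ?case using s(1) integrable_on_refl[of ?sp t0] by (auto simp: good_def)
  next
    case (Suc i)
    have si: "s i < s (Suc i)" "t0 \<le> s i" "s (Suc i) \<le> t1"
      using s(3)[of i] mono[of 0 i] mono[of "Suc i" n] s(1,2) Suc.prems by auto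
    have IH: "good (s i)" using Suc si by auto
    show ?case
    proof
      fix r assume r: "r \<in> {t0..s (Suc i)}"
      show "good r"
      proof (cases "r \<le> s i")
        case True
        then show ?thesis using Suc r by auto
      next
        case False
        then have r': "s i < r" "r \<le> s (Suc i)" using r by auto
        let ?J = "{s i..s (Suc i)}"
        have J: "?J \<subseteq> {t0..t1}" using si by auto
        have scJ: "smooth_curve A ?J \<gamma>" using sc Suc.prems by simp
        note piece = speed_on_piece[OF J scJ order_refl r']
        have int0: "?sp integrable_on {t0..s i}" using IH by (simp add: good_def)
        have int: "?sp integrable_on {t0..r}"
          by (rule Henstock_Kurzweil_Integration.integrable_combine[OF si(2) less_imp_le[OF r'(1)] int0 piece(1)])
        have comb: "integral {t0..s i} ?sp + integral {s i..r} ?sp = integral {t0..r} ?sp"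
          by (rule Henstock_Kurzweil_Integration.integral_combine[OF si(2) less_imp_le[OF r'(1)] int])
        have "\<bar>\<phi> (\<sigma> r) - \<phi> (\<sigma> t0)\<bar> \<le> slope * integral {t0..r} ?sp \<and>
            norm (\<sigma> r - \<sigma> t0) \<le> frame_const * integral {t0..r} ?sp"
          if inW: "\<forall>q\<in>{t0..r}. \<gamma> q \<in> fst c \<and> \<sigma> q \<in> W"
        proof -
          have 1: "\<bar>\<phi> (\<sigma> (s i)) - \<phi> (\<sigma> t0)\<bar> \<le> slope * integral {t0..s i} ?sp"
            "norm (\<sigma> (s i) - \<sigma> t0) \<le> frame_const * integral {t0..s i} ?sp"
            using IH inW r' by (auto simp: good_def)
          have sub: "{s i..r} \<subseteq> ?J" using r' by auto
          have hor: "AE q in lborel. q \<in> {s i..r} \<longrightarrow> velocity A ?J \<gamma> q \<in> \<Sigma> (\<gamma> q)"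
            using ae AE_lborel_singleton[of "s i"] AE_lborel_singleton[of "s (Suc i)"]
          proof eventually_elim
            case (elim q)
            show ?case
            proof
              assume "q \<in> {s i..r}"
              then have "q \<in> {s i<..<s (Suc i)}" "q \<in> {t0..t1}" using elim r' si by auto
              then show "velocity A ?J \<gamma> q \<in> \<Sigma> (\<gamma> q)" using elim(1) velocity_subinterval[OF J] by metis
            qed
          qed
          have inW': "\<forall>q\<in>{s i..r}. \<gamma> q \<in> fst c \<and> snd c (\<gamma> q) \<in> W"
            using inW si(2) by (auto simp: \<sigma>_def)
          note slow = slow_along_smooth_horizontal_curve[OF bg scJ r'(1) sub hor inW', folded piece(2) \<sigma>_def]
          have "\<bar>\<phi> (\<sigma> r) - \<phi> (\<sigma> t0)\<bar> \<le> slope * (integral {t0..s i} ?sp + integral {s i..r} ?sp)"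
            using 1(1) slow(1) unfolding distrib_left by linarith
          moreover have "norm (\<sigma> r - \<sigma> t0) \<le> frame_const * (integral {t0..s i} ?sp + integral {s i..r} ?sp)"
            using 1(2) slow(2) norm_triangle_ineq[of "\<sigma> r - \<sigma> (s i)" "\<sigma> (s i) - \<sigma> t0"]
            unfolding distrib_left by simp
          ultimately show ?thesis unfolding comb by blast
        qed
        then show ?thesis using int by (simp add: good_def)
      qed
    qed
  qed
  from this[of n] have good: "good r" if "r \<in> {t0..t1}" for r using that s(2) by simp
  have "t0 < t1" using hc by (simp add: horizontal_curve_def)
  then show "?sp integrable_on {t0..t1}" using good[of t1] by (simp add: good_def)
  show "\<bar>\<phi> (snd c (\<gamma> t)) - \<phi> (snd c (\<gamma> t0))\<bar> \<le> slope * integral {t0..t} ?sp"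
    "norm (snd c (\<gamma> t) - snd c (\<gamma> t0)) \<le> frame_const * integral {t0..t} ?sp"
    using good[OF t] inW unfolding good_def \<sigma>_def by auto
qed

text \<open>The first time outside the open ball exists because the curve is continuous.  At that time the curve is still
  in the chart, since the image of the closed ball is compact and hence closed in the manifold.\<close>

lemma first_exit:
  fixes \<gamma> :: "real \<Rightarrow> 'm" and t0 t1 r :: real
  assumes cont: "continuous_on {t0..t1} \<gamma>" and r: "r < R/4"
    and start: "\<gamma> t0 \<in> chart_inv c ` ball a r" and t01: "t0 \<le> t1"
  obtains (stays) "\<forall>t\<in>{t0..t1}. \<gamma> t \<in> fst c \<and> snd c (\<gamma> t) \<in> W"
  | (leaves) \<tau> where "\<tau> \<in> {t0..t1}" "\<forall>t\<in>{t0..\<tau>}. \<gamma> t \<in> fst c \<and> snd c (\<gamma> t) \<in> W"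
      "r \<le> dist a (snd c (\<gamma> \<tau>))"
proof -
  have sub: "cball a r \<subseteq> snd c ` fst c" "cball a r \<subseteq> W"
    using W_sub in_chart r by (auto simp: subset_iff)
  let ?V = "chart_inv c ` ball a r" and ?C = "chart_inv c ` cball a r"
  have V_eq: "?V = fst c \<inter> snd c -` ball a r"
  proof (intro set_eqI iffI)
    fix p assume "p \<in> ?V"
    then obtain x where x: "x \<in> ball a r" "p = chart_inv c x" by blast
    then have "x \<in> snd c ` fst c" using sub(1) by auto
    then show "p \<in> fst c \<inter> snd c -` ball a r" using x chart(6,7)[OF cA] by auto
  next
    fix p assume p: "p \<in> fst c \<inter> snd c -` ball a r"
    then show "p \<in> ?V" using chart(5)[OF cA, of p] by (intro image_eqI[of _ _ "snd c p"]) auto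
  qed
  have opV: "open ?V" unfolding V_eq by (rule continuous_open_preimage[OF chart(3)[OF cA] chart(1)[OF cA] open_ball])
  have "compact ?C"
    by (rule compact_continuous_image[OF continuous_on_subset[OF chart(4)[OF cA] sub(1)] compact_cball])
  then have clC: "closed ?C" by (rule compact_imp_closed)
  have C_in: "\<gamma> t \<in> fst c \<and> snd c (\<gamma> t) \<in> W" if C: "\<gamma> t \<in> ?C" for t
  proof -
    obtain x where x: "x \<in> cball a r" "\<gamma> t = chart_inv c x" using C by blast
    then have xc: "x \<in> snd c ` fst c" using sub(1) by blast
    have "snd c (\<gamma> t) = x" "\<gamma> t \<in> fst c" using chart(6,7)[OF cA xc] by (simp_all add: x(2))
    moreover have "x \<in> W" using sub(2) x(1) by blast
    ultimately show ?thesis by simp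
  qed
  show ?thesis
  proof (cases "\<forall>t\<in>{t0..t1}. \<gamma> t \<in> ?V")
    case True
    show ?thesis
    proof (rule stays, rule ballI)
      fix t assume "t \<in> {t0..t1}"
      then have "\<gamma> t \<in> ?V" by (rule bspec[OF True])
      then have "\<gamma> t \<in> ?C" by (rule subsetD[OF image_mono[OF ball_subset_cball]])
      then show "\<gamma> t \<in> fst c \<and> snd c (\<gamma> t) \<in> W" by (rule C_in)
    qed
  next
    case False
    define E where "E = {t0..t1} \<inter> \<gamma> -` (- ?V)"
    have E: "E \<noteq> {}" "bdd_below E" using False by (auto simp: E_def intro: bdd_belowI[of _ t0])
    have "closed E" unfolding E_def by (intro continuous_closed_preimage[OF cont]) (use opV in auto)
    define \<tau> where "\<tau> = Inf E"
    have \<tau>E: "\<tau> \<in> E" unfolding \<tau>_def by (rule closed_contains_Inf[OF E \<open>closed E\<close>])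
    then have \<tau>: "\<tau> \<in> {t0..t1}" "\<gamma> \<tau> \<notin> ?V" by (auto simp: E_def)
    have "t0 < \<tau>" using \<tau> start by (cases "t0 = \<tau>") auto
    have before: "\<gamma> t \<in> ?C" if "t \<in> {t0..<\<tau>}" for t
    proof (rule ccontr)
      assume "\<gamma> t \<notin> ?C"
      then have "t \<in> E" using that \<tau> ball_subset_cball[of a r] by (auto simp: E_def)
      then have "\<tau> \<le> t" unfolding \<tau>_def using E by (intro cInf_lower)
      then show False using that by simp
    qed
    have "closed ({t0..\<tau>} \<inter> \<gamma> -` ?C)"
      by (rule continuous_closed_preimage[OF continuous_on_subset[OF cont] _ clC]) (use \<tau> in auto)
    moreover have "{t0..<\<tau>} \<subseteq> {t0..\<tau>} \<inter> \<gamma> -` ?C" using before by auto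
    ultimately have "closure {t0..<\<tau>} \<subseteq> {t0..\<tau>} \<inter> \<gamma> -` ?C" by (intro closure_minimal)
    then have inC: "\<gamma> t \<in> ?C" if "t \<in> {t0..\<tau>}" for t using that \<open>t0 < \<tau>\<close> by auto
    have "r \<le> dist a (snd c (\<gamma> \<tau>))"
    proof (rule ccontr)
      assume "\<not> r \<le> dist a (snd c (\<gamma> \<tau>))"
      moreover have "\<gamma> \<tau> \<in> fst c" using C_in[OF inC] \<open>t0 < \<tau>\<close> by auto
      ultimately show False using \<tau>(2) unfolding V_eq by auto
    qed
    then show ?thesis
    proof (rule leaves[OF \<tau>(1), rotated])
      show "\<forall>t\<in>{t0..\<tau>}. \<gamma> t \<in> fst c \<and> snd c (\<gamma> t) \<in> W" by (intro ballI C_in inC)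
    qed
  qed
qed

text \<open>A curve that leaves the ball of radius \<open>2 r\<close> covers a coordinate distance of at least \<open>r\<close>, so its length is at
  least \<open>r / frame_const\<close>, whereas \<open>f\<close> oscillates by at most \<open>h\<close> on the ball of radius \<open>r\<close>.\<close>

lemma lipschitz_along_horizontal_curves:
  assumes bg: "bracket_generating A \<Sigma>"
  obtains r H where "0 < r" "r \<le> R/4" "0 < H"
    "\<forall>t0 t1 \<gamma>. horizontal_curve A \<Sigma> t0 t1 \<gamma> \<longrightarrow> \<gamma> t0 \<in> chart_inv c ` ball a r \<longrightarrow>
     \<gamma> t1 \<in> chart_inv c ` ball a r \<longrightarrow> \<bar>f (\<gamma> t0) - f (\<gamma> t1)\<bar> \<le> H * curve_length A g t0 t1 \<gamma>"
proof -
  have "isCont \<phi> a" using continuous_\<phi>[OF bg] lf.pos by simp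
  then obtain d where d: "d > 0" "\<And>x. dist x a < d \<Longrightarrow> dist (\<phi> x) (\<phi> a) < 1"
    unfolding continuous_at_eps_delta by (metis zero_less_one)
  \<comment> \<open>Curves are followed up to the ball of radius \<open>2 r\<close>, on whose closure the estimates hold; \<open>\<phi>\<close> is bounded
    above on the ball of radius \<open>r\<close>.\<close>
  define r where "r = min d (R/16)"
  have r: "r > 0" "2 * r < R/4" "r \<le> d" using d lf.pos by (auto simp: r_def)
  \<comment> \<open>On the ball of radius \<open>r\<close>, \<open>h\<close> bounds \<open>exp \<phi>\<close>, the derivative that translates differences of \<open>\<phi>\<close> into those of \<open>f\<close>.\<close>
  define h where "h = exp (\<phi> a + 1)"
  have h: "exp (\<phi> x) \<le> h" if "x \<in> ball a r" for x
    using d(2)[of x] that r by (simp add: h_def dist_commute dist_real_def abs_less_iff)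
  define H where "H = h * (slope + frame_const / r) + 1"
  have h0: "h > 0" by (simp add: h_def)
  have H0: "H > 0" using h0 slope_nonneg frame_const(1) r by (simp add: H_def add_nonneg_pos)
  have "\<bar>f (\<gamma> t0) - f (\<gamma> t1)\<bar> \<le> H * curve_length A g t0 t1 \<gamma>"
    if hc: "horizontal_curve A \<Sigma> t0 t1 \<gamma>" and ends: "\<gamma> t0 \<in> chart_inv c ` ball a r" "\<gamma> t1 \<in> chart_inv c ` ball a r" for t0 t1 \<gamma>
  proof -
    let ?sp = "speed t0 t1 \<gamma>"
    have t01: "t0 < t1" and cont: "continuous_on {t0..t1} \<gamma>" using hc by (auto simp: horizontal_curve_def)
    obtain x0 x1 where x: "x0 \<in> ball a r" "x1 \<in> ball a r" "\<gamma> t0 = chart_inv c x0" "\<gamma> t1 = chart_inv c x1"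
      using ends by blast
    have xS: "x0 \<in> S" "x1 \<in> S" using x(1,2) r W_sub by auto
    have sx: "snd c (\<gamma> t0) = x0" "snd c (\<gamma> t1) = x1" using chart(6)[OF cA] in_chart xS x by auto
    have ef: "f (chart_inv c x) = K - exp (\<phi> x)" if "x \<in> S" for x
      using below_K[OF that] by (simp add: \<phi>_def)
    have fd: "f (\<gamma> t0) - f (\<gamma> t1) = exp (\<phi> x1) - exp (\<phi> x0)" using ef xS x by simp
    have len: "curve_length A g t0 t1 \<gamma> = integral {t0..t1} ?sp"
      by (simp add: curve_length_def speed_def[abs_def])
    have start: "\<gamma> t0 \<in> chart_inv c ` ball a (2 * r)" using x(1,3) r by auto
    show ?thesis
    proof (rule first_exit[OF cont r(2) start less_imp_le[OF t01]])
      assume stays: "\<forall>t\<in>{t0..t1}. \<gamma> t \<in> fst c \<and> snd c (\<gamma> t) \<in> W"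
      have "t1 \<in> {t0..t1}" using t01 by simp
      note est = slow_along_curve[OF bg hc this stays]
      have l0: "integral {t0..t1} ?sp \<ge> 0"
        by (rule Henstock_Kurzweil_Integration.integral_nonneg[OF est(1)]) (rule speed_nonneg)
      have "\<bar>exp (\<phi> x1) - exp (\<phi> x0)\<bar> \<le> h * \<bar>\<phi> x1 - \<phi> x0\<bar>" by (rule abs_exp_diff_le(1)[OF h[OF x(2)] h[OF x(1)]])
      also have "\<dots> \<le> h * (slope * integral {t0..t1} ?sp)" using est(2) h0 by (intro mult_left_mono) (auto simp: sx)
      also have "\<dots> \<le> H * integral {t0..t1} ?sp"
      proof -
        have "h * slope \<le> H" using h0 frame_const(1) r by (simp add: H_def distrib_left)
        then show ?thesis using l0 mult_right_mono by (fastforce simp: mult.assoc)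
      qed
      finally show ?thesis by (simp add: fd len)
    next
      fix \<tau> assume leaves: "\<tau> \<in> {t0..t1}" "\<forall>t\<in>{t0..\<tau>}. \<gamma> t \<in> fst c \<and> snd c (\<gamma> t) \<in> W"
        "2 * r \<le> dist a (snd c (\<gamma> \<tau>))"
      note est = slow_along_curve[OF bg hc leaves(1,2)]
      have split: "integral {t0..\<tau>} ?sp + integral {\<tau>..t1} ?sp = integral {t0..t1} ?sp"
        using leaves(1) by (intro Henstock_Kurzweil_Integration.integral_combine est(1)) auto
      have "integral {\<tau>..t1} ?sp \<ge> 0"
        by (rule Henstock_Kurzweil_Integration.integral_nonneg[OF integrable_subinterval_real[OF est(1)]])
           (use leaves(1) speed_nonneg in auto)
      then have le: "integral {t0..\<tau>} ?sp \<le> integral {t0..t1} ?sp" using split by linarith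
      have "2 * r \<le> dist a x0 + dist x0 (snd c (\<gamma> \<tau>))" using leaves(3) dist_triangle[of a "snd c (\<gamma> \<tau>)" x0] by linarith
      then have "r \<le> norm (snd c (\<gamma> \<tau>) - snd c (\<gamma> t0))"
        using x(1) by (simp add: sx dist_norm norm_minus_commute)
      also have "\<dots> \<le> frame_const * integral {t0..\<tau>} ?sp" by (rule est(3))
      also have "\<dots> \<le> frame_const * integral {t0..t1} ?sp" using le frame_const(1) by (rule mult_left_mono)
      finally have far: "1 \<le> frame_const / r * integral {t0..t1} ?sp" using r by (simp add: field_simps)
      have "\<bar>exp (\<phi> x1) - exp (\<phi> x0)\<bar> \<le> h" by (rule abs_exp_diff_le(2)[OF h[OF x(2)] h[OF x(1)]])
      also have "\<dots> \<le> h * (frame_const / r * integral {t0..t1} ?sp)"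
        using mult_left_mono[OF far less_imp_le[OF h0]] by simp
      also have "\<dots> \<le> H * integral {t0..t1} ?sp"
      proof -
        have l0: "integral {t0..t1} ?sp \<ge> 0"
          by (rule Henstock_Kurzweil_Integration.integral_nonneg[OF est(1)]) (rule speed_nonneg)
        have "h * (frame_const / r) \<le> H" using h0 slope_nonneg by (simp add: H_def distrib_left)
        from mult_right_mono[OF this l0] show ?thesis by (simp add: mult.assoc)
      qed
      finally show ?thesis by (simp add: fd len)
    qed
  qed
  then show ?thesis using that[OF r(1) _ H0] r by simp
qed

end

section \<open>Lipschitz continuity for the two distances\<close>

lemma lipschitz_dist_cc:
  fixes x y :: real
  assumes H: "H > 0" and curves: "\<And>a b \<gamma>. horizontal_curve A \<Sigma> a b \<gamma> \<Longrightarrow> \<gamma> a = p \<Longrightarrow> \<gamma> b = q \<Longrightarrow>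
      \<bar>x - y\<bar> \<le> H * curve_length A g a b \<gamma>"
  shows "ereal \<bar>x - y\<bar> \<le> ereal H * dist_cc A g \<Sigma> p q"
proof -
  have "ereal (\<bar>x - y\<bar> / H) \<le> dist_cc A g \<Sigma> p q"
    unfolding dist_cc_def
  proof (rule Inf_greatest)
    fix l assume "l \<in> {ereal (curve_length A g a b \<gamma>) |a b \<gamma>. horizontal_curve A \<Sigma> a b \<gamma> \<and> \<gamma> a = p \<and> \<gamma> b = q}"
    then obtain a b \<gamma> where l: "l = ereal (curve_length A g a b \<gamma>)" "horizontal_curve A \<Sigma> a b \<gamma>" "\<gamma> a = p" "\<gamma> b = q"
      by blast
    show "ereal (\<bar>x - y\<bar> / H) \<le> l" using curves[OF l(2-4)] H by (simp add: l(1) field_simps)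
  qed
  then have "ereal H * ereal (\<bar>x - y\<bar> / H) \<le> ereal H * dist_cc A g \<Sigma> p q"
    using H by (intro ereal_mult_left_mono) auto
  then show ?thesis using H by simp
qed

lemma dist_cc_le_dist_H: "dist_cc A g \<Sigma> p q \<le> dist_H A g \<Sigma> p q"
  unfolding dist_cc_def dist_H_def by (rule Inf_superset_mono) (auto simp: broken_geodesic_def)

theorem theorem4p8:
  fixes A :: "('m::{t2_space,second_countable_topology}, 'e::euclidean_space) chart set"
    and g :: "'m \<Rightarrow> 'e \<Rightarrow> 'e \<Rightarrow> real"
    and k :: nat
    and \<Sigma> :: "'m \<Rightarrow> 'e set"
    and \<Omega> :: "'m set"
    and f :: "'m \<Rightarrow> real"
  assumes "sub_riemannian_manifold A g k \<Sigma>"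
    and "regular_distribution A \<Sigma>"
    and "connected (UNIV :: 'm set)"
    and "open \<Omega>"
    and "n_convex_set A g \<Sigma> \<Omega>"
    and "n_convex_fun A g \<Sigma> \<Omega> f"
    and "locally_bounded_above_on \<Omega> f"
  shows "locally_lipschitz_wrt (dist_cc A g \<Sigma>) \<Omega> f \<and> locally_lipschitz_wrt (dist_H A g \<Sigma>) \<Omega> f"
proof -
  have sr: "smooth_atlas A" "riemannian_metric A g" "k < DIM('e)" "distribution A k \<Sigma>"
    using assms(1) by (auto simp: sub_riemannian_manifold_def)
  interpret riemannian A g by unfold_locales (rule sr)+
  have bg: "bracket_generating A \<Sigma>" using assms(2) by (simp add: regular_distribution_def regular_at_def)
  have local: "\<exists>U H. open U \<and> p0 \<in> U \<and> U \<subseteq> \<Omega> \<and> 0 < H \<and> (\<forall>p\<in>U. \<forall>q\<in>U. ereal \<bar>f p - f q\<bar> \<le> ereal H * dist_cc A g \<Sigma> p q)"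
    if p0: "p0 \<in> \<Omega>" for p0
  proof -
    define c where "c = chart_at A p0"
    have c: "c \<in> A" "p0 \<in> fst c" using chart_at by (auto simp: c_def)
    obtain S0 Z where S0: "open S0" "snd c p0 \<in> S0" "S0 \<subseteq> snd c ` fst c" and Z: "\<forall>i<k. smooth_on S0 (Z i)"
      "\<forall>x\<in>S0. \<forall>i<k. \<forall>j<k. mc c x (Z i x) (Z j x) = (if i = j then 1 else 0)"
      "\<forall>x\<in>S0. to_coord A c (chart_inv c x) ` \<Sigma> (chart_inv c x) = span ((\<lambda>i. Z i x) ` {..<k})"
      using orthonormal_frame[OF sr(4) c] .
    obtain U K where U: "open U" "p0 \<in> U" "\<forall>x\<in>U \<inter> \<Omega>. f x \<le> K"
      using bspec[OF assms(7)[unfolded locally_bounded_above_on_def] p0] by blast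
    define S where "S = S0 \<inter> snd c ` (fst c \<inter> (U \<inter> \<Omega>))"
    have dom: "open S" "snd c p0 \<in> S" "S \<subseteq> snd c ` fst c" "S \<subseteq> S0"
      using open_chart_image[OF c(1), of "U \<inter> \<Omega>"] U assms(4) S0 c p0 by (auto simp: S_def)
    have inU: "chart_inv c x \<in> U \<inter> \<Omega>" if "x \<in> S" for x
      using that chart(5)[OF c(1)] by (auto simp: S_def)
    obtain \<beta>0 where "bij_betw \<beta>0 {0..<DIM('e)} (Basis :: 'e set)"
      using ex_bij_betw_nat_finite[OF finite_Basis] by blast
    then have \<beta>: "i < k \<Longrightarrow> \<beta>0 i \<in> Basis" and \<beta>_inj: "inj_on \<beta>0 {..<k}" for i
      using sr(3) by (auto simp: bij_betw_def intro: inj_on_subset)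
    interpret framed_chart A g \<Sigma> k c S Z \<beta>0
    proof
      show "smooth_on S (Z i)" if "i < k" for i
        by (rule smooth_on_subset[OF _ dom(4) open_thick[OF dom(1)]]) (use Z(1) that in simp)
      fix x assume "x \<in> S"
      then have x: "x \<in> S0" using dom(4) by (rule subsetD[rotated])
      show "mc c x (Z i x) (Z j x) = (if i = j then 1 else 0)" if "i < k" "j < k" for i j
        using Z(2) x that by simp
      show "to_coord A c (chart_inv c x) ` \<Sigma> (chart_inv c x) = span ((\<lambda>i. Z i x) ` {..<k})"
        using Z(3) x by simp
    qed (fact c(1) dom(1) dom(3) \<beta> \<beta>_inj)+
    have base: "(snd c p0, 0) \<in> S \<times> (UNIV :: 'e set)" "open (S \<times> (UNIV :: 'e set))" using dom by (auto simp: open_Times)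
    from smooth_imp_local_flow[OF geodesic_field_smooth base(2,1)]
    obtain R M L C T where fl: "cball (snd c p0, 0) R \<subseteq> S \<times> (UNIV :: 'e set)"
      "local_flow geodesic_field (\<lambda>z. Blinfun (frechet_derivative geodesic_field (at z))) (snd c p0, 0) R M L C T"
      by blast
    have "convex_chart A g \<Sigma> k c S Z \<beta>0 \<Omega> f (K + 1) (snd c p0) R M L C T"
    proof (intro convex_chart.intro convex_chart_axioms.intro)
      show "framed_chart A g \<Sigma> k c S Z \<beta>0" by unfold_locales
      show "n_convex_fun A g \<Sigma> \<Omega> f" by (rule assms(6))
      fix x assume "x \<in> S"
      from inU[OF this] have "chart_inv c x \<in> \<Omega>" "f (chart_inv c x) \<le> K" using U(3) by auto
      then show "chart_inv c x \<in> \<Omega>" "f (chart_inv c x) < K + 1" by auto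
    qed (rule fl)+
    then interpret convex_chart A g \<Sigma> k c S Z \<beta>0 \<Omega> f "K + 1" "snd c p0" R M L C T .
    obtain r H where r: "0 < r" "r \<le> R/4" "0 < H" and
      est: "\<forall>t0 t1 \<gamma>. horizontal_curve A \<Sigma> t0 t1 \<gamma> \<longrightarrow> \<gamma> t0 \<in> chart_inv c ` ball (snd c p0) r \<longrightarrow>
        \<gamma> t1 \<in> chart_inv c ` ball (snd c p0) r \<longrightarrow> \<bar>f (\<gamma> t0) - f (\<gamma> t1)\<bar> \<le> H * curve_length A g t0 t1 \<gamma>"
      using lipschitz_along_horizontal_curves[OF bg] .
    define V where "V = fst c \<inter> snd c -` ball (snd c p0) r"
    have V: "open V" unfolding V_def
      by (rule continuous_open_preimage[OF chart(3)[OF c(1)] chart(1)[OF c(1)] open_ball])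
    have Vimg: "p \<in> chart_inv c ` ball (snd c p0) r" if "p \<in> V" for p
      using that chart(5)[OF c(1), of p] by (intro image_eqI[of _ _ "snd c p"]) (auto simp: V_def)
    have "V \<subseteq> \<Omega>"
    proof
      fix p assume p: "p \<in> V"
      then have "snd c p \<in> ball (snd c p0) (R/4)" using r by (auto simp: V_def)
      then have "chart_inv c (snd c p) \<in> \<Omega>" using W_sub inU by blast
      then show "p \<in> \<Omega>" using p chart(5)[OF c(1)] by (simp add: V_def)
    qed
    moreover have "ereal \<bar>f p - f q\<bar> \<le> ereal H * dist_cc A g \<Sigma> p q" if "p \<in> V" "q \<in> V" for p q
    proof (rule lipschitz_dist_cc[OF r(3)])
      fix s t \<gamma> assume "horizontal_curve A \<Sigma> s t \<gamma>" "\<gamma> s = p" "\<gamma> t = q"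
      then show "\<bar>f p - f q\<bar> \<le> H * curve_length A g s t \<gamma>"
        using spec[OF spec[OF spec[OF est, of s], of t], of \<gamma>] Vimg[OF that(1)] Vimg[OF that(2)] by simp
    qed
    moreover have "p0 \<in> V" using c r by (simp add: V_def)
    ultimately show ?thesis using V r(3) by blast
  qed
  have "locally_lipschitz_wrt (dist_cc A g \<Sigma>) \<Omega> f"
    unfolding locally_lipschitz_wrt_def
  proof
    fix p0 assume "p0 \<in> \<Omega>"
    from local[OF this] obtain U H where U: "open U" "p0 \<in> U" "U \<subseteq> \<Omega>" "0 < H"
      "\<forall>p\<in>U. \<forall>q\<in>U. ereal \<bar>f p - f q\<bar> \<le> ereal H * dist_cc A g \<Sigma> p q" by (elim exE conjE)
    then show "\<exists>U L. open U \<and> p0 \<in> U \<and> U \<subseteq> \<Omega> \<and> (\<forall>p\<in>U. \<forall>q\<in>U. ereal \<bar>f p - f q\<bar> \<le> ereal L * dist_cc A g \<Sigma> p q)"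
      by (intro exI[of _ U] exI[of _ H] conjI)
  qed
  moreover have "locally_lipschitz_wrt (dist_H A g \<Sigma>) \<Omega> f"
    unfolding locally_lipschitz_wrt_def
  proof
    fix p0 assume "p0 \<in> \<Omega>"
    from local[OF this] obtain U H where U: "open U" "p0 \<in> U" "U \<subseteq> \<Omega>" "0 < H"
      "\<forall>p\<in>U. \<forall>q\<in>U. ereal \<bar>f p - f q\<bar> \<le> ereal H * dist_cc A g \<Sigma> p q" by (elim exE conjE)
    have "ereal \<bar>f p - f q\<bar> \<le> ereal H * dist_H A g \<Sigma> p q" if "p \<in> U" "q \<in> U" for p q
    proof -
      have "ereal \<bar>f p - f q\<bar> \<le> ereal H * dist_cc A g \<Sigma> p q" using U(5) that by simp
      also have "\<dots> \<le> ereal H * dist_H A g \<Sigma> p q"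
        using U(4) by (intro ereal_mult_left_mono dist_cc_le_dist_H) simp
      finally show ?thesis .
    qed
    then show "\<exists>U L. open U \<and> p0 \<in> U \<and> U \<subseteq> \<Omega> \<and> (\<forall>p\<in>U. \<forall>q\<in>U. ereal \<bar>f p - f q\<bar> \<le> ereal L * dist_H A g \<Sigma> p q)"
      using U(1-3) by (intro exI[of _ U] exI[of _ H] conjI ballI) auto
  qed
  ultimately show ?thesis by (rule conjI)
qed

end
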